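(* Let $\lambda>0$, let $\mathfrak p\in(0,1)$ with $\mathfrak p\ne\frac12$, let $k\in\mathbb N$, and let $\varphi(x)=\sum_{j=0}^k\beta_jx^j$ be a real polynomial with $\beta_k\ne0$. Let $\xi$ be the Poisson field of independent simple symmetric random walks on $\mathbb Z$ with parameter $\lambda$, and let $S=(S_n)_{n\in\mathbb N_0}$ be a nearest-neighbour random walk on $\mathbb Z$, independent of $\xi$ (and of all particle walks), with $S_0=0$ and i.i.d. increments equal to $+1$ with probability $\mathfrak p$ and to $-1$ with probability $1-\mathfrak p$ (so its drift $v=2\mathfrak p-1$ is non-zero). Put $$Y_{N,\varphi}=\sum_{n=1}^N\varphi(\xi(n,S_n)),\qquad \sigma_{N,\varphi}^2=\operatorname{Var}(Y_{N,\varphi}),\qquad F_{N,\varphi}=\frac{Y_{N,\varphi}-\mathbb E[Y_{N,\varphi}]}{\sigma_{N,\varphi}},$$ where expectation and variance are with respect to the joint law of $\xi$ and $S$, and let $Z\sim\mathcal N(0,1)$. Then there exists a constant $C_\varphi\in(0,\infty)$, depending on the fixed polynomial $\varphi$ (and the fixed model parameters $\lambda,\mathfrak p$) but not on $N$, such that for all $N\ge1$ $$d_W(F_{N,\varphi},Z)\le C_\varphi N^{-1/2}.$$ Moreover, there exists a constant $\mathfrak c_\varphi\in(0,\infty)$ such that $\sigma_{N,\varphi}^2=\mathfrak c_\varphi N+O(1)$ as $N\to\infty$; more precisely, $$\mathfrak c_\varphi=\sum_{q=1}^k c_{\varphi,q}^2\,q!\,\lambda^q\Bigl(1+2\sum_{t\ge1}a_t^{(q)}\Bigr),\qquad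 a_t^{(q)}=\mathbb E\bigl[Q_t(S_t)^q\bigr],$$ where $Q_t(x)$ is the $t$-step transition probability from $0$ to $x$ of the simple symmetric random walk on $\mathbb Z$, and $(c_{\varphi,q})_{1\le q\le k}$ are the Poisson--Charlier coefficients of the centered single-site observable $\varphi(\xi(n,x))-\mathbb E[\varphi(\xi(n,x))]$.
   Context: $\mathbb N=\{1,2,\dots\}$, $\mathbb N_0=\{0,1,2,\dots\}$. Poisson field of independent walks: let $\{\xi(0,y):y\in\mathbb Z\}$ be i.i.d. Poisson random variables with mean $\lambda$. Given these, at time $0$ place $\xi(0,y)$ particles at each $y\in\mathbb Z$; the particles perform independent simple symmetric random walks $X^{y,i}=(X^{y,i}_n)_{n\in\mathbb N_0}$ on $\mathbb Z$ with $X^{y,i}_0=y$. Define $\xi(n,x)=\sum_{y\in\mathbb Z}\sum_{i=1}^{\xi(0,y)}\mathbf 1_{\{X_n^{y,i}=x\}}$ for $n\in\mathbb N_0$, $x\in\mathbb Z$. Each $\xi(n,x)$ is Poisson with mean $\lambda$. Monic Charlier polynomials $C_r(\cdot;\lambda)$: $C_0\equiv1$, $C_1(x;\lambda)=x-\lambda$, and $(x-\lambda)C_r(x;\lambda)=C_{r+1}(x;\lambda)+rC_r(x;\lambda)+r\lambda C_{r-1}(x;\lambda)$ for $r\ge1$. They are orthogonal for the Poisson law: if $M\sim\mathrm{Poi}(\lambda)$, then $\mathbb E[C_r(M;\lambda)C_s(M;\lambda)]=\mathbf 1_{\{r=s\}}r!\lambda^r$. The Poisson--Charlier coefficients are $c_{\varphi,q}=\mathbb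 E[\varphi(M)C_q(M;\lambda)]/(q!\lambda^q)$, $1\le q\le k$, equivalently $\varphi(M)-\mathbb E[\varphi(M)]=\sum_{q=1}^kc_{\varphi,q}C_q(M;\lambda)$. Wasserstein distance: $d_W(F,Z)=\sup\{|\mathbb E h(F)-\mathbb E h(Z)|\}$, the supremum being over all $h:\mathbb R\to\mathbb R$ that are Lipschitz with constant at most $1$. *)

theory Defs
  imports "HOL-Probability.Probability"
begin

definition nn_step_pmf :: "real \<Rightarrow> int pmf" where
  "nn_step_pmf p = map_pmf (\<lambda>b. if b then 1 else - 1) (bernoulli_pmf p)"

primrec nn_walk_pmf :: "real \<Rightarrow> nat \<Rightarrow> int pmf" where
  "nn_walk_pmf p 0 = return_pmf 0"
| "nn_walk_pmf p (Suc t) =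
     bind_pmf (nn_walk_pmf p t) (\<lambda>x. map_pmf (\<lambda>s. x + s) (nn_step_pmf p))"

definition srw_trans :: "nat \<Rightarrow> int \<Rightarrow> real" where
  "srw_trans t x = pmf (nn_walk_pmf (1 / 2) t) x"

text \<open>
  The randomness of the model is driven by the initial occupation numbers, the steps of the
  particles and the steps of the walker \<open>S\<close>. The joint independence of this whole family says at
  once that the initial occupation numbers, the individual particle walks and \<open>S\<close> are independent,
  and that each walk has independent increments. Occupation numbers are read as integers only to
  make the family homogeneously typed.
\<close>

datatype source = Initial int | Particle int nat nat | Walker nat

fun driver ::
  "(int \<Rightarrow> 'a \<Rightarrow> nat) \<Rightarrow> (int \<Rightarrow> nat \<Rightarrow> nat \<Rightarrow> 'a \<Rightarrow> int) \<Rightarrow> (nat \<Rightarrow> 'a \<Rightarrow> int) \<Rightarrow> source \<Rightarrow> 'a \<Rightarrow> int"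
where
  "driver \<eta> X S (Initial y) \<omega> = int (\<eta> y \<omega>)"
| "driver \<eta> X S (Particle y i n) \<omega> = X y i (Suc n) \<omega> - X y i n \<omega>"
| "driver \<eta> X S (Walker n) \<omega> = S (Suc n) \<omega> - S n \<omega>"

text \<open>
  \<open>\<eta> y\<close> is the initial number of particles at \<open>y\<close>, \<open>X y i n\<close> the position at time \<open>n\<close> of the
  \<open>i\<close>-th particle started at \<open>y\<close>. Particles at a site are numbered from 0, so those present are
  the ones with \<open>i < \<eta> y\<close>.
\<close>

locale walk_in_poisson_field = prob_space M
  for M :: "'a measure" +
  fixes lam \<pp> :: real
    and \<eta> :: "int \<Rightarrow> 'a \<Rightarrow> nat"
    and X :: "int \<Rightarrow> nat \<Rightarrow> nat \<Rightarrow> 'a \<Rightarrow> int"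
    and S :: "nat \<Rightarrow> 'a \<Rightarrow> int"
  assumes initial_law: "\<And>y. distr M (count_space UNIV) (\<eta> y) = measure_pmf (poisson_pmf lam)"
    and particle_start: "\<And>y i \<omega>. \<omega> \<in> space M \<Longrightarrow> X y i 0 \<omega> = y"
    and particle_law: "\<And>y i n. distr M (count_space UNIV) (\<lambda>\<omega>. X y i (Suc n) \<omega> - X y i n \<omega>)
                         = measure_pmf (nn_step_pmf (1 / 2))"
    and walker_start: "\<And>\<omega>. \<omega> \<in> space M \<Longrightarrow> S 0 \<omega> = 0"
    and walker_law: "\<And>n. distr M (count_space UNIV) (\<lambda>\<omega>. S (Suc n) \<omega> - S n \<omega>)
                         = measure_pmf (nn_step_pmf \<pp>)"
    and independent: "indep_vars (\<lambda>_. count_space UNIV) (driver \<eta> X S) UNIV"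

text \<open>
  Almost surely only the sites \<open>y\<close> with \<open>\<bar>y - x\<bar> \<le> n\<close> contribute to the infinite sum.
\<close>

definition field ::
  "(int \<Rightarrow> 'a \<Rightarrow> nat) \<Rightarrow> (int \<Rightarrow> nat \<Rightarrow> nat \<Rightarrow> 'a \<Rightarrow> int) \<Rightarrow> nat \<Rightarrow> int \<Rightarrow> 'a \<Rightarrow> nat" where
  "field \<eta> X n x \<omega> = (\<Sum>\<^sub>\<infinity>y. \<Sum>i<\<eta> y \<omega>. of_bool (X y i n \<omega> = x))"

definition additive_functional ::
  "(real \<Rightarrow> real) \<Rightarrow> (int \<Rightarrow> 'a \<Rightarrow> nat) \<Rightarrow> (int \<Rightarrow> nat \<Rightarrow> nat \<Rightarrow> 'a \<Rightarrow> int) \<Rightarrow> (nat \<Rightarrow> 'a \<Rightarrow> int)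
    \<Rightarrow> nat \<Rightarrow> 'a \<Rightarrow> real" where
  "additive_functional \<phi> \<eta> X S N \<omega> = (\<Sum>n=1..N. \<phi> (real (field \<eta> X n (S n \<omega>) \<omega>)))"

definition standardized :: "'a measure \<Rightarrow> ('a \<Rightarrow> real) \<Rightarrow> 'a \<Rightarrow> real" where
  "standardized M Y \<omega> =
     (Y \<omega> - prob_space.expectation M Y) / sqrt (prob_space.variance M Y)"

definition wasserstein_dist :: "real measure \<Rightarrow> real measure \<Rightarrow> ereal" where
  "wasserstein_dist \<mu> \<nu> =
     (SUP h \<in> {h. 1-lipschitz_on UNIV h}. ereal \<bar>(\<integral>x. h x \<partial>\<mu>) - (\<integral>x. h x \<partial>\<nu>)\<bar>)"

fun charlier :: "real \<Rightarrow> nat \<Rightarrow> real \<Rightarrow> real" where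
  "charlier lam 0 x = 1"
| "charlier lam (Suc 0) x = x - lam"
| "charlier lam (Suc (Suc r)) x =
     (x - lam) * charlier lam (Suc r) x - real (Suc r) * charlier lam (Suc r) x
       - real (Suc r) * lam * charlier lam r x"

definition charlier_coeff :: "real \<Rightarrow> (real \<Rightarrow> real) \<Rightarrow> nat \<Rightarrow> real" where
  "charlier_coeff lam \<phi> q =
     measure_pmf.expectation (poisson_pmf lam) (\<lambda>m. \<phi> (real m) * charlier lam q (real m))
       / (fact q * lam ^ q)"

definition overlap :: "'a measure \<Rightarrow> (nat \<Rightarrow> 'a \<Rightarrow> int) \<Rightarrow> nat \<Rightarrow> nat \<Rightarrow> real" where
  "overlap M S q t = prob_space.expectation M (\<lambda>\<omega>. srw_trans t (S t \<omega>) ^ q)"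

end

theory Submission
  imports Defs "HOL-Real_Asymp.Real_Asymp"
begin

text \<open>
  Condition on the walker's path. A particle that ever meets the walker is recorded at the time of
  its first meeting, together with its whole path; by the Poisson property and time reversal, the
  particles recorded at time \<open>m\<close> may be realized as those members of a fresh Poisson cloud of walks
  through the walker's position at time \<open>m\<close> whose past avoids the walker. A comparison of
  generating functions shows that this has the right joint law. Thus the functional becomes a sum of
  causal functions \<open>v n\<close> of independent blocks (walker step, cloud), and a block at time \<open>j\<close>
  influences \<open>v n\<close> only if some particle meets the walker both before \<open>j\<close> and at \<open>n\<close>; since the walker
  has a drift, the probability of this is exponentially small in \<open>n - j\<close>.

  For such functionals Stein's method applies: resampling the blocks one after the other yields a
  random variable \<open>T\<close> of mean \<open>\<sigma>\<^sup>2\<close> with \<open>E (F g(F)) = E (g'(F) T) / \<sigma>\<^sup>2\<close> up to third moments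
  of the differences, and the Efron--Stein inequality bounds the variance of \<open>T\<close> by a multiple of
  \<open>N\<close>. The variance itself is read off from the Charlier expansion, whose two-point covariances are
  diagonal with eigenvalues \<open>q! \<lambda>\<^sup>q a\<^sub>t\<close>.
\<close>

subsection \<open>Stein's equation\<close>

text \<open>In the original description no independent source is attached to a single time: every
  initial site feeds all times at once, so resampling one site disturbs the whole sum. Indexing
  particles by first meetings manufactures a time index. Keeping the past of each path is the price,
  since freshness has to be decided from the block and the earlier walker steps. Only the joint law
  of the occupation numbers seen by the walker enters the claim, so equality of generating functions
  is enough and no coupling is constructed.

  Fourth moments are the natural scale because \<open>T\<close> is a sum of products of two
  differences, and its own differences are squared in the Efron-Stein bound. The variance in the
  denominator is harmless for every \<open>N\<close>, not only for large ones: powers of transition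
  probabilities are nonnegative, so all covariances are nonnegative and the variance is at least
  \<open>N\<close> times that of a single summand.\<close>

definition gw :: "real \<Rightarrow> real" where "gw t = exp (- t\<^sup>2 / 2)"

lemma gw_pos: "gw t > 0" by (simp add: gw_def)

lemma gw_density: "gw t = sqrt (2 * pi) * std_normal_density t"
  by (simp add: gw_def std_normal_density_def)

lemma continuous_gw [continuous_intros]: "continuous_on A gw"
  unfolding gw_def by (intro continuous_intros) auto

lemma isCont_gw: "isCont gw t"
  using continuous_gw[of UNIV] by (simp add: continuous_on_eq_continuous_at)

lemma gw_borel [measurable]: "gw \<in> borel_measurable borel"
  by (intro borel_measurable_continuous_onI continuous_gw)

lemma integrable_gw_moment: "integrable lborel (\<lambda>t. t ^ k * gw t)"
  using integrable_mult_right[OF integrable_std_normal_moment[of k], of "sqrt (2*pi)"]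
  by (simp add: gw_density mult_ac)

lemma DERIV_gw: "(gw has_real_derivative - t * gw t) (at t)"
  unfolding gw_def by (auto intro!: derivative_eq_intros)

text \<open>Partial moments of the unnormalized Gaussian weight. Only quotients by \<open>gw\<close>
  matter, such as the Mills ratio \<open>gtail 0 x / gw x\<close>, and there the normalization
  cancels.\<close>

definition gtail :: "nat \<Rightarrow> real \<Rightarrow> real" where
  "gtail k x = (LBINT t:{x<..}. t ^ k * gw t)"

lemma set_integrable_gw: "A \<in> sets borel \<Longrightarrow> set_integrable lborel A (\<lambda>t. t ^ k * gw t)"
  unfolding set_integrable_def using integrable_gw_moment[of k]
  by (intro integrable_mult_indicator) auto

text \<open>With an antiderivative that vanishes at infinity a tail integral is a boundary value.
  The closed forms below use the antiderivatives \<open>- gw t\<close>, \<open>- (t * gw t)\<close>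
  and \<open>- ((t\<^sup>2 + 2) * gw t)\<close>.\<close>

lemma gaussian_FTC:
  assumes P: "\<And>t. (P has_real_derivative f t) (at t)" and f: "\<And>t. isCont f t"
    "set_integrable lborel {x<..} f" "(P \<longlongrightarrow> 0) at_top"
  shows "(LBINT t:{x<..}. f t) = - P x"
proof -
  have *: "(P \<longlongrightarrow> P x) (at_right x)"
    using DERIV_isCont[OF P, of x] by (simp add: isCont_def filterlim_at_split)
  have "(LBINT t=ereal x..\<infinity>. f t) = 0 - P x"
    using assms
    using * by (intro interval_integral_FTC_integrable[where F=P])
       (auto simp: has_real_derivative_iff_has_vector_derivative[symmetric] einterval_eq_Ici
          ereal_tendsto_simps1)
  then show ?thesis by (simp add: interval_integral_to_infinity_eq)
qed

lemma gw_moment_tendsto_0: "((\<lambda>t. t ^ k * gw t) \<longlongrightarrow> 0) at_top"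
  unfolding gw_def by real_asymp

lemma gtail_1: "gtail 1 x = gw x"
proof -
  have "(LBINT t:{x<..}. t ^ 1 * gw t) = - (- gw x)"
    using gw_moment_tendsto_0[of 0]
    by (intro gaussian_FTC set_integrable_gw)
       (auto intro!: derivative_eq_intros DERIV_gw isCont_gw continuous_intros tendsto_eq_intros)
  then show ?thesis by (simp add: gtail_def)
qed

lemma gtail_2: "gtail 2 x = x * gw x + gtail 0 x"
proof -
  have "(LBINT t:{x<..}. t ^ 2 * gw t - t ^ 0 * gw t) = - (- (x * gw x))"
    using gw_moment_tendsto_0[of 1, THEN tendsto_minus]
    by (intro gaussian_FTC set_integral_diff set_integrable_gw)
       (auto intro!: derivative_eq_intros DERIV_gw isCont_gw continuous_intros
         simp: power2_eq_square algebra_simps)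
  then show ?thesis using set_integral_diff(2)[OF set_integrable_gw set_integrable_gw, of "{x<..}" 2 0]
    by (simp add: gtail_def)
qed

lemma gtail_3: "gtail 3 x = (x\<^sup>2 + 2) * gw x"
proof -
  have lim: "((\<lambda>t. - ((t\<^sup>2 + 2) * gw t)) \<longlongrightarrow> 0) at_top"
    unfolding gw_def by real_asymp
  have "(LBINT t:{x<..}. t ^ 3 * gw t) = - (- ((x\<^sup>2 + 2) * gw x))"
    by (intro gaussian_FTC set_integrable_gw lim)
       (auto intro!: derivative_eq_intros DERIV_gw isCont_gw continuous_intros
         simp: power2_eq_square power3_eq_cube algebra_simps)
  then show ?thesis by (simp add: gtail_def)
qed

text \<open>Four monomials suffice because the polynomial of highest degree needed is
  \<open>(t - x) ^ 3\<close>; shorter ones are padded with zero coefficients.\<close>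

lemma gtail_shift_integral:
  "set_integrable lborel {x<..} (\<lambda>t. (a * t ^ i + b * t ^ j + c * t ^ k + d * t ^ l) * gw t)"
  "(LBINT t:{x<..}. (a * t ^ i + b * t ^ j + c * t ^ k + d * t ^ l) * gw t)
     = a * gtail i x + b * gtail j x + c * gtail k x + d * gtail l x"
  by (simp_all add: gtail_def set_integrable_gw set_integral_add distrib_right mult.assoc)

lemma gtail_nonneg:
  assumes "\<And>t. t > x \<Longrightarrow> f t \<ge> 0" shows "(LBINT t:{x<..}. f t) \<ge> (0::real)"
  unfolding set_lebesgue_integral_def using assms by (auto intro!: integral_nonneg simp: indicator_def)

lemma gtail_0_nonneg: "gtail 0 x \<ge> 0"
  unfolding gtail_def by (rule gtail_nonneg) (use gw_pos in \<open>simp add: less_imp_le\<close>)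

lemma gtail_0_le_3: "gtail 0 x \<le> 3"
proof -
  have "gtail 0 x \<le> (\<integral>t. gw t \<partial>lborel)"
    unfolding gtail_def set_lebesgue_integral_def using integrable_gw_moment[of 0] gw_pos
    by (intro integral_mono_AE set_integrable_gw[unfolded set_integrable_def])
       (auto simp: indicator_def less_imp_le)
  also have "\<dots> = sqrt (2 * pi)"
    using integral_std_normal_moment_even[of 0] by (simp add: gw_density)
  also have "\<dots> \<le> 3" using pi_less_4 by (intro real_le_lsqrt) (auto simp: )
  finally show ?thesis .
qed

text \<open>The tail integrals of \<open>t - x\<close>, its square and its cube against
  \<open>gw\<close> are nonnegative. Expressed through \<open>gtail 0\<close> and \<open>gw\<close>
  they give alternately upper and lower bounds for the Mills ratio, in this lemma and the next
  two.\<close>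

lemma mills_1: "x * gtail 0 x \<le> gw x"
proof -
  have "(LBINT t:{x<..}. (1 * t ^ 1 + (- x) * t ^ 0 + 0 * t ^ 0 + 0 * t ^ 0) * gw t) \<ge> 0"
    by (rule gtail_nonneg) (use gw_pos in \<open>auto intro!: mult_nonneg_nonneg less_imp_le\<close>)
  then show ?thesis unfolding gtail_shift_integral by (simp add: gtail_1[simplified])
qed

lemma mills_2: "x * gw x \<le> (1 + x\<^sup>2) * gtail 0 x"
proof -
  have "(LBINT t:{x<..}. (1 * t ^ 2 + (- 2 * x) * t ^ 1 + x\<^sup>2 * t ^ 0 + 0 * t ^ 0) * gw t) \<ge> 0"
  proof (rule gtail_nonneg)
    fix t :: real
    have "(1 * t ^ 2 + (- 2 * x) * t ^ 1 + x\<^sup>2 * t ^ 0 + 0 * t ^ 0) = (t - x)^2"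
      by (simp add: power2_eq_square algebra_simps)
    then show "0 \<le> (1 * t ^ 2 + (- 2 * x) * t ^ 1 + x\<^sup>2 * t ^ 0 + 0 * t ^ 0) * gw t"
      using gw_pos[of t] by simp
  qed
  then show ?thesis unfolding gtail_shift_integral gtail_2 gtail_1 by (simp add: algebra_simps)
qed

lemma mills_3: "(3 * x + x ^ 3) * gtail 0 x \<le> (x\<^sup>2 + 2) * gw x"
proof -
  have "(LBINT t:{x<..}. (1 * t ^ 3 + (- 3 * x) * t ^ 2 + (3 * x\<^sup>2) * t ^ 1 + (- (x ^ 3)) * t ^ 0) * gw t) \<ge> 0"
  proof (rule gtail_nonneg)
    fix t :: real assume t: "x < t"
    have "(1 * t ^ 3 + (- 3 * x) * t ^ 2 + (3 * x\<^sup>2) * t ^ 1 + (- (x ^ 3)) * t ^ 0) = (t - x)^3"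
      by (simp add: power2_eq_square power3_eq_cube algebra_simps)
    then show "0 \<le> (1 * t ^ 3 + (- 3 * x) * t ^ 2 + (3 * x\<^sup>2) * t ^ 1 + (- (x ^ 3)) * t ^ 0) * gw t"
      using gw_pos[of t] t by simp
  qed
  then show ?thesis unfolding gtail_shift_integral gtail_3 gtail_2 gtail_1
    by (simp add: algebra_simps power2_eq_square power3_eq_cube)
qed

definition normal_mean :: "(real \<Rightarrow> real) \<Rightarrow> real" where
  "normal_mean h = (LINT t|lborel. std_normal_density t * h t)"

definition stein_tail :: "(real \<Rightarrow> real) \<Rightarrow> real \<Rightarrow> real" where
  "stein_tail h x = (LBINT t:{x<..}. (h t - normal_mean h) * gw t)"

text \<open>The integrating factor of Stein's equation is \<open>gw\<close>. Other solutions grow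
  like \<open>1 / gw\<close>; this one does not, because the tail takes care of plus infinity and
  the vanishing total integral makes it the left-tail solution as well.\<close>

definition stein_sol :: "(real \<Rightarrow> real) \<Rightarrow> real \<Rightarrow> real" where
  "stein_sol h x = - stein_tail h x / gw x"

context
  fixes h :: "real \<Rightarrow> real"
  assumes lip: "1-lipschitz_on UNIV h"
begin

lemma lip_abs: "\<bar>h x - h y\<bar> \<le> \<bar>x - y\<bar>"
  using lipschitz_onD[OF lip, of x y] by (simp add: dist_real_def)

lemma lip_cont: "continuous_on A h"
  using lipschitz_on_continuous_on[OF lip] continuous_on_subset by blast

lemma lip_borel [measurable]: "h \<in> borel_measurable borel"
  by (intro borel_measurable_continuous_onI lip_cont)

lemma lip_integrable: "integrable lborel (\<lambda>t. (h t - c) * gw t)"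
proof (rule Bochner_Integration.integrable_bound)
  show "integrable lborel (\<lambda>t. \<bar>t ^ 1 * gw t\<bar> + \<bar>h 0 - c\<bar> * (t ^ 0 * gw t))"
    by (intro Bochner_Integration.integrable_add integrable_abs integrable_mult_right integrable_gw_moment)
  show "AE t in lborel. norm ((h t - c) * gw t) \<le> norm (\<bar>t ^ 1 * gw t\<bar> + \<bar>h 0 - c\<bar> * (t ^ 0 * gw t))"
  proof (rule AE_I2)
    fix t
    have "\<bar>h t - c\<bar> \<le> \<bar>t\<bar> + \<bar>h 0 - c\<bar>" using lip_abs[of t 0] by auto
    then have "\<bar>h t - c\<bar> * gw t \<le> (\<bar>t\<bar> + \<bar>h 0 - c\<bar>) * gw t"
      using gw_pos[of t] by (intro mult_right_mono) auto
    then show "norm ((h t - c) * gw t) \<le> norm (\<bar>t ^ 1 * gw t\<bar> + \<bar>h 0 - c\<bar> * (t ^ 0 * gw t))"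
      using gw_pos[of t] by (simp add: abs_mult distrib_right)
  qed
qed auto

lemma lip_set_integrable: "A \<in> sets borel \<Longrightarrow> set_integrable lborel A (\<lambda>t. (h t - c) * gw t)"
  unfolding set_integrable_def by (intro integrable_mult_indicator lip_integrable) auto

lemma lip_normal_integrable: "integrable lborel (\<lambda>t. std_normal_density t * h t)"
proof -
  have "integrable lborel (\<lambda>t. (1 / sqrt (2 * pi)) * ((h t - 0) * gw t))"
    by (intro integrable_mult_right lip_integrable)
  then show ?thesis by (simp add: gw_density mult.commute)
qed

lemma stein_total: "(LINT t|lborel. (h t - normal_mean h) * gw t) = 0"
proof -
  have d: "(LINT t|lborel. std_normal_density t) = 1" "integrable lborel std_normal_density"
    using integral_std_normal_moment_even[of 0] integrable_std_normal_moment[of 0] by simp_all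
  have "(LINT t|lborel. (h t - normal_mean h) * gw t)
      = (LINT t|lborel. sqrt (2*pi) * (std_normal_density t * h t - normal_mean h * std_normal_density t))"
    by (intro Bochner_Integration.integral_cong) (auto simp: gw_density algebra_simps)
  also have "\<dots> = sqrt (2*pi) * (normal_mean h - normal_mean h * 1)"
    using lip_normal_integrable d by (simp add: normal_mean_def)
  finally show ?thesis by simp
qed

text \<open>The Lipschitz bound is averaged over a normal variable, whose mean absolute value sqrt
  (2 / pi) is at most 1.\<close>

lemma lip_normal_mean: "\<bar>h x - normal_mean h\<bar> \<le> \<bar>x\<bar> + 1"
proof -
  have d: "(LINT t|lborel. std_normal_density t) = 1" "integrable lborel std_normal_density"
    using integral_std_normal_moment_even[of 0] integrable_std_normal_moment[of 0] by simp_all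
  have i: "integrable lborel (\<lambda>t. std_normal_density t * \<bar>t\<bar>)"
    using integrable_std_normal_moment_abs[of 1] by simp
  have "(LINT t|lborel. std_normal_density t * \<bar>t\<bar>) = sqrt (2 / pi)"
    using integral_std_normal_moment_abs_odd[of 0] by simp
  also have "\<dots> \<le> 1" using pi_gt3 by simp
  finally have le: "(LINT t|lborel. std_normal_density t * \<bar>t\<bar>) \<le> 1" .
  have "\<bar>h x - normal_mean h\<bar> = \<bar>LINT t|lborel. h x * std_normal_density t - std_normal_density t * h t\<bar>"
    using lip_normal_integrable d by (simp add: normal_mean_def)
  also have "\<dots> \<le> (LINT t|lborel. \<bar>h x * std_normal_density t - std_normal_density t * h t\<bar>)"
    by (rule integral_abs_bound)
  also have "\<dots> \<le> (LINT t|lborel. \<bar>x\<bar> * std_normal_density t + std_normal_density t * \<bar>t\<bar>)"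
  proof (intro integral_mono)
    fix t
    have "\<bar>h x - h t\<bar> \<le> \<bar>x\<bar> + \<bar>t\<bar>" using lip_abs[of x t] by auto
    then have "std_normal_density t * \<bar>h x - h t\<bar> \<le> std_normal_density t * (\<bar>x\<bar> + \<bar>t\<bar>)"
      by (intro mult_left_mono) auto
    moreover have "\<bar>h x * std_normal_density t - std_normal_density t * h t\<bar> = std_normal_density t * \<bar>h x - h t\<bar>"
      by (simp add: abs_mult[symmetric] abs_mult_pos' algebra_simps)
    ultimately show "\<bar>h x * std_normal_density t - std_normal_density t * h t\<bar>
        \<le> \<bar>x\<bar> * std_normal_density t + std_normal_density t * \<bar>t\<bar>"
      by (simp add: algebra_simps)
  qed (use lip_normal_integrable d i in auto)
  also have "\<dots> \<le> \<bar>x\<bar> + 1" using d i le by simp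
  finally show ?thesis .
qed

lemma stein_tail_DERIV: "(stein_tail h has_real_derivative - ((h x - normal_mean h) * gw x)) (at x)"
proof -
  let ?H = "\<lambda>t. (h t - normal_mean h) * gw t"
  let ?c = "x - 1"
  have int: "interval_lebesgue_integrable lborel a b ?H" for a b
    unfolding interval_lebesgue_integrable_def
    using lip_set_integrable by auto
  \<comment> \<open>Splitting at the fixed point \<open>x - 1\<close> leaves a proper integral as
    the only part that varies with \<open>u\<close>.\<close>
  have eq: "stein_tail h u = stein_tail h ?c - (LBINT t=?c..u. ?H t)" for u
  proof -
    have "(LBINT t=?c..u. ?H t) + (LBINT t=u..\<infinity>. ?H t) = (LBINT t=?c..\<infinity>. ?H t)"
      by (intro interval_integral_sum int)
    then show ?thesis by (simp add: stein_tail_def interval_integral_to_infinity_eq)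
  qed
  have "((\<lambda>u. LBINT t=?c..u. ?H t) has_vector_derivative ?H x) (at x within {?c..x + 1})"
    by (intro interval_integral_FTC2 continuous_on_mult continuous_on_diff continuous_on_const lip_cont continuous_gw) auto
  then have "((\<lambda>u. LBINT t=?c..u. ?H t) has_real_derivative ?H x) (at x)"
    by (simp add: has_real_derivative_iff_has_vector_derivative at_within_Icc_at)
  then show ?thesis
    by (subst eq[abs_def], intro DERIV_cong[OF DERIV_diff[OF DERIV_const]]) auto
qed

lemma stein_sol_DERIV: "(stein_sol h has_real_derivative x * stein_sol h x + h x - normal_mean h) (at x)"
proof -
  have w: "gw x \<noteq> 0" using gw_pos[of x] by simp
  have "(stein_sol h has_real_derivative
      (- (- ((h x - normal_mean h) * gw x)) * gw x - (- stein_tail h x) * (- x * gw x)) / (gw x * gw x)) (at x)"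
    unfolding stein_sol_def[abs_def] by (intro DERIV_divide DERIV_minus stein_tail_DERIV DERIV_gw w)
  also have "(- (- ((h x - normal_mean h) * gw x)) * gw x - (- stein_tail h x) * (- x * gw x)) / (gw x * gw x)
      = x * stein_sol h x + h x - normal_mean h"
    using w by (simp add: stein_sol_def field_simps)
  finally show ?thesis .
qed

text \<open>
  The second bound controls the derivative of \<open>x * g x\<close> for the solution \<open>g\<close>, so that \<open>g'\<close> is
  Lipschitz although \<open>h\<close> need not be differentiable.
\<close>
lemma stein_bounds_pos:
  assumes x: "x \<ge> 0"
  shows "\<bar>x * stein_sol h x + h x - normal_mean h\<bar> \<le> 3"
    and "\<bar>stein_sol h x * (1 + x\<^sup>2) + x * (h x - normal_mean h)\<bar> \<le> 25"
proof -
  define m where "m = h x - normal_mean h"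
  \<comment> \<open>Centring at \<open>h x\<close> instead of at the mean leaves increments of
    \<open>h\<close>, which are at most \<open>t - x\<close>; so \<open>R\<close> is bounded by the
    first shifted tail moment.\<close>
  define R where "R = (LBINT t:{x<..}. (h t - h x) * gw t)"
  define a where "a = gtail 0 x / gw x"
  define b where "b = R / gw x"
  have w: "gw x > 0" by (rule gw_pos)
  have tail: "stein_tail h x = R + m * gtail 0 x"
  proof -
    have "stein_tail h x = (LBINT t:{x<..}. (h t - h x) * gw t + m * (t ^ 0 * gw t))"
      unfolding stein_tail_def by (intro set_lebesgue_integral_cong) (auto simp: m_def algebra_simps)
    also have "\<dots> = R + m * gtail 0 x"
      unfolding R_def gtail_def
      using lip_set_integrable[of "{x<..}" "h x"] set_integrable_gw[of "{x<..}" 0] by simp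
    finally show ?thesis .
  qed
  have sol: "stein_sol h x = - (b + m * a)"
    unfolding stein_sol_def tail a_def b_def by (simp add: add_divide_distrib diff_divide_distrib)
  have "\<bar>R\<bar> \<le> (LBINT t:{x<..}. (1 * t ^ 1 + (- x) * t ^ 0 + 0 * t ^ 0 + 0 * t ^ 0) * gw t)"
    unfolding R_def set_lebesgue_integral_def
  proof (rule order_trans[OF integral_abs_bound integral_mono])
    show "integrable lborel (\<lambda>t. \<bar>indicat_real {x<..} t *\<^sub>R ((h t - h x) * gw t)\<bar>)"
      using lip_set_integrable[of "{x<..}" "h x"] unfolding set_integrable_def
      by (intro integrable_abs) auto
    show "integrable lborel (\<lambda>t. indicat_real {x<..} t *\<^sub>R ((1 * t ^ 1 + (- x) * t ^ 0 + 0 * t ^ 0 + 0 * t ^ 0) * gw t))"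
      using gtail_shift_integral(1) unfolding set_integrable_def .
    show "\<bar>indicat_real {x<..} t *\<^sub>R ((h t - h x) * gw t)\<bar>
      \<le> indicat_real {x<..} t *\<^sub>R ((1 * t ^ 1 + (- x) * t ^ 0 + 0 * t ^ 0 + 0 * t ^ 0) * gw t)" for t
      using lip_abs[of t x] gw_pos[of t] by (auto simp: indicator_def abs_mult)
  qed
  then have R: "\<bar>R\<bar> \<le> gw x - x * gtail 0 x"
    unfolding gtail_shift_integral gtail_1 by simp
  have a0: "a \<ge> 0" unfolding a_def using gtail_0_nonneg w by simp
  have a1: "x * a \<le> 1" using mills_1[of x] w by (simp add: a_def field_simps)
  have a2: "x \<le> (1 + x\<^sup>2) * a" using mills_2[of x] w by (simp add: a_def field_simps)
  have a3: "(3 * x + x ^ 3) * a \<le> x\<^sup>2 + 2" using mills_3[of x] w by (simp add: a_def field_simps)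
  have b: "\<bar>b\<bar> \<le> 1 - x * a"
    unfolding b_def a_def abs_divide using R w by (simp add: field_simps)
  have m: "\<bar>m\<bar> \<le> x + 1" using lip_normal_mean[of x] x by (simp add: m_def)
  \<comment> \<open>\<open>J\<close> is the defect in \<open>mills_1\<close> divided by
    \<open>gw x\<close>. By \<open>mills_2\<close> it is at most 1 / (1 + x^2), which beats the
    linear growth of \<open>m\<close>; the remainder \<open>b\<close> is bounded by the same
    quantity.\<close>
  define J where "J = 1 - x * a"
  have J0: "J \<ge> 0" using a1 by (simp add: J_def)
  have "x * x \<le> x * ((1 + x\<^sup>2) * a)" using a2 x by (rule mult_left_mono)
  then have J1: "(1 + x\<^sup>2) * J \<le> 1" by (simp add: J_def algebra_simps power2_eq_square)
  have J: "J \<le> 1" using x a0 by (simp add: J_def)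
  have "(x - 1)\<^sup>2 \<ge> 0" by simp
  then have xle: "2 * x \<le> 1 + x\<^sup>2" by (simp add: power2_eq_square algebra_simps)
  have xJ: "2 * (x * J) \<le> 1" using mult_right_mono[OF xle J0] J1 by (simp add: algebra_simps)
  have "x * stein_sol h x + h x - normal_mean h = m * J - x * b"
    unfolding sol J_def m_def by (simp add: algebra_simps)
  also have "\<bar>\<dots>\<bar> \<le> \<bar>m\<bar> * J + x * \<bar>b\<bar>"
    using x J0 abs_triangle_ineq4[of "m * J" "x * b"] by (simp add: abs_mult)
  also have "\<dots> \<le> (x + 1) * J + x * J"
    using m b J0 x by (intro add_mono mult_right_mono mult_left_mono) (auto simp: J_def)
  also have "\<dots> \<le> 3" using xJ J by (simp add: algebra_simps)
  finally show "\<bar>x * stein_sol h x + h x - normal_mean h\<bar> \<le> 3" .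
  \<comment> \<open>\<open>K\<close> is the defect in \<open>mills_2\<close> divided by
    \<open>gw x\<close> and has to compensate the linear growth of \<open>m\<close>. For large
    \<open>x\<close> this follows from \<open>mills_3\<close>. On [0, 1] crude bounds do:
    \<open>gw x\<close> is at least 1/2, so \<open>a \<le> 6\<close> and \<open>K \<le> 12\<close>,
    whence 24.\<close>
  define K where "K = (1 + x\<^sup>2) * a - x"
  have K0: "K \<ge> 0" using a2 by (simp add: K_def)
  have KB: "(x + 1) * K \<le> 24"
  proof (cases "x \<le> 1")
    case True
    have "gw x \<ge> 1 + (- x\<^sup>2 / 2)" unfolding gw_def by (rule exp_ge_add_one_self)
    moreover have "x\<^sup>2 \<le> 1" using True x by (simp add: power_le_one)
    ultimately have "gw x \<ge> 1 / 2" by simp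
    then have "gtail 0 x / gw x \<le> 3 / (1 / 2)"
      using gtail_0_le_3[of x] gtail_0_nonneg by (intro frac_le) auto
    then have "a \<le> 6" by (simp add: a_def)
    moreover have "(1 + x\<^sup>2) * a \<le> 2 * a" using \<open>x\<^sup>2 \<le> 1\<close> a0 by (intro mult_right_mono) auto
    ultimately have "K \<le> 12" using x by (simp add: K_def)
    then have "(x + 1) * K \<le> 2 * 12" using True K0 x by (intro mult_mono) auto
    then show ?thesis by simp
  next
    case False
    have "(x\<^sup>2 + 3) * (x * K) = (1 + x\<^sup>2) * ((3 * x + x ^ 3) * a) - x\<^sup>2 * (x\<^sup>2 + 3)"
      by (simp add: K_def algebra_simps power2_eq_square power3_eq_cube)
    also have "\<dots> \<le> (1 + x\<^sup>2) * (x\<^sup>2 + 2) - x\<^sup>2 * (x\<^sup>2 + 3)"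
      using a3 by (intro diff_right_mono mult_left_mono) auto
    also have "\<dots> = 2" by (simp add: algebra_simps)
    finally have *: "(x\<^sup>2 + 3) * (x * K) \<le> 2" .
    have "3 * (x * K) \<le> (x\<^sup>2 + 3) * (x * K)" using x K0 by (intro mult_right_mono) auto
    with * have xK: "x * K \<le> 1" by simp
    have "1 * K \<le> x * K" using False K0 by (intro mult_right_mono) auto
    with xK show ?thesis by (simp add: algebra_simps)
  qed
  have "stein_sol h x * (1 + x\<^sup>2) + x * (h x - normal_mean h) = - m * K - (1 + x\<^sup>2) * b"
    unfolding sol K_def m_def[symmetric] by (simp add: algebra_simps)
  also have "\<bar>\<dots>\<bar> \<le> \<bar>m\<bar> * K + (1 + x\<^sup>2) * \<bar>b\<bar>"
    using abs_triangle_ineq4[of "- m * K" "(1 + x\<^sup>2) * b"] K0 by (simp add: abs_mult)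
  also have "\<dots> \<le> (x + 1) * K + (1 + x\<^sup>2) * J"
    using m b K0 x by (intro add_mono mult_right_mono mult_left_mono) (auto simp: J_def)
  also have "\<dots> \<le> 25" using KB J1 by simp
  finally show "\<bar>stein_sol h x * (1 + x\<^sup>2) + x * (h x - normal_mean h)\<bar> \<le> 25" .
qed

end

text \<open>The Mills bounds are effective only for nonnegative arguments; reflecting
  \<open>h\<close> transports them to the other half-line. Turning a right tail into a left one uses
  that the total integral is zero.\<close>

lemma stein_sol_reflect:
  assumes lip: "1-lipschitz_on UNIV h"
  shows "1-lipschitz_on UNIV (\<lambda>t. h (- t))" "normal_mean (\<lambda>t. h (- t)) = normal_mean h"
    "stein_sol (\<lambda>t. h (- t)) (- x) = - stein_sol h x"
proof -
  let ?H = "\<lambda>t. (h t - normal_mean h) * gw t"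
  show 1: "1-lipschitz_on UNIV (\<lambda>t. h (- t))"
  proof (rule lipschitz_onI)
    show "dist (h (- x)) (h (- y)) \<le> 1 * dist x y" for x y
      using lipschitz_onD[OF lip, of "- x" "- y"] by (simp add: dist_real_def)
  qed simp
  show 2: "normal_mean (\<lambda>t. h (- t)) = normal_mean h"
    unfolding normal_mean_def
    by (subst lborel_integral_real_affine[of "-1" _ 0]) (auto simp: std_normal_density_def)
  have int: "interval_lebesgue_integrable lborel a b ?H" for a b
    unfolding interval_lebesgue_integrable_def
    using lip_set_integrable[OF lip] by auto
  have "stein_tail (\<lambda>t. h (- t)) (- x) = (LBINT t=ereal (- x)..\<infinity>. ?H (- t))"
    by (simp add: stein_tail_def 2 interval_integral_to_infinity_eq gw_def)
  also have "\<dots> = (LBINT t=-\<infinity>..ereal x. ?H t)"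
    by (subst interval_integral_reflect) simp
  also have "\<dots> = (LBINT t=-\<infinity>..\<infinity>. ?H t) - (LBINT t=x..\<infinity>. ?H t)"
    using interval_integral_sum[OF int, of "-\<infinity>" x \<infinity>] by simp
  also have "\<dots> = - stein_tail h x"
    using stein_total[OF lip]
    by (simp add: stein_tail_def interval_integral_to_infinity_eq interval_lebesgue_integral_def set_lebesgue_integral_def)
  finally show "stein_sol (\<lambda>t. h (- t)) (- x) = - stein_sol h x"
    by (simp add: stein_sol_def gw_def)
qed

lemma stein_bounds:
  assumes lip: "1-lipschitz_on UNIV h"
  shows "\<bar>x * stein_sol h x + h x - normal_mean h\<bar> \<le> 3"
    and "\<bar>stein_sol h x * (1 + x\<^sup>2) + x * (h x - normal_mean h)\<bar> \<le> 25"
proof -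
  have "\<bar>x * stein_sol h x + h x - normal_mean h\<bar> \<le> 3 \<and>
     \<bar>stein_sol h x * (1 + x\<^sup>2) + x * (h x - normal_mean h)\<bar> \<le> 25"
  proof (cases "x \<ge> 0")
    case True then show ?thesis using stein_bounds_pos[OF lip] by auto
  next
    case False
    note r = stein_sol_reflect[OF lip]
    have "- x \<ge> 0" using False by simp
    note b = stein_bounds_pos[OF r(1) this, unfolded r(2) r(3)]
    have "\<bar>- (stein_sol h x * (1 + x\<^sup>2) + x * (h x - normal_mean h))\<bar> \<le> 25"
      using b(2) by (simp add: algebra_simps)
    then show ?thesis using b(1) by (simp add: abs_minus_commute)
  qed
  then show "\<bar>x * stein_sol h x + h x - normal_mean h\<bar> \<le> 3"
    "\<bar>stein_sol h x * (1 + x\<^sup>2) + x * (h x - normal_mean h)\<bar> \<le> 25" by auto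
qed

theorem stein_equation_solution:
  fixes h :: "real \<Rightarrow> real"
  assumes lip: "1-lipschitz_on UNIV h"
  obtains g g' where "\<And>x. (g has_real_derivative g' x) (at x)" "\<And>x. \<bar>g' x\<bar> \<le> 3"
    "\<And>x y. \<bar>g' x - g' y\<bar> \<le> 26 * \<bar>x - y\<bar>" "\<And>x. g' x - x * g x = h x - normal_mean h"
proof -
  let ?g = "stein_sol h"
  \<comment> \<open>Reading the derivative off the equation avoids a second derivative: 25 bounds
    the slope of \<open>x * g x\<close>, and \<open>h\<close> adds 1, which gives 26.\<close>
  let ?g' = "\<lambda>x. x * ?g x + h x - normal_mean h"
  have D: "((\<lambda>x. x * ?g x) has_real_derivative (?g x * (1 + x\<^sup>2) + x * (h x - normal_mean h))) (at x)" for x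
    using DERIV_mult[OF DERIV_ident stein_sol_DERIV[OF lip, of x]]
    by (simp add: algebra_simps power2_eq_square)
  have L: "\<bar>x * ?g x - y * ?g y\<bar> \<le> 25 * \<bar>x - y\<bar>" for x y
    using field_differentiable_bound[of UNIV "\<lambda>x. x * ?g x" _ 25 x y, OF convex_UNIV D]
      stein_bounds(2)[OF lip] by (auto simp: abs_minus_commute)
  show ?thesis
  proof (rule that[of ?g ?g'])
    show "\<bar>?g' x - ?g' y\<bar> \<le> 26 * \<bar>x - y\<bar>" for x y
      using L[of x y] lip_abs[OF lip, of x y] by (simp add: abs_if split: if_splits)
  qed (use stein_sol_DERIV[OF lip] stein_bounds(1)[OF lip] in auto)
qed

subsection \<open>Normal approximation of causal functionals\<close>

text \<open>The working integrability class: a product of up to four members is integrable, in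
  particular the square of a product of two differences.\<close>

definition L4 :: "'a pmf \<Rightarrow> ('a \<Rightarrow> real) \<Rightarrow> bool" where
  "L4 p f \<longleftrightarrow> integrable (measure_pmf p) (\<lambda>x. f x ^ 4)"

abbreviation mean :: "'a pmf \<Rightarrow> ('a \<Rightarrow> real) \<Rightarrow> real" where
  "mean p f \<equiv> measure_pmf.expectation p f"

lemma pow4_add_le: "(x + y) ^ 4 \<le> 8 * (x ^ 4 + (y::real) ^ 4)"
proof -
  have a: "(x + y)\<^sup>2 \<le> 2 * (x\<^sup>2 + y\<^sup>2)" for x y :: real
    using sum_squares_bound[of x y] by (simp add: power2_eq_square algebra_simps)
  have "(x + y) ^ 4 = ((x + y)\<^sup>2)\<^sup>2" by (simp flip: power_mult)
  also have "\<dots> \<le> (2 * (x\<^sup>2 + y\<^sup>2))\<^sup>2" by (intro power_mono a) auto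
  also have "\<dots> = 4 * (x\<^sup>2 + y\<^sup>2)\<^sup>2" by (simp only: power_mult_distrib) simp
  also have "\<dots> \<le> 4 * (2 * ((x\<^sup>2)\<^sup>2 + (y\<^sup>2)\<^sup>2))" using a[of "x\<^sup>2" "y\<^sup>2"] by simp
  also have "\<dots> = 8 * (x ^ 4 + y ^ 4)" by (simp flip: power_mult)
  finally show ?thesis .
qed

lemma abs_mult_le_squares: "\<bar>x * y\<bar> \<le> x\<^sup>2 + (y\<^sup>2 :: real)"
proof -
  have "2 * \<bar>x * y\<bar> \<le> x\<^sup>2 + y\<^sup>2"
    using sum_squares_bound[of "\<bar>x\<bar>" "\<bar>y\<bar>"] by (simp add: abs_mult)
  then show ?thesis using abs_ge_zero[of "x * y"] by linarith
qed

lemma prod4_le: "\<bar>a * b * c * (d::real)\<bar> \<le> a ^ 4 + b ^ 4 + c ^ 4 + d ^ 4"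
proof -
  have "\<bar>a * b * c * d\<bar> \<le> (a * b)\<^sup>2 + (c * d)\<^sup>2" using abs_mult_le_squares[of "a * b" "c * d"] by (simp add: mult.assoc)
  also have "\<dots> \<le> (a ^ 4 + b ^ 4) + (c ^ 4 + d ^ 4)"
    using abs_mult_le_squares[of "a\<^sup>2" "b\<^sup>2"] abs_mult_le_squares[of "c\<^sup>2" "d\<^sup>2"]
    by (intro add_mono) (auto simp: power_mult_distrib simp flip: power_mult)
  finally show ?thesis by simp
qed

lemma L4_add: assumes "L4 p f" "L4 p g" shows "L4 p (\<lambda>x. f x + g x)"
  unfolding L4_def
proof (rule Bochner_Integration.integrable_bound)
  show "integrable (measure_pmf p) (\<lambda>x. 8 * (f x ^ 4 + g x ^ 4))"
    using assms unfolding L4_def by auto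
qed (auto simp: pow4_add_le intro!: AE_I2 order_trans[OF pow4_add_le])

lemma L4_cmult: "L4 p f \<Longrightarrow> L4 p (\<lambda>x. c * f x)"
  unfolding L4_def by (simp add: power_mult_distrib)

lemma L4_minus: "L4 p f \<Longrightarrow> L4 p (\<lambda>x. - f x)"
  unfolding L4_def by simp

lemma L4_diff: "L4 p f \<Longrightarrow> L4 p g \<Longrightarrow> L4 p (\<lambda>x. f x - g x)"
  using L4_add[of p f "\<lambda>x. - g x"] L4_minus[of p g] by simp

lemma L4_bounded: "(\<And>x. \<bar>f x\<bar> \<le> B) \<Longrightarrow> L4 p f"
  unfolding L4_def
  by (rule measure_pmf.integrable_const_bound[where B="B ^ 4"])
     (auto intro!: AE_pmfI power_mono_even simp: order_trans[OF _ abs_ge_self])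

lemma L4_const: "L4 p (\<lambda>x. c)" by (rule L4_bounded[of _ "\<bar>c\<bar>"]) simp

lemma L4_sum: "(\<And>i. i \<in> I \<Longrightarrow> L4 p (f i)) \<Longrightarrow> L4 p (\<lambda>x. \<Sum>i\<in>I. f i x)"
  by (induction I rule: infinite_finite_induct) (auto intro: L4_add L4_const)

lemma L4_mono: assumes "L4 p g" "\<And>x. \<bar>f x\<bar> \<le> \<bar>g x\<bar>" shows "L4 p f"
  unfolding L4_def
  by (rule Bochner_Integration.integrable_bound[OF assms(1)[unfolded L4_def]])
     (auto intro!: AE_pmfI power_mono_even assms)

lemma L4_map: "L4 (map_pmf m p) f \<longleftrightarrow> L4 p (\<lambda>x. f (m x))"
  unfolding L4_def by (simp add: integrable_map_pmf_eq)

lemma L4_integrable4: assumes "L4 p a" "L4 p b" "L4 p c" "L4 p d"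
  shows "integrable (measure_pmf p) (\<lambda>x. a x * b x * c x * d x)"
proof (rule Bochner_Integration.integrable_bound)
  show "integrable (measure_pmf p) (\<lambda>x. a x ^ 4 + b x ^ 4 + c x ^ 4 + d x ^ 4)"
    using assms unfolding L4_def by auto
  show "AE x in measure_pmf p. norm (a x * b x * c x * d x) \<le> norm (a x ^ 4 + b x ^ 4 + c x ^ 4 + d x ^ 4)"
    using prod4_le by (auto intro!: AE_I2 order_trans[OF _ abs_ge_self])
qed auto

lemma L4_integrable3: "L4 p a \<Longrightarrow> L4 p b \<Longrightarrow> L4 p c \<Longrightarrow> integrable (measure_pmf p) (\<lambda>x. a x * b x * c x)"
  using L4_integrable4[of p a b c "\<lambda>_. 1"] by (simp add: L4_const)

lemma L4_integrable2: "L4 p a \<Longrightarrow> L4 p b \<Longrightarrow> integrable (measure_pmf p) (\<lambda>x. a x * b x)"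
  using L4_integrable3[of p a b "\<lambda>_. 1"] by (simp add: L4_const)

lemma L4_integrable: "L4 p a \<Longrightarrow> integrable (measure_pmf p) a"
  using L4_integrable2[of p a "\<lambda>_. 1"] by (simp add: L4_const)

lemma L4_integrable_sq: "L4 p a \<Longrightarrow> integrable (measure_pmf p) (\<lambda>x. (a x)\<^sup>2)"
  using L4_integrable2[of p a a] by (simp add: power2_eq_square)

lemma L2_integrable_mult:
  assumes "integrable (measure_pmf p) (\<lambda>x. (a x)\<^sup>2)" "integrable (measure_pmf p) (\<lambda>x. (b x)\<^sup>2)"
  shows "integrable (measure_pmf p) (\<lambda>x. a x * b x :: real)"
proof (rule Bochner_Integration.integrable_bound)
  show "integrable (measure_pmf p) (\<lambda>x. (a x)\<^sup>2 + (b x)\<^sup>2)" using assms by auto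
  have "\<bar>a x * b x\<bar> \<le> (a x)\<^sup>2 + (b x)\<^sup>2" for x by (rule abs_mult_le_squares)
  then show "AE x in measure_pmf p. norm (a x * b x) \<le> norm ((a x)\<^sup>2 + (b x)\<^sup>2)"
    by auto
qed auto

lemma L2_integrable:
  assumes "integrable (measure_pmf p) (\<lambda>x. (a x)\<^sup>2)"
  shows "integrable (measure_pmf p) (a :: _ \<Rightarrow> real)"
  using L2_integrable_mult[OF assms, of "\<lambda>_. 1"] by simp

lemma L2_diff:
  assumes "integrable (measure_pmf p) (\<lambda>x. (a x)\<^sup>2)" "integrable (measure_pmf p) (\<lambda>x. (b x)\<^sup>2)"
  shows "integrable (measure_pmf p) (\<lambda>x. (a x - b x :: real)\<^sup>2)"
  using assms L2_integrable_mult[OF assms] by (simp add: power2_diff mult.assoc)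

lemma L4_sum_prod_sq:
  assumes "\<And>j. j \<in> J \<Longrightarrow> L4 p (a j)" "\<And>j. j \<in> J \<Longrightarrow> L4 p (b j)"
  shows "integrable (measure_pmf p) (\<lambda>x. (\<Sum>j\<in>J. a j x * b j x)\<^sup>2)"
proof -
  have "(\<Sum>j\<in>J. a j x * b j x)\<^sup>2 = (\<Sum>i\<in>J. \<Sum>j\<in>J. a i x * b i x * a j x * b j x)" for x
    by (simp add: power2_eq_square sum_product mult.assoc)
  note eq = this
  show ?thesis unfolding eq by (intro Bochner_Integration.integrable_sum L4_integrable4 assms)
qed

lemma expectation_sq_le: 
  assumes "integrable (measure_pmf p) (\<lambda>x. (a x)\<^sup>2)" shows "(mean p a)\<^sup>2 \<le> mean p (\<lambda>x. (a x)\<^sup>2)"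
proof -
  have "0 \<le> measure_pmf.variance p a" by (intro integral_nonneg_AE) auto
  also have "\<dots> = mean p (\<lambda>x. (a x)\<^sup>2) - (mean p a)\<^sup>2"
    using L2_integrable[OF assms] assms by (intro measure_pmf.variance_eq) auto
  finally show ?thesis by simp
qed

section \<open>Adding up bounds by weighted Cauchy-Schwarz inequalities\<close>

lemma CS_weighted:
  assumes "\<And>n. n \<in> J \<Longrightarrow> w n > (0::real)"
  shows "(\<Sum>n\<in>J. \<delta> n)\<^sup>2 \<le> (\<Sum>n\<in>J. w n) * (\<Sum>n\<in>J. (\<delta> n)\<^sup>2 / w n)"
proof -
  have "(\<Sum>n\<in>J. \<delta> n) = (\<Sum>n\<in>J. sqrt (w n) * (\<delta> n / sqrt (w n)))"
    by (intro sum.cong) (auto dest!: assms)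
  also have "(\<dots>)\<^sup>2 \<le> (\<Sum>n\<in>J. (sqrt (w n))\<^sup>2) * (\<Sum>n\<in>J. (\<delta> n / sqrt (w n))\<^sup>2)"
    by (rule Cauchy_Schwarz_ineq_sum)
  also have "(\<Sum>n\<in>J. (sqrt (w n))\<^sup>2) = (\<Sum>n\<in>J. w n)"
    by (intro sum.cong) (auto dest!: assms)
  also have "(\<Sum>n\<in>J. (\<delta> n / sqrt (w n))\<^sup>2) = (\<Sum>n\<in>J. (\<delta> n)\<^sup>2 / w n)"
    by (intro sum.cong) (auto simp: power_divide dest!: assms)
  finally show ?thesis .
qed

text \<open>Acts as the triangle inequality in L^2: norms of size sqrt K times \<open>w n\<close>
  add up. Taking the weights in Cauchy-Schwarz equal to these sizes loses nothing, so geometric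
  decay survives the summation.\<close>

lemma expectation_sum_sq_le:
  assumes w: "\<And>n. n \<in> J \<Longrightarrow> w n > (0::real)"
    and int: "\<And>n. n \<in> J \<Longrightarrow> integrable (measure_pmf p) (\<lambda>x. (\<delta> n x)\<^sup>2)"
    and E: "\<And>n. n \<in> J \<Longrightarrow> mean p (\<lambda>x. (\<delta> n x)\<^sup>2) \<le> K * (w n)\<^sup>2"
    and sq: "integrable (measure_pmf p) (\<lambda>x. (\<Sum>n\<in>J. \<delta> n x)\<^sup>2)"
  shows "mean p (\<lambda>x. (\<Sum>n\<in>J. \<delta> n x)\<^sup>2) \<le> K * (\<Sum>n\<in>J. w n)\<^sup>2"
proof -
  have "mean p (\<lambda>x. (\<Sum>n\<in>J. \<delta> n x)\<^sup>2) \<le> mean p (\<lambda>x. (\<Sum>n\<in>J. w n) * (\<Sum>n\<in>J. (\<delta> n x)\<^sup>2 / w n))"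
    using CS_weighted[OF w] int by (intro integral_mono sq) auto
  also have "\<dots> = (\<Sum>n\<in>J. w n) * (\<Sum>n\<in>J. mean p (\<lambda>x. (\<delta> n x)\<^sup>2) / w n)"
    using int by simp
  also have "\<dots> \<le> (\<Sum>n\<in>J. w n) * (\<Sum>n\<in>J. K * (w n)\<^sup>2 / w n)"
    using w E by (intro mult_left_mono sum_mono divide_right_mono sum_nonneg) (auto simp: less_imp_le)
  also have "(\<Sum>n\<in>J. K * (w n)\<^sup>2 / w n) = K * (\<Sum>n\<in>J. w n)"
    unfolding sum_distrib_left by (intro sum.cong) (auto simp: power2_eq_square dest!: w)
  finally show ?thesis by (simp add: power2_eq_square mult_ac)
qed

text \<open>The L^4 version applies the weighted inequality twice, first to the sum and then to the
  resulting sum of squares.\<close>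

lemma expectation_sum_pow4_le:
  assumes w: "\<And>n. n \<in> J \<Longrightarrow> w n > (0::real)"
    and int: "\<And>n. n \<in> J \<Longrightarrow> L4 p (\<delta> n)"
    and E: "\<And>n. n \<in> J \<Longrightarrow> mean p (\<lambda>x. \<delta> n x ^ 4) \<le> K * w n ^ 4"
  shows "mean p (\<lambda>x. (\<Sum>n\<in>J. \<delta> n x) ^ 4) \<le> K * (\<Sum>n\<in>J. w n) ^ 4"
proof -
  have *: "(\<Sum>n\<in>J. \<delta> n x) ^ 4 \<le> (\<Sum>n\<in>J. w n) ^ 3 * (\<Sum>n\<in>J. \<delta> n x ^ 4 / w n ^ 3)" for x
  proof -
    have W: "0 \<le> (\<Sum>n\<in>J. w n)" by (intro sum_nonneg) (use w in \<open>auto simp: less_imp_le\<close>)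
    have "(\<Sum>n\<in>J. \<delta> n x) ^ 4 = ((\<Sum>n\<in>J. \<delta> n x)\<^sup>2)\<^sup>2" by (simp flip: power_mult)
    also have "\<dots> \<le> ((\<Sum>n\<in>J. w n) * (\<Sum>n\<in>J. (\<delta> n x)\<^sup>2 / w n))\<^sup>2"
      by (intro power_mono CS_weighted w) auto
    also have "\<dots> = (\<Sum>n\<in>J. w n)\<^sup>2 * (\<Sum>n\<in>J. (\<delta> n x)\<^sup>2 / w n)\<^sup>2" by (simp add: power_mult_distrib)
    also have "\<dots> \<le> (\<Sum>n\<in>J. w n)\<^sup>2 * ((\<Sum>n\<in>J. w n) * (\<Sum>n\<in>J. ((\<delta> n x)\<^sup>2 / w n)\<^sup>2 / w n))"
      by (intro mult_left_mono CS_weighted w) auto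
    also have "\<dots> = (\<Sum>n\<in>J. w n) ^ 3 * (\<Sum>n\<in>J. \<delta> n x ^ 4 / w n ^ 3)"
      by (simp add: power_divide power2_eq_square power3_eq_cube power4_eq_xxxx mult.assoc)
    finally show ?thesis .
  qed
  have W: "0 \<le> (\<Sum>n\<in>J. w n)" by (intro sum_nonneg) (use w in \<open>auto simp: less_imp_le\<close>)
  have int': "integrable (measure_pmf p) (\<lambda>x. \<delta> n x ^ 4)" if "n \<in> J" for n
    using int[OF that] by (simp add: L4_def)
  have "mean p (\<lambda>x. (\<Sum>n\<in>J. \<delta> n x) ^ 4) \<le> mean p (\<lambda>x. (\<Sum>n\<in>J. w n) ^ 3 * (\<Sum>n\<in>J. \<delta> n x ^ 4 / w n ^ 3))"
    using * int' L4_sum[of J p \<delta>, OF int, unfolded L4_def] by (intro integral_mono) auto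
  also have "\<dots> = (\<Sum>n\<in>J. w n) ^ 3 * (\<Sum>n\<in>J. mean p (\<lambda>x. \<delta> n x ^ 4) / w n ^ 3)"
    using int' by simp
  also have "\<dots> \<le> (\<Sum>n\<in>J. w n) ^ 3 * (\<Sum>n\<in>J. K * w n ^ 4 / w n ^ 3)"
    using w E W by (intro mult_left_mono sum_mono divide_right_mono) (auto simp: less_imp_le)
  also have "(\<Sum>n\<in>J. K * w n ^ 4 / w n ^ 3) = K * (\<Sum>n\<in>J. w n)"
    unfolding sum_distrib_left
    by (intro sum.cong) (auto simp: power4_eq_xxxx power3_eq_cube dest!: w)
  finally show ?thesis by (simp add: power4_eq_xxxx power3_eq_cube mult_ac)
qed

section \<open>Iterated expectations over independent pairs\<close>

lemma expectation_pair_pmf_nonneg: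
  assumes F: "integrable (measure_pmf (pair_pmf p q)) F" "\<And>z. F z \<ge> (0::real)"
  shows "AE x in measure_pmf p. integrable (measure_pmf q) (\<lambda>y. F (x, y))"
    "integrable (measure_pmf p) (\<lambda>x. mean q (\<lambda>y. F (x, y)))"
    "mean (pair_pmf p q) F = mean p (\<lambda>x. mean q (\<lambda>y. F (x, y)))"
proof -
  let ?G = "\<lambda>x. \<integral>\<^sup>+y. ennreal (F (x, y)) \<partial>measure_pmf q"
  have fin: "(\<integral>\<^sup>+x. ?G x \<partial>measure_pmf p) < \<infinity>"
    using F by (simp add: integrable_iff_bounded nn_integral_pair_pmf')
  have ae: "AE x in measure_pmf p. ?G x \<noteq> \<infinity>"
    using fin by (intro nn_integral_PInf_AE) auto
  then show int: "AE x in measure_pmf p. integrable (measure_pmf q) (\<lambda>y. F (x, y))"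
    by eventually_elim (use F in \<open>auto simp: integrable_iff_bounded less_top\<close>)
  have G: "mean q (\<lambda>y. F (x, y)) = enn2real (?G x)" for x
    using F by (intro integral_eq_nn_integral) auto
  have eqae: "AE x in measure_pmf p. ennreal (mean q (\<lambda>y. F (x, y))) = ?G x"
    using ae by eventually_elim (auto simp: G less_top)
  then have nn: "(\<integral>\<^sup>+x. ennreal (mean q (\<lambda>y. F (x, y))) \<partial>measure_pmf p) = (\<integral>\<^sup>+x. ?G x \<partial>measure_pmf p)"
    by (rule nn_integral_cong_AE)
  have nonneg: "mean q (\<lambda>y. F (x, y)) \<ge> 0" for x using F by simp
  show "integrable (measure_pmf p) (\<lambda>x. mean q (\<lambda>y. F (x, y)))"
    using nn fin nonneg by (simp add: integrable_iff_bounded)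
  have "mean (pair_pmf p q) F = enn2real (\<integral>\<^sup>+x. ?G x \<partial>measure_pmf p)"
    using F by (simp add: integral_eq_nn_integral nn_integral_pair_pmf')
  also have "\<dots> = mean p (\<lambda>x. mean q (\<lambda>y. F (x, y)))"
    using nonneg by (simp add: integral_eq_nn_integral nn)
  finally show "mean (pair_pmf p q) F = mean p (\<lambda>x. mean q (\<lambda>y. F (x, y)))" .
qed

text \<open>Positive and negative parts are treated separately: for each of them the iterated
  integral exists, and finiteness of the outer one makes the inner ones finite almost everywhere, so
  that they may be subtracted.\<close>

lemma expectation_pair_pmf_iterated:
  assumes F: "integrable (measure_pmf (pair_pmf p q)) (F :: _ \<Rightarrow> real)"
  shows "mean (pair_pmf p q) F = mean p (\<lambda>x. mean q (\<lambda>y. F (x, y)))"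
proof -
  define P N where "P z = (\<bar>F z\<bar> + F z) / 2" and "N z = (\<bar>F z\<bar> - F z) / 2" for z
  have PN: "F z = P z - N z" "P z \<ge> 0" "N z \<ge> 0" for z by (auto simp: P_def N_def field_simps)
  have I: "integrable (measure_pmf (pair_pmf p q)) P" "integrable (measure_pmf (pair_pmf p q)) N"
    using F unfolding P_def N_def by auto
  note p = expectation_pair_pmf_nonneg[OF I(1) PN(2)] and n = expectation_pair_pmf_nonneg[OF I(2) PN(3)]
  have "mean (pair_pmf p q) F = mean (pair_pmf p q) P - mean (pair_pmf p q) N"
    using I by (simp flip: Bochner_Integration.integral_diff PN(1))
  also have "\<dots> = mean p (\<lambda>x. mean q (\<lambda>y. P (x, y)) - mean q (\<lambda>y. N (x, y)))"
    using p n by simp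
  also have "\<dots> = mean p (\<lambda>x. mean q (\<lambda>y. F (x, y)))"
  proof (intro integral_cong_AE)
    show "AE x in measure_pmf p. mean q (\<lambda>y. P (x, y)) - mean q (\<lambda>y. N (x, y)) = mean q (\<lambda>y. F (x, y))"
      using p(1) n(1) by eventually_elim (simp add: PN(1))
  qed auto
  finally show ?thesis .
qed

lemma expectation_pair_mult:
  fixes f g :: "_ \<Rightarrow> real"
  assumes f: "integrable (measure_pmf p) f" and g: "integrable (measure_pmf q) g"
  shows "mean (pair_pmf p q) (\<lambda>z. f (fst z) * g (snd z)) = mean p f * mean q g"
    and "integrable (measure_pmf (pair_pmf p q)) (\<lambda>z. f (fst z) * g (snd z))"
proof -
  have "(\<integral>\<^sup>+z. ennreal (\<bar>f (fst z)\<bar> * \<bar>g (snd z)\<bar>) \<partial>pair_pmf p q)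
     = (\<integral>\<^sup>+x. ennreal \<bar>f x\<bar> \<partial>p) * (\<integral>\<^sup>+y. ennreal \<bar>g y\<bar> \<partial>q)"
    by (simp add: nn_integral_pair_pmf' ennreal_mult nn_integral_cmult nn_integral_multc)
  then show int: "integrable (measure_pmf (pair_pmf p q)) (\<lambda>z. f (fst z) * g (snd z))"
    using f g unfolding integrable_iff_bounded by (auto simp: abs_mult ennreal_mult_less_top)
  show "mean (pair_pmf p q) (\<lambda>z. f (fst z) * g (snd z)) = mean p f * mean q g"
    by (simp add: expectation_pair_pmf_iterated[OF int])
qed

section \<open>Exchanging blocks between two independent copies\<close>

definition mix :: "'i set \<Rightarrow> ('i \<Rightarrow> 'u) \<times> ('i \<Rightarrow> 'u) \<Rightarrow> 'i \<Rightarrow> 'u" where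
  "mix A \<omega> = (\<lambda>i. if i \<in> A then snd \<omega> i else fst \<omega> i)"

text \<open>A law-preserving involution on pairs of copies; all symmetrizations below are instances
  of its invariance.\<close>

definition exch :: "'i set \<Rightarrow> ('i \<Rightarrow> 'u) \<times> ('i \<Rightarrow> 'u) \<Rightarrow> ('i \<Rightarrow> 'u) \<times> ('i \<Rightarrow> 'u)" where
  "exch A \<omega> = (mix A \<omega>, mix (- A) \<omega>)"

lemma mix_empty [simp]: "mix {} = fst" by (simp add: mix_def fun_eq_iff)

lemma exch_exch [simp]: "exch A (exch A \<omega>) = \<omega>"
  by (cases \<omega>) (auto simp: exch_def mix_def)

text \<open>The reason for indexing interpolations by sets: exchange acts on the index as a
  symmetric difference.\<close>

lemma mix_exch: "mix B (exch A \<omega>) = mix (sym_diff A B) \<omega>"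
  by (auto simp: exch_def mix_def)

context
  fixes I :: "'i set" and d :: 'u and D :: "'u pmf"
  assumes fin: "finite I"
begin

abbreviation "QI \<equiv> Pi_pmf I d (\<lambda>_. D)"
abbreviation "PPI \<equiv> pair_pmf QI QI"

text \<open>The point mass of a pair is a product over both copies, and the swap only permutes
  factors with the same index. Off \<open>I\<close> both copies take the same default value, so the
  support condition is preserved.\<close>

lemma map_exch: "map_pmf (exch A) PPI = PPI"
proof (rule pmf_eqI)
  fix \<omega>
  have inj: "inj (exch A :: ('i \<Rightarrow> 'u) \<times> _ \<Rightarrow> _)" by (rule injI) (metis exch_exch)
  have "pmf (map_pmf (exch A) PPI) \<omega> = pmf (map_pmf (exch A) PPI) (exch A (exch A \<omega>))" by simp
  also have "\<dots> = pmf PPI (exch A \<omega>)" by (rule pmf_map_inj'[OF inj])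
  also have "\<dots> = pmf QI (mix A \<omega>) * pmf QI (mix (- A) \<omega>)" by (simp add: exch_def pmf_pair)
  also have "\<dots> = pmf QI (fst \<omega>) * pmf QI (snd \<omega>)"
  proof -
    have "(\<forall>x. x \<notin> I \<longrightarrow> mix A \<omega> x = d) \<and> (\<forall>x. x \<notin> I \<longrightarrow> mix (- A) \<omega> x = d)
       \<longleftrightarrow> (\<forall>x. x \<notin> I \<longrightarrow> fst \<omega> x = d) \<and> (\<forall>x. x \<notin> I \<longrightarrow> snd \<omega> x = d)"
      by (auto simp: mix_def)
    moreover have "(\<Prod>x\<in>I. pmf D (mix A \<omega> x)) * (\<Prod>x\<in>I. pmf D (mix (- A) \<omega> x))
      = (\<Prod>x\<in>I. pmf D (fst \<omega> x)) * (\<Prod>x\<in>I. pmf D (snd \<omega> x))"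
      unfolding prod.distrib[symmetric] by (intro prod.cong) (auto simp: mix_def)
    ultimately show ?thesis by (simp add: pmf_Pi[OF fin]) auto
  qed
  also have "\<dots> = pmf PPI \<omega>" by (cases \<omega>) (simp add: pmf_pair)
  finally show "pmf (map_pmf (exch A) PPI) \<omega> = pmf PPI \<omega>" .
qed

lemma map_mix: "map_pmf (mix A) PPI = QI"
proof -
  have "map_pmf (mix A) PPI = map_pmf fst (map_pmf (exch A) PPI)"
    by (simp add: pmf.map_comp o_def exch_def)
  then show ?thesis by (simp add: map_exch map_fst_pair_pmf)
qed

text \<open>Two interpolations that differ exactly on \<open>B\<close> are jointly distributed like
  a configuration and its resampling on \<open>B\<close>. So each step of an interpolation obeys the
  bounds for a single resampling.\<close>

lemma map_mix2: "map_pmf (\<lambda>\<omega>. (mix A \<omega>, mix (sym_diff A B) \<omega>)) PPI = map_pmf (\<lambda>\<omega>. (fst \<omega>, mix B \<omega>)) PPI"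
proof -
  have "map_pmf (\<lambda>\<omega>. (mix {} \<omega>, mix B \<omega>)) PPI = map_pmf (\<lambda>\<omega>. (mix {} \<omega>, mix B \<omega>)) (map_pmf (exch A) PPI)"
    by (simp add: map_exch)
  also have "\<dots> = map_pmf (\<lambda>\<omega>. (mix A \<omega>, mix (sym_diff A B) \<omega>)) PPI"
    unfolding pmf.map_comp o_def mix_exch by simp
  finally show ?thesis by simp
qed

lemma expectation_exch: "mean PPI (\<lambda>\<omega>. F (exch A \<omega>)) = mean PPI F"
proof -
  have "mean PPI F = mean (map_pmf (exch A) PPI) F" by (simp add: map_exch)
  then show ?thesis by simp
qed

lemma integrable_mix: "integrable (measure_pmf PPI) (\<lambda>\<omega>. F (mix A \<omega>)) \<longleftrightarrow> integrable (measure_pmf QI) (F :: _ \<Rightarrow> real)"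
proof -
  have "integrable (measure_pmf (map_pmf (mix A) PPI)) F \<longleftrightarrow> integrable (measure_pmf PPI) (\<lambda>\<omega>. F (mix A \<omega>))"
    by (simp add: integrable_map_pmf_eq)
  then show ?thesis by (simp add: map_mix)
qed

lemma expectation_mix: "mean PPI (\<lambda>\<omega>. F (mix A \<omega>)) = mean QI F"
proof -
  have "mean QI F = mean (map_pmf (mix A) PPI) F" by (simp add: map_mix)
  then show ?thesis by simp
qed

end

text \<open>
  The blocks of \<open>fst \<omega>\<close> are replaced one after the other by those of \<open>snd \<omega>\<close>; exchanging the
  \<open>j\<close>-th blocks of the two antisymmetrizes the \<open>j\<close>-th term. With \<open>h = k\<close> this gives the Efron--Stein inequality, with
  \<open>k\<close> a function of \<open>h\<close> it starts Stein's method.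
\<close>
lemma interpolation:
  fixes N :: nat and d :: 'u and D h k
  defines "Q \<equiv> Pi_pmf {..<N} d (\<lambda>_. D)"
  assumes h: "integrable (measure_pmf Q) (\<lambda>x. (h x)\<^sup>2)" and k: "integrable (measure_pmf Q) (\<lambda>x. (k x)\<^sup>2 :: real)"
  shows "mean Q (\<lambda>x. h x * k x) - mean Q h * mean Q k
    = 1/2 * (\<Sum>j<N. mean (pair_pmf Q Q) (\<lambda>\<omega>. (h (mix {..<j} \<omega>) - h (mix {..<Suc j} \<omega>)) * (k (fst \<omega>) - k (mix {j} \<omega>))))"
proof -
  let ?PP = "pair_pmf Q Q"
  have sq: "integrable (measure_pmf ?PP) (\<lambda>\<omega>. (F (mix A \<omega>))\<^sup>2)"
    if "integrable (measure_pmf Q) (\<lambda>x. (F x)\<^sup>2 :: real)" for F A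
    using that integrable_mix[of "{..<N}" d D "\<lambda>x. (F x)\<^sup>2" A] by (simp add: Q_def)
  have int: "integrable (measure_pmf ?PP) (\<lambda>\<omega>. h (mix A \<omega>) * k (mix B \<omega>))" for A B
    by (intro L2_integrable_mult sq h k)
  have int0: "integrable (measure_pmf ?PP) (\<lambda>\<omega>. h (mix A \<omega>) * k (fst \<omega>))" for A
    using int[of A "{}"] by simp
  have step: "mean ?PP (\<lambda>\<omega>. (h (mix {..<j} \<omega>) - h (mix {..<Suc j} \<omega>)) * k (fst \<omega>))
     = 1/2 * mean ?PP (\<lambda>\<omega>. (h (mix {..<j} \<omega>) - h (mix {..<Suc j} \<omega>)) * (k (fst \<omega>) - k (mix {j} \<omega>)))" for j
  proof -
    have s: "sym_diff {j} {..<j} = {..<Suc j}" "sym_diff {j} {..<Suc j} = {..<j}" "sym_diff {j} {} = {j}" by auto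
    have "mean ?PP (\<lambda>\<omega>. (h (mix {..<j} \<omega>) - h (mix {..<Suc j} \<omega>)) * k (mix {} \<omega>))
       = mean ?PP (\<lambda>\<omega>. (h (mix {..<j} (exch {j} \<omega>)) - h (mix {..<Suc j} (exch {j} \<omega>))) * k (mix {} (exch {j} \<omega>)))"
      unfolding Q_def
      by (rule expectation_exch[where A="{j}" and
            F="\<lambda>\<omega>. (h (mix {..<j} \<omega>) - h (mix {..<Suc j} \<omega>)) * k (mix {} \<omega>)", symmetric]) simp
    also have "\<dots> = mean ?PP (\<lambda>\<omega>. (h (mix {..<Suc j} \<omega>) - h (mix {..<j} \<omega>)) * k (mix {j} \<omega>))"
      unfolding mix_exch s ..
    finally have e: "mean ?PP (\<lambda>\<omega>. (h (mix {..<j} \<omega>) - h (mix {..<Suc j} \<omega>)) * k (fst \<omega>))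
      = - mean ?PP (\<lambda>\<omega>. (h (mix {..<j} \<omega>) - h (mix {..<Suc j} \<omega>)) * k (mix {j} \<omega>))"
      by (simp add: algebra_simps int)
    show ?thesis
      using e by (simp add: right_diff_distrib left_diff_distrib int int0)
  qed
  have tel: "(\<Sum>j<N. h (mix {..<j} \<omega>) - h (mix {..<Suc j} \<omega>)) = h (fst \<omega>) - h (mix {..<N} \<omega>)" for \<omega>
    using sum_lessThan_telescope'[of "\<lambda>j. h (mix {..<j} \<omega>)" N] by (simp del: lessThan_Suc)
  have "(\<Sum>j<N. mean ?PP (\<lambda>\<omega>. (h (mix {..<j} \<omega>) - h (mix {..<Suc j} \<omega>)) * k (fst \<omega>)))
     = mean ?PP (\<lambda>\<omega>. \<Sum>j<N. (h (mix {..<j} \<omega>) - h (mix {..<Suc j} \<omega>)) * k (fst \<omega>))"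
    by (subst Bochner_Integration.integral_sum) (auto simp: left_diff_distrib int0)
  also have "\<dots> = mean ?PP (\<lambda>\<omega>. h (mix {} \<omega>) * k (mix {} \<omega>) - h (mix {..<N} \<omega>) * k (fst \<omega>))"
    unfolding sum_distrib_right[symmetric] tel by (simp add: left_diff_distrib)
  also have "\<dots> = mean ?PP (\<lambda>\<omega>. h (mix {} \<omega>) * k (mix {} \<omega>)) - mean ?PP (\<lambda>\<omega>. h (mix {..<N} \<omega>) * k (fst \<omega>))"
    using int[of "{}" "{}"] int0 by simp
  also have "mean ?PP (\<lambda>\<omega>. h (mix {} \<omega>) * k (mix {} \<omega>)) = mean Q (\<lambda>x. h x * k x)"
    unfolding Q_def by (rule expectation_mix) simp
  \<comment> \<open>After all \<open>N\<close> exchanges the configuration is the second copy, but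
    only on the support, where both copies have the default value off the index set. Independence
    then factors the mean.\<close>
  also have "mean ?PP (\<lambda>\<omega>. h (mix {..<N} \<omega>) * k (fst \<omega>)) = mean ?PP (\<lambda>\<omega>. k (fst \<omega>) * h (snd \<omega>))"
  proof (intro integral_cong_AE AE_pmfI)
    fix \<omega> assume "\<omega> \<in> set_pmf ?PP"
    then have "fst \<omega> \<in> set_pmf Q" "snd \<omega> \<in> set_pmf Q" by auto
    then have "mix {..<N} \<omega> = snd \<omega>"
      using set_Pi_pmf_subset[of "{..<N}" d "\<lambda>_. D"] by (auto simp: Q_def mix_def fun_eq_iff)
    then show "h (mix {..<N} \<omega>) * k (fst \<omega>) = k (fst \<omega>) * h (snd \<omega>)" by simp
  qed auto
  also have "\<dots> = mean Q k * mean Q h"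
    by (intro expectation_pair_mult(1) L2_integrable[OF h] L2_integrable[OF k])
  finally show ?thesis unfolding step by (simp add: sum_distrib_left mult.commute)
qed

text \<open>Each term of \<open>interpolation\<close> with \<open>h = k\<close> multiplies two
  differences of the same law, so Young's inequality bounds it by their common second
  moment.\<close>

lemma efron_stein:
  fixes N :: nat and d :: 'u and D h
  defines "Q \<equiv> Pi_pmf {..<N} d (\<lambda>_. D)"
  assumes h: "integrable (measure_pmf Q) (\<lambda>x. (h x)\<^sup>2 :: real)"
  shows "mean Q (\<lambda>x. (h x)\<^sup>2) - (mean Q h)\<^sup>2 \<le> 1/2 * (\<Sum>j<N. mean (pair_pmf Q Q) (\<lambda>\<omega>. (h (fst \<omega>) - h (mix {j} \<omega>))\<^sup>2))"
proof -
  let ?PP = "pair_pmf Q Q"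
  have sq: "integrable (measure_pmf ?PP) (\<lambda>\<omega>. (h (mix A \<omega>))\<^sup>2)" for A
    using h integrable_mix[of "{..<N}" d D "\<lambda>x. (h x)\<^sup>2" A] by (simp add: Q_def)
  have int: "integrable (measure_pmf ?PP) (\<lambda>\<omega>. h (mix A \<omega>) * h (mix B \<omega>))" for A B
    by (intro L2_integrable_mult sq)
  have d2: "integrable (measure_pmf ?PP) (\<lambda>\<omega>. (h (mix A \<omega>) - h (mix B \<omega>))\<^sup>2)" for A B
    using sq int by (simp add: power2_diff mult.assoc)
  have d20: "integrable (measure_pmf ?PP) (\<lambda>\<omega>. (h (fst \<omega>) - h (mix B \<omega>))\<^sup>2)" for B
    using d2[of "{}" B] by simp
  have dm: "integrable (measure_pmf ?PP) (\<lambda>\<omega>. (h (mix A \<omega>) - h (mix B \<omega>)) * (h (fst \<omega>) - h (mix C \<omega>)))" for A B C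
    by (intro L2_integrable_mult d2 d20)
  have "mean Q (\<lambda>x. (h x)\<^sup>2) - (mean Q h)\<^sup>2 = 1/2 * (\<Sum>j<N. mean ?PP (\<lambda>\<omega>. (h (mix {..<j} \<omega>) - h (mix {..<Suc j} \<omega>)) * (h (fst \<omega>) - h (mix {j} \<omega>))))"
    using interpolation[of N d D h h] h by (simp add: Q_def power2_eq_square)
  also have "\<dots> \<le> 1/2 * (\<Sum>j<N. mean ?PP (\<lambda>\<omega>. (h (fst \<omega>) - h (mix {j} \<omega>))\<^sup>2))"
  proof (intro mult_left_mono sum_mono)
    fix j
    have s: "{..<Suc j} = sym_diff {..<j} {j}" by auto
    have "mean ?PP (\<lambda>\<omega>. (h (mix {..<j} \<omega>) - h (mix {..<Suc j} \<omega>))\<^sup>2)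
      = mean (map_pmf (\<lambda>\<omega>. (mix {..<j} \<omega>, mix (sym_diff {..<j} {j}) \<omega>)) ?PP) (\<lambda>z. (h (fst z) - h (snd z))\<^sup>2)"
      unfolding s[symmetric] by simp
    also have "\<dots> = mean ?PP (\<lambda>\<omega>. (h (fst \<omega>) - h (mix {j} \<omega>))\<^sup>2)"
      unfolding Q_def by (subst map_mix2) simp_all
    finally have e: "mean ?PP (\<lambda>\<omega>. (h (mix {..<j} \<omega>) - h (mix {..<Suc j} \<omega>))\<^sup>2)
      = mean ?PP (\<lambda>\<omega>. (h (fst \<omega>) - h (mix {j} \<omega>))\<^sup>2)" .
    have "mean ?PP (\<lambda>\<omega>. (h (mix {..<j} \<omega>) - h (mix {..<Suc j} \<omega>)) * (h (fst \<omega>) - h (mix {j} \<omega>)))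
       \<le> mean ?PP (\<lambda>\<omega>. 1/2 * (h (mix {..<j} \<omega>) - h (mix {..<Suc j} \<omega>))\<^sup>2 + 1/2 * (h (fst \<omega>) - h (mix {j} \<omega>))\<^sup>2)"
    proof (intro integral_mono dm)
      have "a * b \<le> 1/2 * a\<^sup>2 + 1/2 * b\<^sup>2" for a b :: real
        using sum_squares_bound[of a b] by simp
      then show "(h (mix {..<j} \<omega>) - h (mix {..<Suc j} \<omega>)) * (h (fst \<omega>) - h (mix {j} \<omega>))
        \<le> 1/2 * (h (mix {..<j} \<omega>) - h (mix {..<Suc j} \<omega>))\<^sup>2 + 1/2 * (h (fst \<omega>) - h (mix {j} \<omega>))\<^sup>2" for \<omega> .
    qed (use d2 d20 in auto)
    also have "\<dots> = mean ?PP (\<lambda>\<omega>. (h (fst \<omega>) - h (mix {j} \<omega>))\<^sup>2)"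
      using d2 d20 e by simp
    finally show "mean ?PP (\<lambda>\<omega>. (h (mix {..<j} \<omega>) - h (mix {..<Suc j} \<omega>)) * (h (fst \<omega>) - h (mix {j} \<omega>)))
       \<le> mean ?PP (\<lambda>\<omega>. (h (fst \<omega>) - h (mix {j} \<omega>))\<^sup>2)" .
  qed simp
  finally show ?thesis .
qed

text \<open>Converts independent pairs into a pair of independent families. It serves twice: for two
  copies of the blocks, and for the decomposition of a block into walker step and cloud.\<close>

definition unzip_fun :: "('i \<Rightarrow> 'u \<times> 'w) \<Rightarrow> ('i \<Rightarrow> 'u) \<times> ('i \<Rightarrow> 'w)" where
  "unzip_fun z = (\<lambda>i. fst (z i), \<lambda>i. snd (z i))"

lemma map_unzip_fun:
  assumes fin: "finite I"
  shows "map_pmf unzip_fun (Pi_pmf I (a, b) (\<lambda>_. pair_pmf A B)) = pair_pmf (Pi_pmf I a (\<lambda>_. A)) (Pi_pmf I b (\<lambda>_. B))"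
proof (rule pmf_eqI)
  fix \<omega> :: "('a \<Rightarrow> 'b) \<times> ('a \<Rightarrow> 'c)"
  let ?z = "\<lambda>i. (fst \<omega> i, snd \<omega> i)"
  have inj: "inj (unzip_fun :: ('a \<Rightarrow> 'b \<times> 'c) \<Rightarrow> _)"
    by (rule injI) (auto simp: unzip_fun_def fun_eq_iff prod_eq_iff)
  have "pmf (map_pmf unzip_fun (Pi_pmf I (a, b) (\<lambda>_. pair_pmf A B))) (unzip_fun ?z) = pmf (Pi_pmf I (a, b) (\<lambda>_. pair_pmf A B)) ?z"
    by (rule pmf_map_inj'[OF inj])
  also have "\<dots> = pmf (Pi_pmf I a (\<lambda>_. A)) (fst \<omega>) * pmf (Pi_pmf I b (\<lambda>_. B)) (snd \<omega>)"
    by (auto simp: pmf_Pi[OF fin] pmf_pair prod.distrib)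
  finally show "pmf (map_pmf unzip_fun (Pi_pmf I (a, b) (\<lambda>_. pair_pmf A B))) \<omega> =
     pmf (pair_pmf (Pi_pmf I a (\<lambda>_. A)) (Pi_pmf I b (\<lambda>_. B))) \<omega>"
    by (cases \<omega>) (simp add: unzip_fun_def pmf_pair)
qed

lemma geometric_tail_le:
  assumes "0 < \<theta>" "\<theta> < (1::real)" "a \<le> b"
  shows "(\<Sum>n\<in>{b..<N}. \<theta> ^ (n - a)) \<le> \<theta> ^ (b - a) / (1 - \<theta>)"
proof -
  have "(\<Sum>n\<in>{b..<N}. \<theta> ^ (n - a)) = (\<Sum>n\<in>{b..<N}. \<theta> ^ (b - a) * \<theta> ^ (n - b))"
    using assms by (intro sum.cong) (auto simp flip: power_add)
  also have "\<dots> = \<theta> ^ (b - a) * (\<Sum>n<N - b. \<theta> ^ n)"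
    unfolding sum_distrib_left[symmetric]
    by (intro arg_cong2[where f="(*)"] refl sum.reindex_bij_witness[of _ "\<lambda>n. n + b" "\<lambda>n. n - b"]) auto
  also have "(\<Sum>n<N - b. \<theta> ^ n) \<le> (\<Sum>n. \<theta> ^ n)"
    using assms by (intro sum_le_suminf summable_geometric) auto
  also have "(\<Sum>n. \<theta> ^ n) = 1 / (1 - \<theta>)" using assms by (intro suminf_geometric) auto
  finally show ?thesis using assms by (simp add: mult_left_mono)
qed

definition nat_dist :: "nat \<Rightarrow> nat \<Rightarrow> nat" where "nat_dist i j = max i j - min i j"

lemma sum_nat_dist_le:
  assumes "0 < \<theta>" "\<theta> < (1::real)"
  shows "(\<Sum>j<N. \<theta> ^ nat_dist i j) \<le> 2 / (1 - \<theta>)"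
proof -
  have "(\<Sum>j<N. \<theta> ^ nat_dist i j) \<le> (\<Sum>j\<in>{..<i} \<union> {i..<N}. \<theta> ^ nat_dist i j)"
    using assms by (intro sum_mono2) auto
  also have "\<dots> = (\<Sum>j<i. \<theta> ^ nat_dist i j) + (\<Sum>j\<in>{i..<N}. \<theta> ^ nat_dist i j)"
    by (intro sum.union_disjoint) auto
  also have "(\<Sum>j\<in>{i..<N}. \<theta> ^ nat_dist i j) = (\<Sum>j\<in>{i..<N}. \<theta> ^ (j - i))"
    by (intro sum.cong) (auto simp: nat_dist_def)
  also have "\<dots> \<le> \<theta> ^ (i - i) / (1 - \<theta>)" using assms by (intro geometric_tail_le) auto
  also have "(\<Sum>j<i. \<theta> ^ nat_dist i j) \<le> (\<Sum>n\<in>{0..<Suc i}. \<theta> ^ (n - 0))"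
  proof -
    have "(\<Sum>j<i. \<theta> ^ nat_dist i j) = (\<Sum>n\<in>{1..i}. \<theta> ^ n)"
      by (intro sum.reindex_bij_witness[of _ "\<lambda>n. i - n" "\<lambda>n. i - n"]) (auto simp: nat_dist_def)
    also have "\<dots> \<le> (\<Sum>n\<in>{0..<Suc i}. \<theta> ^ n)" using assms by (intro sum_mono2) auto
    finally show ?thesis by simp
  qed
  also have "\<dots> \<le> \<theta> ^ (0 - 0) / (1 - \<theta>)" using assms by (intro geometric_tail_le) auto
  finally show ?thesis by simp
qed

text \<open>
  Resampling the block \<open>j\<close> changes the summand \<open>v n\<close> by an amount that decays exponentially in \<open>n - j\<close>.
  First differences of the sum are then bounded in \<open>L\<^sup>4\<close>, and second differences in the blocks
  \<open>i\<close> and \<open>j\<close> decay exponentially in \<open>\<bar>i - j\<bar>\<close>; this is what bounds the variance of \<open>T\<close> below.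
\<close>
locale causal_functional =
  fixes N :: nat and d :: 'u and D :: "'u pmf" and v :: "nat \<Rightarrow> (nat \<Rightarrow> 'u) \<Rightarrow> real"
    and K \<theta> :: real
  assumes theta: "0 < \<theta>" "\<theta> < 1"
    and causal: "\<And>n x y. (\<And>i. i \<le> n \<Longrightarrow> x i = y i) \<Longrightarrow> v n x = v n y"
    and v_L4: "\<And>n. n < N \<Longrightarrow> L4 (Pi_pmf {..<N} d (\<lambda>_. D)) (v n)"
    and influence: "\<And>n j. n < N \<Longrightarrow> j \<le> n \<Longrightarrow>
      mean (pair_pmf (Pi_pmf {..<N} d (\<lambda>_. D)) (Pi_pmf {..<N} d (\<lambda>_. D)))
        (\<lambda>\<omega>. (v n (fst \<omega>) - v n (mix {j} \<omega>)) ^ 4) \<le> K * \<theta> ^ (4 * (n - j))"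
begin

definition Q where "Q = Pi_pmf {..<N} d (\<lambda>_. D)"
definition PP where "PP = pair_pmf Q Q"
text \<open>Two copies regarded as \<open>N\<close> independent pairs: in this form \<open>T\<close>
  is again a function of independent coordinates and \<open>efron_stein\<close> applies to
  it.\<close>

definition Q2 where "Q2 = Pi_pmf {..<N} (d, d) (\<lambda>_. pair_pmf D D)"
definition f where "f x = (\<Sum>n<N. v n x)"
text \<open>Summing the influences of a block over all later indices costs a factor
  \<open>1 / (1 - \<theta>)\<close> in L^4 norm, hence the fourth power.\<close>

definition K1 where "K1 = K / (1 - \<theta>) ^ 4"

lemma f_L4: "L4 Q f" unfolding f_def Q_def by (intro L4_sum v_L4) auto

lemma map_mix_Q: "map_pmf (mix A) PP = Q" unfolding PP_def Q_def by (rule map_mix) simp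

lemma map_mix_pair: "map_pmf (\<lambda>\<omega>. (mix A \<omega>, mix (sym_diff A B) \<omega>)) PP = map_pmf (\<lambda>\<omega>. (fst \<omega>, mix B \<omega>)) PP"
  unfolding PP_def Q_def by (rule map_mix2) simp

lemma L4_mix: "L4 Q F \<Longrightarrow> L4 PP (\<lambda>\<omega>. F (mix A \<omega>))"
  using L4_map[of "mix A" PP F] by (simp add: map_mix_Q)

lemma L4_v: "n < N \<Longrightarrow> L4 Q (v n)" using v_L4 by (simp add: Q_def)

text \<open>Extracts the two facts that the difference bounds rest on, the joint law of one
  resampling and agreement off \<open>j\<close>. The same estimates then cover interpolations and
  resampled pairs of blocks.\<close>

definition neighbours :: "'x pmf \<Rightarrow> nat \<Rightarrow> ('x \<Rightarrow> nat \<Rightarrow> 'u) \<Rightarrow> ('x \<Rightarrow> nat \<Rightarrow> 'u) \<Rightarrow> bool" where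
  "neighbours p j a b \<longleftrightarrow> map_pmf (\<lambda>x. (a x, b x)) p = map_pmf (\<lambda>\<omega>. (fst \<omega>, mix {j} \<omega>)) PP \<and> (\<forall>x. \<forall>i. i \<noteq> j \<longrightarrow> a x i = b x i)"

lemma neighbours_law:
  assumes "neighbours p j a b" shows "map_pmf a p = Q" "map_pmf b p = Q"
proof -
  have "map_pmf a p = map_pmf fst (map_pmf (\<lambda>x. (a x, b x)) p)" by (simp add: pmf.map_comp o_def)
  also have "\<dots> = map_pmf (mix {}) PP" using assms by (simp add: neighbours_def pmf.map_comp o_def)
  finally show "map_pmf a p = Q" by (simp only: map_mix_Q)
  have "map_pmf b p = map_pmf snd (map_pmf (\<lambda>x. (a x, b x)) p)" by (simp add: pmf.map_comp o_def)
  also have "\<dots> = map_pmf (mix {j}) PP" using assms by (simp add: neighbours_def pmf.map_comp o_def)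
  finally show "map_pmf b p = Q" by (simp only: map_mix_Q)
qed

lemma neighbours_L4:
  assumes "neighbours p j a b" "L4 Q F" shows "L4 p (\<lambda>x. F (a x))" "L4 p (\<lambda>x. F (b x))"
  using neighbours_law[OF assms(1)] assms(2) L4_map[of a p F] L4_map[of b p F] by auto

lemma neighbours_influence:
  assumes "neighbours p j a b" "n < N" "j \<le> n"
  shows "mean p (\<lambda>x. (v n (a x) - v n (b x)) ^ 4) \<le> K * (\<theta> ^ (n - j)) ^ 4"
proof -
  have "mean p (\<lambda>x. (v n (a x) - v n (b x)) ^ 4) = mean (map_pmf (\<lambda>x. (a x, b x)) p) (\<lambda>z. (v n (fst z) - v n (snd z)) ^ 4)"
    by simp
  also have "\<dots> = mean PP (\<lambda>\<omega>. (v n (fst \<omega>) - v n (mix {j} \<omega>)) ^ 4)"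
    using assms by (simp add: neighbours_def)
  also have "\<dots> \<le> K * \<theta> ^ (4 * (n - j))" using influence[OF assms(2,3)] by (simp add: PP_def Q_def)
  finally show ?thesis by (simp add: power_mult[symmetric] mult.commute)
qed

lemma neighbours_causal: "neighbours p j a b \<Longrightarrow> n < j \<Longrightarrow> v n (a x) = v n (b x)"
  by (rule causal) (auto simp: neighbours_def)

lemma K_nonneg: assumes "0 < N" shows "K \<ge> 0"
proof -
  have "0 \<le> mean PP (\<lambda>\<omega>. (v 0 (fst \<omega>) - v 0 (mix {0} \<omega>)) ^ 4)"
    by (intro integral_nonneg_AE) auto
  also have "\<dots> \<le> K" using influence[OF assms, of 0] by (simp add: PP_def Q_def)
  finally show ?thesis .
qed

lemma sum_drop: "(\<And>n. n < j \<Longrightarrow> g n = 0) \<Longrightarrow> (\<Sum>n<N. g n) = (\<Sum>n\<in>{j..<N}. g n :: real)"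
  by (rule sum.mono_neutral_right) force+

lemma first_difference:
  assumes nb: "neighbours p j a b" and N: "0 < N"
  shows "mean p (\<lambda>x. (f (a x) - f (b x)) ^ 4) \<le> K1"
proof -
  have eq: "f (a x) - f (b x) = (\<Sum>n\<in>{j..<N}. v n (a x) - v n (b x))" for x
    unfolding f_def sum_subtractf[symmetric] by (rule sum_drop) (simp add: neighbours_causal[OF nb])
  have "mean p (\<lambda>x. (f (a x) - f (b x)) ^ 4) \<le> K * (\<Sum>n\<in>{j..<N}. \<theta> ^ (n - j)) ^ 4"
    unfolding eq using theta
    by (intro expectation_sum_pow4_le neighbours_influence[OF nb] L4_diff neighbours_L4[OF nb] L4_v) auto
  also have "\<dots> \<le> K * (\<theta> ^ (j - j) / (1 - \<theta>)) ^ 4"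
    using theta by (intro mult_left_mono power_mono geometric_tail_le K_nonneg N sum_nonneg) auto
  finally show ?thesis by (simp add: K1_def power_divide)
qed

text \<open>The four terms can be paired along \<open>i\<close> or along \<open>j\<close>. Pairing
  along the larger index removes every summand before it by causality; pairing along the smaller one
  gives the better decay for the summands that remain.\<close>

lemma second_difference:
  assumes ab: "neighbours p j a b" and a'b': "neighbours p j a' b'"
    and aa': "neighbours p i a a'" and bb': "i \<noteq> j \<Longrightarrow> neighbours p i b b'" and N: "0 < N"
  shows "mean p (\<lambda>x. ((f (a x) - f (b x)) - (f (a' x) - f (b' x))) ^ 4) \<le> 16 * K1 * (\<theta> ^ nat_dist i j) ^ 4"
proof -
  let ?\<delta> = "\<lambda>n x. (v n (a x) - v n (b x)) - (v n (a' x) - v n (b' x))"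
  note L = neighbours_L4[OF ab] neighbours_L4[OF a'b']
  have fL: "L4 p (\<lambda>x. f (a x) - f (b x))" "L4 p (\<lambda>x. f (a' x) - f (b' x))"
    by (intro L4_diff L f_L4)+
  have four: "mean p (\<lambda>x. (g x - h x) ^ 4) \<le> 8 * (mean p (\<lambda>x. g x ^ 4) + mean p (\<lambda>x. h x ^ 4))"
    if "L4 p g" "L4 p h" for g h
  proof -
    have "mean p (\<lambda>x. (g x - h x) ^ 4) \<le> mean p (\<lambda>x. 8 * (g x ^ 4 + h x ^ 4))"
      using that L4_diff[OF that] pow4_add_le[of "g x" "- h x" for x] unfolding L4_def
      by (intro integral_mono) auto
    also have "\<dots> = 8 * (mean p (\<lambda>x. g x ^ 4) + mean p (\<lambda>x. h x ^ 4))"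
      using that unfolding L4_def by simp
    finally show ?thesis .
  qed
  show ?thesis
  proof (cases "i = j")
    case True
    have "mean p (\<lambda>x. ((f (a x) - f (b x)) - (f (a' x) - f (b' x))) ^ 4) \<le> 8 * (K1 + K1)"
      by (rule order_trans[OF four[OF fL]], intro mult_left_mono add_mono first_difference[OF ab N] first_difference[OF a'b' N]) simp
    then show ?thesis using True by (simp add: nat_dist_def)
  next
    case False
    note bb = bb'[OF False]
    let ?m = "min i j" and ?M = "max i j"
    have z: "?\<delta> n x = 0" if "n < ?M" for n x
    proof (cases "i < j")
      case True
      then have "n < j" using that by simp
      then show ?thesis using neighbours_causal[OF ab] neighbours_causal[OF a'b'] by simp
    next
      case False
      then have "n < i" using that by simp
      then show ?thesis using neighbours_causal[OF aa'] neighbours_causal[OF bb] by simp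
    qed
    have eq: "(f (a x) - f (b x)) - (f (a' x) - f (b' x)) = (\<Sum>n\<in>{?M..<N}. ?\<delta> n x)" for x
      unfolding f_def sum_subtractf[symmetric] by (rule sum_drop) (rule z)
    have E: "mean p (\<lambda>x. ?\<delta> n x ^ 4) \<le> (16 * K) * (\<theta> ^ (n - ?m)) ^ 4" if "n \<in> {?M..<N}" for n
    proof (cases "i < j")
      case True
      have n: "n < N" "i \<le> n" using that by auto
      have "mean p (\<lambda>x. ?\<delta> n x ^ 4) = mean p (\<lambda>x. ((v n (a x) - v n (a' x)) - (v n (b x) - v n (b' x))) ^ 4)"
        by (simp add: algebra_simps)
      also have "\<dots> \<le> 8 * (mean p (\<lambda>x. (v n (a x) - v n (a' x)) ^ 4) + mean p (\<lambda>x. (v n (b x) - v n (b' x)) ^ 4))"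
        by (intro four L4_diff L L4_v n)
      also have "\<dots> \<le> 8 * (K * (\<theta> ^ (n - i)) ^ 4 + K * (\<theta> ^ (n - i)) ^ 4)"
        by (intro mult_left_mono add_mono neighbours_influence[OF aa' n] neighbours_influence[OF bb n]) simp
      finally show ?thesis using True by simp
    next
      case False
      have n: "n < N" "j \<le> n" using that by auto
      have "mean p (\<lambda>x. ?\<delta> n x ^ 4) \<le> 8 * (mean p (\<lambda>x. (v n (a x) - v n (b x)) ^ 4) + mean p (\<lambda>x. (v n (a' x) - v n (b' x)) ^ 4))"
        by (intro four L4_diff L L4_v n)
      also have "\<dots> \<le> 8 * (K * (\<theta> ^ (n - j)) ^ 4 + K * (\<theta> ^ (n - j)) ^ 4)"
        by (intro mult_left_mono add_mono neighbours_influence[OF ab n] neighbours_influence[OF a'b' n]) simp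
      finally show ?thesis using False by simp
    qed
    have "mean p (\<lambda>x. ((f (a x) - f (b x)) - (f (a' x) - f (b' x))) ^ 4)
        \<le> (16 * K) * (\<Sum>n\<in>{?M..<N}. \<theta> ^ (n - ?m)) ^ 4"
      unfolding eq using theta
      by (intro expectation_sum_pow4_le E L4_diff L L4_v) auto
    also have "\<dots> \<le> (16 * K) * (\<theta> ^ (?M - ?m) / (1 - \<theta>)) ^ 4"
      using theta K_nonneg[OF N] by (intro mult_left_mono power_mono geometric_tail_le sum_nonneg) auto
    finally show ?thesis by (simp add: K1_def power_divide nat_dist_def)
  qed
qed

text \<open>The integrand of \<open>interpolation\<close> for \<open>h = k = f\<close>, so its mean
  is the variance of \<open>f\<close>. It is not conditioned on the first copy, because as a
  function of paired blocks its variance can be bounded by resampling.\<close>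

definition T :: "(nat \<Rightarrow> 'u) \<times> (nat \<Rightarrow> 'u) \<Rightarrow> real" where
  "T \<omega> = 1/2 * (\<Sum>j<N. (f (mix {..<j} \<omega>) - f (mix {..<Suc j} \<omega>)) * (f (fst \<omega>) - f (mix {j} \<omega>)))"

lemma map_unzip_Q2: "map_pmf unzip_fun Q2 = PP" unfolding Q2_def PP_def Q_def by (rule map_unzip_fun) simp

text \<open>Two resamplings commute: \<open>j\<close> moves between the two copies inside its pair,
  while \<open>i\<close> replaces an entire pair by a fresh one. The sides of the resulting square
  are all pairs of neighbours, as the second differences require.\<close>

lemma resample_neighbours:
  defines "R \<equiv> pair_pmf Q2 Q2"
  defines "a \<equiv> \<lambda>C z. mix C (unzip_fun (fst z))" and "a' \<equiv> \<lambda>C i z. mix C (unzip_fun (mix {i} z))"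
  shows "neighbours R j (a C) (a (sym_diff C {j}))" "neighbours R j (a' C i) (a' (sym_diff C {j}) i)"
    "neighbours R i (a C) (a' C i)"
proof -
  have z: "map_pmf (\<lambda>z. unzip_fun (fst z)) R = PP"
    using map_fst_pair_pmf[of Q2 Q2] map_unzip_Q2 by (simp add: R_def flip: pmf.map_comp[unfolded o_def])
  have z': "map_pmf (\<lambda>z. unzip_fun (mix {i} z)) R = PP"
  proof -
    have "map_pmf (mix {i}) R = Q2" unfolding R_def Q2_def by (rule map_mix) simp
    then show ?thesis using map_unzip_Q2 by (simp flip: pmf.map_comp[unfolded o_def])
  qed
  have two: "map_pmf (\<lambda>z. (mix C (g z), mix (sym_diff C {j}) (g z))) R = map_pmf (\<lambda>\<omega>. (fst \<omega>, mix {j} \<omega>)) PP"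
    if "map_pmf g R = PP" for g
  proof -
    have "map_pmf (\<lambda>z. (mix C (g z), mix (sym_diff C {j}) (g z))) R
       = map_pmf (\<lambda>\<omega>. (mix C \<omega>, mix (sym_diff C {j}) \<omega>)) (map_pmf g R)"
      by (simp add: pmf.map_comp o_def)
    also have "\<dots> = map_pmf (\<lambda>\<omega>. (fst \<omega>, mix {j} \<omega>)) PP" unfolding that by (rule map_mix_pair)
    finally show ?thesis .
  qed
  show "neighbours R j (a C) (a (sym_diff C {j}))" "neighbours R j (a' C i) (a' (sym_diff C {j}) i)"
    using two[OF z] two[OF z'] by (auto simp: neighbours_def a_def a'_def) (auto simp: mix_def)
  let ?g = "\<lambda>z. (mix C (unzip_fun (fst z)), mix C (unzip_fun (snd z)))"
  have g: "map_pmf ?g R = PP"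
  proof -
    have "map_pmf ?g R = map_pmf (\<lambda>(x, y). (mix C (unzip_fun x), mix C (unzip_fun y))) (pair_pmf Q2 Q2)"
      by (simp add: R_def case_prod_beta')
    also have "\<dots> = pair_pmf (map_pmf (\<lambda>x. mix C (unzip_fun x)) Q2) (map_pmf (\<lambda>x. mix C (unzip_fun x)) Q2)"
      by (rule map_pair)
    also have "map_pmf (\<lambda>x. mix C (unzip_fun x)) Q2 = Q"
      using map_mix_Q[of C] map_unzip_Q2 by (metis pmf.map_comp[unfolded o_def])
    finally show ?thesis by (simp add: PP_def)
  qed
  have e: "a' C i z = mix {i} (?g z)" "a C z = fst (?g z)" for z
    by (auto simp: a'_def a_def mix_def unzip_fun_def fun_eq_iff)
  have "map_pmf (\<lambda>z. (a C z, a' C i z)) R = map_pmf (\<lambda>\<omega>. (fst \<omega>, mix {i} \<omega>)) (map_pmf ?g R)"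
    unfolding pmf.map_comp o_def e ..
  also have "\<dots> = map_pmf (\<lambda>\<omega>. (fst \<omega>, mix {i} \<omega>)) PP" unfolding g ..
  finally show "neighbours R i (a C) (a' C i)"
    by (auto simp: neighbours_def a_def a'_def mix_def unzip_fun_def)
qed

text \<open>Young's inequality with weight \<open>w\<^sup>2\<close> balances the small fourth moment
  of a difference against the bounded one of the other factor. The product rule has two such terms,
  each giving 16 + 1, hence 34.\<close>

lemma product_difference_sq:
  assumes L: "L4 p a" "L4 p b" "L4 p a'" "L4 p b'" and w: "w > 0"
    and a': "mean p (\<lambda>x. a' x ^ 4) \<le> k" and b: "mean p (\<lambda>x. b x ^ 4) \<le> k"
    and da: "mean p (\<lambda>x. (a x - a' x) ^ 4) \<le> 16 * k * w ^ 4" and db: "mean p (\<lambda>x. (b x - b' x) ^ 4) \<le> 16 * k * w ^ 4"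
  shows "mean p (\<lambda>x. (a x * b x - a' x * b' x)\<^sup>2) \<le> 34 * k * w\<^sup>2"
proof -
  have I: "integrable (measure_pmf p) (\<lambda>x. a' x ^ 4)" "integrable (measure_pmf p) (\<lambda>x. b x ^ 4)"
    "integrable (measure_pmf p) (\<lambda>x. (a x - a' x) ^ 4)" "integrable (measure_pmf p) (\<lambda>x. (b x - b' x) ^ 4)"
    using L L4_diff[OF L(1,3)] L4_diff[OF L(2,4)] by (simp_all add: L4_def)
  have pt: "(a x * b x - a' x * b' x)\<^sup>2 \<le>
     ((a x - a' x) ^ 4 / w\<^sup>2 + w\<^sup>2 * b x ^ 4) + ((b x - b' x) ^ 4 / w\<^sup>2 + w\<^sup>2 * a' x ^ 4)" for x
  proof -
    have *: "2 * (u\<^sup>2 * y\<^sup>2) \<le> u ^ 4 / w\<^sup>2 + w\<^sup>2 * y ^ 4" for u y :: real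
    proof -
      have "2 * (u\<^sup>2 / w) * (w * y\<^sup>2) \<le> (u\<^sup>2 / w)\<^sup>2 + (w * y\<^sup>2)\<^sup>2" by (rule sum_squares_bound)
      then show ?thesis using w by (simp add: power_divide power_mult_distrib flip: power_mult)
    qed
    have "(a x * b x - a' x * b' x) = (a x - a' x) * b x + (b x - b' x) * a' x" by (simp add: algebra_simps)
    also have "(\<dots>)\<^sup>2 \<le> 2 * ((a x - a' x) * b x)\<^sup>2 + 2 * ((b x - b' x) * a' x)\<^sup>2"
      using sum_squares_bound[of "(a x - a' x) * b x" "(b x - b' x) * a' x"] by (simp add: power2_sum)
    also have "\<dots> \<le> ((a x - a' x) ^ 4 / w\<^sup>2 + w\<^sup>2 * b x ^ 4) + ((b x - b' x) ^ 4 / w\<^sup>2 + w\<^sup>2 * a' x ^ 4)"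
      unfolding power_mult_distrib by (intro add_mono *)
    finally show ?thesis .
  qed
  have int: "integrable (measure_pmf p) (\<lambda>x. (a x * b x - a' x * b' x)\<^sup>2)"
    using L2_diff[OF L4_sum_prod_sq[of "{()}" p "\<lambda>_. a" "\<lambda>_. b"] L4_sum_prod_sq[of "{()}" p "\<lambda>_. a'" "\<lambda>_. b'"]] L by simp
  have "mean p (\<lambda>x. (a x * b x - a' x * b' x)\<^sup>2) \<le> mean p (\<lambda>x.
     ((a x - a' x) ^ 4 / w\<^sup>2 + w\<^sup>2 * b x ^ 4) + ((b x - b' x) ^ 4 / w\<^sup>2 + w\<^sup>2 * a' x ^ 4))"
    using I by (intro integral_mono int pt) auto
  also have "\<dots> = (mean p (\<lambda>x. (a x - a' x) ^ 4) / w\<^sup>2 + w\<^sup>2 * mean p (\<lambda>x. b x ^ 4)) + (mean p (\<lambda>x. (b x - b' x) ^ 4) / w\<^sup>2 + w\<^sup>2 * mean p (\<lambda>x. a' x ^ 4))"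
    using I by simp
  also have "\<dots> \<le> (16 * k * w ^ 4 / w\<^sup>2 + w\<^sup>2 * k) + (16 * k * w ^ 4 / w\<^sup>2 + w\<^sup>2 * k)"
    using w by (intro add_mono divide_right_mono mult_left_mono da db a' b) auto
  also have "16 * k * w ^ 4 / w\<^sup>2 = 16 * k * w\<^sup>2" using w by (simp add: power4_eq_xxxx power2_eq_square)
  finally show ?thesis by (simp add: algebra_simps)
qed

lemma T_sq_integrable: "integrable (measure_pmf PP) (\<lambda>\<omega>. (T \<omega>)\<^sup>2)"
proof -
  have "integrable (measure_pmf PP) (\<lambda>\<omega>. (\<Sum>j<N. (f (mix {..<j} \<omega>) - f (mix {..<Suc j} \<omega>)) * (f (mix {} \<omega>) - f (mix {j} \<omega>)))\<^sup>2)"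
    by (intro L4_sum_prod_sq L4_diff L4_mix f_L4)
  then show ?thesis by (simp add: T_def power_divide)
qed

text \<open>Replacing pair \<open>i\<close> changes the \<open>j\<close>-th product by an amount
  decaying in the distance of \<open>i\<close> and \<open>j\<close>, so the total change is bounded
  uniformly in \<open>N\<close>. Efron-Stein adds \<open>N\<close> such bounds, and its factor 1/2
  turns 34 into 17.\<close>

lemma T_variance:
  assumes N: "0 < N"
  shows "mean PP (\<lambda>\<omega>. (T \<omega>)\<^sup>2) - (mean PP T)\<^sup>2 \<le> 17 * K1 * N / (1 - \<theta>)\<^sup>2"
proof -
  let ?R = "pair_pmf Q2 Q2"
  let ?a = "\<lambda>C z. mix C (unzip_fun (fst z))" and ?a' = "\<lambda>C i z. mix C (unzip_fun (mix {i} z))"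
  have PQ: "mean PP F = mean Q2 (\<lambda>z. F (unzip_fun z))" for F
    using integral_map_pmf[of unzip_fun Q2 F] by (simp add: map_unzip_Q2)
  have int: "integrable (measure_pmf Q2) (\<lambda>z. (T (unzip_fun z))\<^sup>2)"
    using T_sq_integrable by (simp flip: map_unzip_Q2)
  have K1: "K1 \<ge> 0" using K_nonneg[OF N] by (simp add: K1_def)
  have each: "mean ?R (\<lambda>z. (T (unzip_fun (fst z)) - T (unzip_fun (mix {i} z)))\<^sup>2) \<le> 34 * K1 / (1 - \<theta>)\<^sup>2" for i
  proof -
    let ?A = "\<lambda>j z. f (?a {..<j} z) - f (?a {..<Suc j} z)" and ?B = "\<lambda>j z. f (?a {} z) - f (?a {j} z)"
    let ?A' = "\<lambda>j z. f (?a' {..<j} i z) - f (?a' {..<Suc j} i z)" and ?B' = "\<lambda>j z. f (?a' {} i z) - f (?a' {j} i z)"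
    let ?c = "\<lambda>j z. ?A j z * ?B j z - ?A' j z * ?B' j z"
    have s: "{..<Suc j} = sym_diff {..<j} {j}" "{j} = sym_diff {} {j}" for j :: nat by auto
    have nA: "neighbours ?R j (?a {..<j}) (?a {..<Suc j})" "neighbours ?R j (?a' {..<j} i) (?a' {..<Suc j} i)" for j
      using resample_neighbours(1)[where j=j and C="{..<j}"] resample_neighbours(2)[where i=i and j=j and C="{..<j}"] by (simp_all only: s(1)[symmetric])
    have nB: "neighbours ?R j (?a {}) (?a {j})" "neighbours ?R j (?a' {} i) (?a' {j} i)" for j
      using resample_neighbours(1)[where j=j and C="{}"] resample_neighbours(2)[where i=i and j=j and C="{}"] by (simp_all only: s(2)[symmetric])
    note nI = resample_neighbours(3)[where i=i]
    have L: "L4 ?R (?A j)" "L4 ?R (?B j)" "L4 ?R (?A' j)" "L4 ?R (?B' j)" for j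
      by (intro L4_diff neighbours_L4[OF nA(1)] neighbours_L4[OF nA(2)] neighbours_L4[OF nB(1)] neighbours_L4[OF nB(2)] f_L4)+
    have cE: "mean ?R (\<lambda>z. (?c j z)\<^sup>2) \<le> 34 * K1 * (\<theta> ^ nat_dist i j)\<^sup>2" for j
      using theta
      by (intro product_difference_sq L first_difference[OF nA(2) N] first_difference[OF nB(1) N]
          second_difference[OF nA nI nI N] second_difference[OF nB nI nI N]) auto
    have cI: "integrable (measure_pmf ?R) (\<lambda>z. (?c j z)\<^sup>2)" for j
      using L2_diff[OF L4_sum_prod_sq[of "{()}" ?R "\<lambda>_. ?A j" "\<lambda>_. ?B j"] L4_sum_prod_sq[of "{()}" ?R "\<lambda>_. ?A' j" "\<lambda>_. ?B' j"]] L[of j]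
      by simp
    have scI: "integrable (measure_pmf ?R) (\<lambda>z. (\<Sum>j<N. ?c j z)\<^sup>2)"
      unfolding sum_subtractf by (intro L2_diff L4_sum_prod_sq L)
    have "mean ?R (\<lambda>z. (T (unzip_fun (fst z)) - T (unzip_fun (mix {i} z)))\<^sup>2) = mean ?R (\<lambda>z. 1/4 * (\<Sum>j<N. ?c j z)\<^sup>2)"
    proof -
      have "T (unzip_fun (fst z)) - T (unzip_fun (mix {i} z)) = 1/2 * (\<Sum>j<N. ?c j z)" for z
        unfolding T_def sum_subtractf by (simp add: right_diff_distrib)
      note eq = this
      show ?thesis unfolding eq power_mult_distrib by (simp add: power_divide)
    qed
    also have "\<dots> = 1/4 * mean ?R (\<lambda>z. (\<Sum>j<N. ?c j z)\<^sup>2)" by simp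
    also have "\<dots> \<le> 1/4 * ((34 * K1) * (\<Sum>j<N. \<theta> ^ nat_dist i j)\<^sup>2)"
      using theta by (intro mult_left_mono expectation_sum_sq_le cE cI scI) auto
    also have "\<dots> \<le> 1/4 * ((34 * K1) * (2 / (1 - \<theta>))\<^sup>2)"
      using theta K1 by (intro mult_left_mono power_mono sum_nat_dist_le sum_nonneg) auto
    also have "\<dots> = 34 * K1 / (1 - \<theta>)\<^sup>2" by (simp add: power_divide)
    finally show ?thesis .
  qed
  have "mean PP (\<lambda>\<omega>. (T \<omega>)\<^sup>2) - (mean PP T)\<^sup>2 = mean Q2 (\<lambda>z. (T (unzip_fun z))\<^sup>2) - (mean Q2 (\<lambda>z. T (unzip_fun z)))\<^sup>2"
    by (simp add: PQ)
  also have "\<dots> \<le> 1/2 * (\<Sum>i<N. mean ?R (\<lambda>z. (T (unzip_fun (fst z)) - T (unzip_fun (mix {i} z)))\<^sup>2))"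
    using efron_stein[of N "(d, d)" "pair_pmf D D" "\<lambda>z. T (unzip_fun z)"] int by (simp add: Q2_def)
  also have "\<dots> \<le> 1/2 * (\<Sum>i<N. 34 * K1 / (1 - \<theta>)\<^sup>2)"
    by (intro mult_left_mono sum_mono each) auto
  finally show ?thesis by (simp add: mult_ac)
qed

text \<open>A discrete integration by parts: in \<open>interpolation\<close> with the second
  function \<open>g (f / s)\<close>, the increment of \<open>g\<close> is linearized at the first
  copy. The linear part produces \<open>T\<close>, whose distance from its mean
  \<open>s\<^sup>2\<close> gives the first error term; the Taylor remainders, products of three
  differences, give the second.\<close>

theorem stein_discrepancy:
  assumes N: "0 < N" and s: "s > 0" and mean: "mean Q f = 0" and var: "mean Q (\<lambda>x. (f x)\<^sup>2) = s\<^sup>2"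
    and g: "\<And>x. (g has_real_derivative g' x) (at x)" and B1: "\<And>x. \<bar>g' x\<bar> \<le> B1"
    and B2: "\<And>x y. \<bar>g' x - g' y\<bar> \<le> B2 * \<bar>x - y\<bar>"
  shows "\<bar>mean Q (\<lambda>x. g' (f x / s)) - mean Q (\<lambda>x. f x / s * g (f x / s))\<bar>
    \<le> B1 * sqrt (17 * K1 * N / (1 - \<theta>)\<^sup>2) / s\<^sup>2 + B2 * N * (1 + K1) / (2 * s ^ 3)"
proof -
  let ?A = "\<lambda>j \<omega>. f (mix {..<j} \<omega>) - f (mix {..<Suc j} \<omega>)" and ?B = "\<lambda>j \<omega>. f (fst \<omega>) - f (mix {j} \<omega>)"
  let ?k = "\<lambda>x. g (f x / s)" and ?G = "\<lambda>\<omega>. g' (f (fst \<omega>) / s)"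
  have B1p: "B1 \<ge> 0" using B1[of 0] by linarith
  have B2p: "B2 \<ge> 0" using B2[of 1 0] by simp
  have K1: "K1 \<ge> 0" using K_nonneg[OF N] by (simp add: K1_def)
  have gl: "\<bar>g x - g y\<bar> \<le> B1 * \<bar>x - y\<bar>" for x y
    using field_differentiable_bound[of UNIV g g' B1 x y, OF convex_UNIV g] B1 by (auto simp: abs_minus_commute)
  \<comment> \<open>The mean value theorem and the Lipschitz bound on \<open>g'\<close> replace a
    second-order Taylor formula, so \<open>g'\<close> need not be differentiable.\<close>
  have taylor: "\<bar>g x - g y - g' x * (x - y)\<bar> \<le> B2 * (x - y)\<^sup>2" for x y
  proof -
    have "\<exists>c. min x y \<le> c \<and> c \<le> max x y \<and> g x - g y = (x - y) * g' c"
    proof (cases x y rule: linorder_cases)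
      case less
      with MVT2[of x y g g'] g obtain c where "x < c" "c < y" "g y - g x = (y - x) * g' c" by blast
      then show ?thesis by (intro exI[of _ c]) (auto simp: algebra_simps)
    next
      case greater
      with MVT2[of y x g g'] g obtain c where "y < c" "c < x" "g x - g y = (x - y) * g' c" by blast
      then show ?thesis by (intro exI[of _ c]) auto
    qed auto
    then obtain c where c: "min x y \<le> c" "c \<le> max x y" "g x - g y = (x - y) * g' c" by blast
    have "g x - g y - g' x * (x - y) = (g' c - g' x) * (x - y)" using c by (simp add: algebra_simps)
    also have "\<bar>\<dots>\<bar> \<le> (B2 * \<bar>c - x\<bar>) * \<bar>x - y\<bar>"
      unfolding abs_mult by (intro mult_right_mono B2) auto
    also have "\<dots> \<le> (B2 * \<bar>x - y\<bar>) * \<bar>x - y\<bar>"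
      using c B2p by (intro mult_right_mono mult_left_mono) (auto simp: min_def max_def split: if_splits)
    also have "\<dots> = B2 * (x - y)\<^sup>2" by (simp add: power2_eq_square mult.assoc)
    finally show ?thesis .
  qed
  have fs: "L4 Q (\<lambda>x. f x / s)" using L4_cmult[OF f_L4, of "1/s"] by simp
  have "L4 Q (\<lambda>x. g (f x / s) - g 0)"
  proof (rule L4_mono[OF L4_cmult[OF fs, of B1]])
    show "\<bar>g (f x / s) - g 0\<bar> \<le> \<bar>B1 * (f x / s)\<bar>" for x
      using gl[of "f x / s" 0] B1p by (simp add: abs_mult)
  qed
  from L4_add[OF this L4_const[of Q "g 0"]] have kL: "L4 Q ?k" by simp
  have mL: "L4 PP (\<lambda>\<omega>. F (fst \<omega>))" if "L4 Q F" for F using L4_mix[OF that, of "{}"] by simp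
  have GL: "L4 PP ?G" by (rule L4_bounded[of _ B1]) (rule B1)
  have AL: "L4 PP (?A j)" for j by (intro L4_diff L4_mix f_L4)
  have BL: "L4 PP (?B j)" for j by (intro L4_diff L4_mix mL f_L4)
  have kdL: "L4 PP (\<lambda>\<omega>. ?k (fst \<omega>) - ?k (mix {j} \<omega>))" for j by (intro L4_diff L4_mix[OF kL] mL[OF kL])
  have EQ: "mean PP (\<lambda>\<omega>. F (fst \<omega>)) = mean Q F" for F
    using expectation_mix[of "{..<N}" d D F "{}"] by (simp add: PP_def Q_def)
  have ET: "mean PP T = s\<^sup>2"
  proof -
    have "s\<^sup>2 = 1/2 * (\<Sum>j<N. mean PP (\<lambda>\<omega>. ?A j \<omega> * ?B j \<omega>))"
      using interpolation[of N d D f f] L4_integrable_sq[OF f_L4] mean var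
      by (simp add: PP_def Q_def power2_eq_square)
    also have "\<dots> = mean PP T"
      using L4_integrable2[OF AL BL] unfolding T_def by simp
    finally show ?thesis by simp
  qed
  define r where "r j \<omega> = (?k (fst \<omega>) - ?k (mix {j} \<omega>)) - ?G \<omega> * (?B j \<omega> / s)" for j \<omega>
  have rb: "\<bar>r j \<omega>\<bar> \<le> B2 * (?B j \<omega> / s)\<^sup>2" for j \<omega>
    using taylor[of "f (fst \<omega>) / s" "f (mix {j} \<omega>) / s"] by (simp add: r_def diff_divide_distrib)
  have GAB: "integrable (measure_pmf PP) (\<lambda>\<omega>. ?G \<omega> * ?A j \<omega> * ?B j \<omega>)" for j
    by (intro L4_integrable3 GL AL BL)
  have Ak: "integrable (measure_pmf PP) (\<lambda>\<omega>. ?A j \<omega> * (?k (fst \<omega>) - ?k (mix {j} \<omega>)))" for j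
    by (intro L4_integrable2 AL kdL)
  have Ar_eq: "?A j \<omega> * r j \<omega> = ?A j \<omega> * (?k (fst \<omega>) - ?k (mix {j} \<omega>)) - (1/s) * (?G \<omega> * ?A j \<omega> * ?B j \<omega>)" for j \<omega>
  proof -
    have "a * (k - g * (b / s)) = a * k - (1/s) * (g * a * b)" for a b k g :: real
      by (simp add: right_diff_distrib)
    then show ?thesis unfolding r_def .
  qed
  have Ar: "integrable (measure_pmf PP) (\<lambda>\<omega>. ?A j \<omega> * r j \<omega>)" for j
    unfolding Ar_eq using Ak GAB by (intro Bochner_Integration.integrable_diff integrable_mult_right)
  have nA: "mean PP (\<lambda>\<omega>. ?A j \<omega> ^ 4) \<le> K1" for j
  proof (rule first_difference[OF _ N])
    have s: "sym_diff {..<j} {j} = {..<Suc j}" by auto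
    show "neighbours PP j (mix {..<j}) (mix {..<Suc j})"
      unfolding neighbours_def
    proof (intro conjI allI impI)
      show "map_pmf (\<lambda>\<omega>. (mix {..<j} \<omega>, mix {..<Suc j} \<omega>)) PP = map_pmf (\<lambda>\<omega>. (fst \<omega>, mix {j} \<omega>)) PP"
        using map_mix_pair[of "{..<j}" "{j}"] unfolding s .
    qed (auto simp: mix_def)
  qed
  have nB: "mean PP (\<lambda>\<omega>. ?B j \<omega> ^ 4) \<le> K1" for j
    by (rule first_difference[OF _ N]) (auto simp: neighbours_def, auto simp: mix_def)
  have Arb: "\<bar>mean PP (\<lambda>\<omega>. ?A j \<omega> * r j \<omega>)\<bar> \<le> B2 / s\<^sup>2 * (1 + K1)" for j
  proof -
    \<comment> \<open>Young's inequality, used twice, reduces the product of three differences to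
      fourth moments, which are at most \<open>K1\<close>.\<close>
    have pt: "\<bar>?A j \<omega> * r j \<omega>\<bar> \<le> B2 / s\<^sup>2 * (1/2 * (1/2 * (1 + ?A j \<omega> ^ 4) + ?B j \<omega> ^ 4))" for \<omega>
    proof -
      let ?x = "?A j \<omega>" and ?y = "?B j \<omega>"
      have "\<bar>?x * r j \<omega>\<bar> \<le> \<bar>?x\<bar> * (B2 * (?y / s)\<^sup>2)"
        unfolding abs_mult by (intro mult_left_mono rb) auto
      also have "\<dots> = B2 / s\<^sup>2 * (\<bar>?x\<bar> * ?y\<^sup>2)" by (simp add: power_divide)
      also have "\<bar>?x\<bar> * ?y\<^sup>2 \<le> 1/2 * (?x\<^sup>2 + ?y ^ 4)"
        using sum_squares_bound[of "\<bar>?x\<bar>" "?y\<^sup>2"] by (simp flip: power_mult)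
      also have "?x\<^sup>2 \<le> 1/2 * (1 + ?x ^ 4)"
        using sum_squares_bound[of "1" "?x\<^sup>2"] by (simp flip: power_mult)
      finally show ?thesis using B2p by (simp add: mult_left_mono divide_right_mono)
    qed
    have I: "integrable (measure_pmf PP) (\<lambda>\<omega>. ?A j \<omega> ^ 4)" "integrable (measure_pmf PP) (\<lambda>\<omega>. ?B j \<omega> ^ 4)"
      using AL[of j] BL[of j] by (simp_all add: L4_def)
    have "\<bar>mean PP (\<lambda>\<omega>. ?A j \<omega> * r j \<omega>)\<bar> \<le> mean PP (\<lambda>\<omega>. \<bar>?A j \<omega> * r j \<omega>\<bar>)" by (rule integral_abs_bound)
    also have "\<dots> \<le> mean PP (\<lambda>\<omega>. B2 / s\<^sup>2 * (1/2 * (1/2 * (1 + ?A j \<omega> ^ 4) + ?B j \<omega> ^ 4)))"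
      using I by (intro integral_mono pt integrable_abs Ar) auto
    also have "\<dots> = B2 / s\<^sup>2 * (1/2 * (1/2 * (1 + mean PP (\<lambda>\<omega>. ?A j \<omega> ^ 4)) + mean PP (\<lambda>\<omega>. ?B j \<omega> ^ 4)))"
      using I by simp
    also have "\<dots> \<le> B2 / s\<^sup>2 * (1 + K1)"
    proof -
      have "1/2 * (1/2 * (1 + x) + y) \<le> 1 + K1" if "x \<le> K1" "y \<le> K1" for x y :: real
      proof -
        have "1/2 * (1/2 * (1 + x) + y) = 1/4 + x/4 + y/2" by (simp add: field_simps)
        then show ?thesis using that K1 by linarith
      qed
      from this[OF nA[of j] nB[of j]] show ?thesis using B2p by (intro mult_left_mono) auto
    qed
    finally show ?thesis .
  qed
  have "mean Q (\<lambda>x. f x * ?k x) = 1/2 * (\<Sum>j<N. mean PP (\<lambda>\<omega>. ?A j \<omega> * (?k (fst \<omega>) - ?k (mix {j} \<omega>))))"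
    using interpolation[of N d D f ?k] L4_integrable_sq[OF f_L4] L4_integrable_sq[OF kL] mean
    by (simp add: PP_def Q_def)
  also have "\<dots> = 1/2 * (\<Sum>j<N. 1/s * mean PP (\<lambda>\<omega>. ?G \<omega> * ?A j \<omega> * ?B j \<omega>) + mean PP (\<lambda>\<omega>. ?A j \<omega> * r j \<omega>))"
    unfolding Ar_eq using Ak GAB by simp
  also have "\<dots> = 1/s * (1/2 * (\<Sum>j<N. mean PP (\<lambda>\<omega>. ?G \<omega> * ?A j \<omega> * ?B j \<omega>))) + 1/2 * (\<Sum>j<N. mean PP (\<lambda>\<omega>. ?A j \<omega> * r j \<omega>))"
    by (simp add: sum.distrib distrib_left sum_divide_distrib mult.commute)
  also have "1/2 * (\<Sum>j<N. mean PP (\<lambda>\<omega>. ?G \<omega> * ?A j \<omega> * ?B j \<omega>)) = mean PP (\<lambda>\<omega>. ?G \<omega> * T \<omega>)"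
  proof -
    have "?G \<omega> * T \<omega> = 1/2 * (\<Sum>j<N. ?G \<omega> * ?A j \<omega> * ?B j \<omega>)" for \<omega>
      by (simp add: T_def sum_distrib_left mult_ac)
    note eq = this
    show ?thesis unfolding eq using GAB by simp
  qed
  finally have main: "mean Q (\<lambda>x. f x * ?k x) = 1/s * mean PP (\<lambda>\<omega>. ?G \<omega> * T \<omega>) + 1/2 * (\<Sum>j<N. mean PP (\<lambda>\<omega>. ?A j \<omega> * r j \<omega>))" .
  have Gsq: "integrable (measure_pmf PP) (\<lambda>\<omega>. (?G \<omega>)\<^sup>2)" by (rule L4_integrable_sq[OF GL])
  have GT: "integrable (measure_pmf PP) (\<lambda>\<omega>. ?G \<omega> * T \<omega>)"
    by (rule L2_integrable_mult[OF Gsq T_sq_integrable])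
  have Tint: "integrable (measure_pmf PP) T" by (rule L2_integrable[OF T_sq_integrable])
  have dsq: "integrable (measure_pmf PP) (\<lambda>\<omega>. (s\<^sup>2 - T \<omega>)\<^sup>2)"
    by (intro L2_diff T_sq_integrable) simp
  have "\<bar>mean PP (\<lambda>\<omega>. ?G \<omega> * (s\<^sup>2 - T \<omega>))\<bar> \<le> mean PP (\<lambda>\<omega>. \<bar>?G \<omega> * (s\<^sup>2 - T \<omega>)\<bar>)"
    by (rule integral_abs_bound)
  also have "\<dots> \<le> mean PP (\<lambda>\<omega>. B1 * \<bar>s\<^sup>2 - T \<omega>\<bar>)"
    using L2_integrable_mult[OF Gsq dsq] L2_integrable[OF dsq]
    by (intro integral_mono integrable_abs integrable_mult_right) (auto simp: abs_mult intro!: mult_right_mono B1)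
  also have "\<dots> = B1 * mean PP (\<lambda>\<omega>. \<bar>s\<^sup>2 - T \<omega>\<bar>)" by simp
  \<comment> \<open>Since \<open>T\<close> has mean \<open>s\<^sup>2\<close>, the L^1 distance is at
    most the standard deviation of \<open>T\<close>.\<close>
  also have "mean PP (\<lambda>\<omega>. \<bar>s\<^sup>2 - T \<omega>\<bar>) \<le> sqrt (17 * K1 * N / (1 - \<theta>)\<^sup>2)"
  proof (rule real_le_rsqrt)
    have "(mean PP (\<lambda>\<omega>. \<bar>s\<^sup>2 - T \<omega>\<bar>))\<^sup>2 \<le> mean PP (\<lambda>\<omega>. (s\<^sup>2 - T \<omega>)\<^sup>2)"
      using expectation_sq_le[of PP "\<lambda>\<omega>. \<bar>s\<^sup>2 - T \<omega>\<bar>"] dsq by simp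
    also have "\<dots> = mean PP (\<lambda>\<omega>. (T \<omega>)\<^sup>2) - (mean PP T)\<^sup>2"
      using T_sq_integrable Tint ET by (simp add: power2_diff)
    also have "\<dots> \<le> 17 * K1 * N / (1 - \<theta>)\<^sup>2" by (rule T_variance[OF N])
    finally show "(mean PP (\<lambda>\<omega>. \<bar>s\<^sup>2 - T \<omega>\<bar>))\<^sup>2 \<le> 17 * K1 * N / (1 - \<theta>)\<^sup>2" .
  qed
  finally have e1: "\<bar>mean PP (\<lambda>\<omega>. ?G \<omega> * (s\<^sup>2 - T \<omega>))\<bar> \<le> B1 * sqrt (17 * K1 * N / (1 - \<theta>)\<^sup>2)"
    using B1p by (simp add: mult_left_mono)
  have "\<bar>(\<Sum>j<N. mean PP (\<lambda>\<omega>. ?A j \<omega> * r j \<omega>))\<bar> \<le> (\<Sum>j<N. B2 / s\<^sup>2 * (1 + K1))"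
    by (rule order_trans[OF sum_abs sum_mono]) (rule Arb)
  then have e2: "\<bar>(\<Sum>j<N. mean PP (\<lambda>\<omega>. ?A j \<omega> * r j \<omega>))\<bar> \<le> N * (B2 / s\<^sup>2 * (1 + K1))" by simp
  let ?E = "\<Sum>j<N. mean PP (\<lambda>\<omega>. ?A j \<omega> * r j \<omega>)"
  have num: "\<bar>u\<bar> \<le> B1 * sqrt (17 * K1 * N / (1 - \<theta>)\<^sup>2) / s\<^sup>2 + B2 * N * (1 + K1) / (2 * s ^ 3)"
    if u: "u = 1/s\<^sup>2 * x - 1/(2 * s) * y" and x: "\<bar>x\<bar> \<le> B1 * sqrt (17 * K1 * N / (1 - \<theta>)\<^sup>2)"
      and y: "\<bar>y\<bar> \<le> N * (B2 / s\<^sup>2 * (1 + K1))" for u x y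
  proof -
    have "\<bar>u\<bar> \<le> 1/s\<^sup>2 * \<bar>x\<bar> + 1/(2 * s) * \<bar>y\<bar>"
      unfolding u using abs_triangle_ineq4[of "1/s\<^sup>2 * x" "1/(2 * s) * y"] s by (simp add: abs_mult)
    also have "\<dots> \<le> 1/s\<^sup>2 * (B1 * sqrt (17 * K1 * N / (1 - \<theta>)\<^sup>2)) + 1/(2 * s) * (N * (B2 / s\<^sup>2 * (1 + K1)))"
      using s by (intro add_mono mult_left_mono x y) auto
    also have "\<dots> = B1 * sqrt (17 * K1 * N / (1 - \<theta>)\<^sup>2) / s\<^sup>2 + B2 * N * (1 + K1) / (2 * s ^ 3)"
      by (simp add: power2_eq_square power3_eq_cube mult_ac)
    finally show ?thesis .
  qed
  show ?thesis
  proof (rule num[OF _ e1 e2])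
    have fk: "mean Q (\<lambda>x. f x / s * g (f x / s)) = 1/s * mean Q (\<lambda>x. f x * ?k x)" by simp
    have G: "mean PP ?G = mean Q (\<lambda>x. g' (f x / s))" by (rule EQ)
    have GT': "mean PP (\<lambda>\<omega>. ?G \<omega> * (s\<^sup>2 - T \<omega>)) = s\<^sup>2 * mean PP ?G - mean PP (\<lambda>\<omega>. ?G \<omega> * T \<omega>)"
      using GT L4_integrable[OF GL] by (simp add: right_diff_distrib)
    have alg: "a - 1/s * (1/s * b + 1/2 * e) = 1/s\<^sup>2 * (s\<^sup>2 * a - b) - 1/(2 * s) * e" for a b e :: real
      using s by (simp add: field_simps power2_eq_square)
    show "mean Q (\<lambda>x. g' (f x / s)) - mean Q (\<lambda>x. f x / s * g (f x / s))
      = 1/s\<^sup>2 * mean PP (\<lambda>\<omega>. ?G \<omega> * (s\<^sup>2 - T \<omega>)) - 1/(2 * s) * ?E"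
      unfolding GT' G[symmetric] fk main by (rule alg)
  qed
qed

end

subsection \<open>Poisson laws and Charlier polynomials\<close>

text \<open>A class closed under sums, products and shifts that contains the polynomials and the
  powers in generating functions. All its members are integrable for every Poisson law, which
  settles integrability once and for all.\<close>

definition exp_growth :: "(nat \<Rightarrow> real) \<Rightarrow> bool" where
  "exp_growth f \<longleftrightarrow> (\<exists>C R. 0 \<le> C \<and> 1 \<le> R \<and> (\<forall>k. \<bar>f k\<bar> \<le> C * R ^ k))"

lemma exp_growthI: "0 \<le> C \<Longrightarrow> 1 \<le> R \<Longrightarrow> (\<And>k. \<bar>f k\<bar> \<le> C * R ^ k) \<Longrightarrow> exp_growth f"
  unfolding exp_growth_def by blast

lemma exp_growth_const: "exp_growth (\<lambda>k. c)"
  by (rule exp_growthI[of "\<bar>c\<bar>" 1]) auto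

lemma exp_growth_power: "exp_growth (\<lambda>k. c ^ k)"
  by (rule exp_growthI[of 1 "max 1 \<bar>c\<bar>"]) (auto simp: power_abs intro: power_mono)

lemma exp_growth_real: "exp_growth real"
proof (rule exp_growthI[of 1 2])
  show "\<bar>real k\<bar> \<le> 1 * 2 ^ k" for k
  proof -
    have "real k \<le> real (2 ^ k)" using less_exp[of k] by (intro of_nat_mono) simp
    then show ?thesis by simp
  qed
qed auto

lemma exp_growth_add: assumes "exp_growth f" "exp_growth g" shows "exp_growth (\<lambda>k. f k + g k)"
proof -
  from assms obtain C R C' R' where *: "0 \<le> C" "1 \<le> R" "\<And>k. \<bar>f k\<bar> \<le> C * R ^ k"
    "0 \<le> C'" "1 \<le> R'" "\<And>k. \<bar>g k\<bar> \<le> C' * R' ^ k" unfolding exp_growth_def by blast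
  show ?thesis
  proof (rule exp_growthI[of "C + C'" "max R R'"])
    fix k
    have "\<bar>f k + g k\<bar> \<le> C * R ^ k + C' * R' ^ k" using *(3)[of k] *(6)[of k] by linarith
    also have "\<dots> \<le> C * max R R' ^ k + C' * max R R' ^ k"
      using * by (intro add_mono mult_left_mono power_mono) auto
    finally show "\<bar>f k + g k\<bar> \<le> (C + C') * max R R' ^ k" by (simp add: distrib_right)
  qed (use * in auto)
qed

lemma exp_growth_mult: assumes "exp_growth f" "exp_growth g" shows "exp_growth (\<lambda>k. f k * g k)"
proof -
  from assms obtain C R C' R' where *: "0 \<le> C" "1 \<le> R" "\<And>k. \<bar>f k\<bar> \<le> C * R ^ k"
    "0 \<le> C'" "1 \<le> R'" "\<And>k. \<bar>g k\<bar> \<le> C' * R' ^ k" unfolding exp_growth_def by blast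
  show ?thesis
  proof (rule exp_growthI[of "C * C'" "R * R'"])
    fix k
    have "\<bar>f k * g k\<bar> \<le> (C * R ^ k) * (C' * R' ^ k)"
      unfolding abs_mult using * by (intro mult_mono) auto
    then show "\<bar>f k * g k\<bar> \<le> (C * C') * (R * R') ^ k" by (simp add: power_mult_distrib mult_ac)
  next
    show "1 \<le> R * R'" using mult_mono[of 1 R 1 R'] * by simp
  qed (use * in auto)
qed

lemma exp_growth_cmult: "exp_growth f \<Longrightarrow> exp_growth (\<lambda>k. c * f k)"
  by (intro exp_growth_mult exp_growth_const)

lemma exp_growth_sum: "(\<And>i. i \<in> I \<Longrightarrow> exp_growth (f i)) \<Longrightarrow> exp_growth (\<lambda>k. \<Sum>i\<in>I. f i k)"
  by (induction I rule: infinite_finite_induct) (auto intro: exp_growth_add exp_growth_const)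

lemma exp_growth_pow: "exp_growth f \<Longrightarrow> exp_growth (\<lambda>k. f k ^ n)"
  by (induction n) (auto intro: exp_growth_mult exp_growth_const)

lemma exp_growth_shift: assumes "exp_growth f" shows "exp_growth (\<lambda>k. f (k + m))"
proof -
  from assms obtain C R where *: "0 \<le> C" "1 \<le> R" "\<And>k. \<bar>f k\<bar> \<le> C * R ^ k"
    unfolding exp_growth_def by blast
  show ?thesis
  proof (rule exp_growthI[of "C * R ^ m" R])
    show "\<bar>f (k + m)\<bar> \<le> C * R ^ m * R ^ k" for k
      using *(3)[of "k + m"] by (simp add: power_add mult_ac)
  qed (use * in auto)
qed

text \<open>The constant \<open>poisson_pmf\<close> is unspecified at rate 0, which is needed for vanishing overlap.\<close>
definition poi :: "real \<Rightarrow> nat pmf" where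
  "poi \<mu> = (if \<mu> > 0 then poisson_pmf \<mu> else return_pmf 0)"

lemma pmf_poi: "\<mu> \<ge> 0 \<Longrightarrow> pmf (poi \<mu>) k = \<mu> ^ k / fact k * exp (- \<mu>)"
  by (cases "\<mu> = 0") (auto simp: poi_def indicator_def)

lemma summable_poi:
  assumes "exp_growth f" "\<mu> \<ge> 0" shows "summable (\<lambda>k. norm (pmf (poi \<mu>) k * f k))"
proof -
  from assms(1) obtain C R where *: "0 \<le> C" "1 \<le> R" "\<And>k. \<bar>f k\<bar> \<le> C * R ^ k"
    unfolding exp_growth_def by blast
  have "summable (\<lambda>k. C * exp (- \<mu>) * (inverse (fact k) * (\<mu> * R) ^ k))"
    by (intro summable_mult summable_exp)
  then show ?thesis
  proof (rule summable_comparison_test'[where N=0])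
    fix k
    have "\<bar>pmf (poi \<mu>) k * f k\<bar> \<le> (\<mu> ^ k / fact k * exp (- \<mu>)) * (C * R ^ k)"
      unfolding abs_mult using * assms(2) by (intro mult_mono) (auto simp: pmf_poi)
    then show "norm (norm (pmf (poi \<mu>) k * f k)) \<le> C * exp (- \<mu>) * (inverse (fact k) * (\<mu> * R) ^ k)"
      by (simp add: field_simps power_mult_distrib)
  qed
qed

lemma integrable_poi: assumes "exp_growth f" "\<mu> \<ge> 0" shows "integrable (measure_pmf (poi \<mu>)) f"
proof -
  have "integrable (count_space UNIV) (\<lambda>k. pmf (poi \<mu>) k *\<^sub>R f k)"
    using summable_poi[OF assms] by (simp add: integrable_count_space_nat_iff)
  then show ?thesis unfolding measure_pmf_eq_density by (subst integrable_density) auto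
qed

lemma expectation_poi: assumes "exp_growth f" "\<mu> \<ge> 0" shows "mean (poi \<mu>) f = (\<Sum>k. pmf (poi \<mu>) k * f k)"
proof -
  have "mean (poi \<mu>) f = (LINT k|count_space UNIV. pmf (poi \<mu>) k *\<^sub>R f k)"
    unfolding measure_pmf_eq_density by (subst integral_density) auto
  also have "\<dots> = (\<Sum>k. pmf (poi \<mu>) k * f k)"
    using summable_poi[OF assms] by (subst integral_count_space_nat) (auto simp: integrable_count_space_nat_iff)
  finally show ?thesis .
qed

text \<open>The Stein-Chen identity: shift the index in the Poisson series and use that (k + 1)
  times the weight of k + 1 is \<mu> times the weight of k.\<close>

lemma poi_stein: assumes f: "exp_growth f" and \<mu>: "\<mu> \<ge> 0"
  shows "mean (poi \<mu>) (\<lambda>k. real k * f k) = \<mu> * mean (poi \<mu>) (\<lambda>k. f (Suc k))"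
proof -
  have g: "exp_growth (\<lambda>k. real k * f k)" by (intro exp_growth_mult exp_growth_real f)
  have s: "exp_growth (\<lambda>k. f (Suc k))" using exp_growth_shift[OF f, of 1] by simp
  have "mean (poi \<mu>) (\<lambda>k. real k * f k) = (\<Sum>k. pmf (poi \<mu>) (Suc k) * (real (Suc k) * f (Suc k)))"
    using suminf_split_head[OF summable_norm_cancel[OF summable_poi[OF g \<mu>]]]
    by (simp add: expectation_poi[OF g \<mu>])
  also have "\<dots> = (\<Sum>k. \<mu> * (pmf (poi \<mu>) k * f (Suc k)))"
    using \<mu> by (intro suminf_cong) (simp add: pmf_poi divide_simps del: of_nat_Suc)
  also have "\<dots> = \<mu> * mean (poi \<mu>) (\<lambda>k. f (Suc k))"
    by (subst suminf_mult) (auto simp: expectation_poi[OF s \<mu>] summable_norm_cancel[OF summable_poi[OF s \<mu>]])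
  finally show ?thesis .
qed

lemma poi_pgf: assumes "\<mu> \<ge> 0" shows "mean (poi \<mu>) (\<lambda>k. u ^ k) = exp (\<mu> * (u - 1))"
proof -
  have "(\<lambda>k. exp (- \<mu>) * ((\<mu> * u) ^ k /\<^sub>R fact k)) sums (exp (- \<mu>) * exp (\<mu> * u))"
    by (intro sums_mult exp_converges)
  then have "(\<lambda>k. pmf (poi \<mu>) k * u ^ k) sums exp (\<mu> * (u - 1))"
    by (simp add: pmf_poi assms field_simps power_mult_distrib exp_minus exp_diff)
  then show ?thesis by (simp add: expectation_poi[OF exp_growth_power assms] sums_iff)
qed

text \<open>The raising relation and the difference rule hidden in the three-term recursion. Each
  needs both of them one degree lower, so they are proved in one induction.\<close>

lemma charlier_lowering:
  "charlier lam (Suc q) x = x * charlier lam q (x - 1) - lam * charlier lam q x \<and>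
   charlier lam (Suc q) x - charlier lam (Suc q) (x - 1) = real (Suc q) * charlier lam q (x - 1)"
proof (induction q arbitrary: x)
  case (Suc q)
  let ?C = "charlier lam" and ?r = "real (Suc q)"
  have P: "?C (Suc q) x = x * ?C q (x - 1) - lam * ?C q x"
    and D: "?C (Suc q) x - ?C (Suc q) (x - 1) = ?r * ?C q (x - 1)" using Suc[of x] by auto
  have T: "?C (Suc (Suc q)) y = (y - lam) * ?C (Suc q) y - ?r * ?C (Suc q) y - ?r * lam * ?C q y" for y
    by simp
  have "x * ?C (Suc q) (x - 1) - lam * ?C (Suc q) x
      = x * (?C (Suc q) x - ?r * ?C q (x - 1)) - lam * ?C (Suc q) x" using D by (simp add: algebra_simps)
  also have "\<dots> = (x - lam) * ?C (Suc q) x - ?r * (x * ?C q (x - 1))" by (simp add: algebra_simps)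
  also have "x * ?C q (x - 1) = ?C (Suc q) x + lam * ?C q x" using P by simp
  finally have P': "?C (Suc (Suc q)) x = x * ?C (Suc q) (x - 1) - lam * ?C (Suc q) x"
    unfolding T by (simp add: algebra_simps)
  have "?C (Suc (Suc q)) x - ?C (Suc (Suc q)) (x - 1)
     = (?r + 1) * ?C (Suc q) (x - 1) - lam * ((?C (Suc q) x - ?C (Suc q) (x - 1)) - ?r * ?C q (x - 1))"
    unfolding P' T[of "x - 1"] by (simp add: algebra_simps)
  also have "\<dots> = (?r + 1) * ?C (Suc q) (x - 1)" unfolding D by simp
  finally show ?case using P' by (simp add: algebra_simps)
qed auto

lemma charlier_Suc: "charlier lam (Suc q) x = x * charlier lam q (x - 1) - lam * charlier lam q x"
  using charlier_lowering by blast

lemma charlier_difference: "charlier lam (Suc q) (x + 1) - charlier lam (Suc q) x = real (Suc q) * charlier lam q x"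
  using charlier_lowering[of lam q "x + 1"] by simp

lemma charlier_poly: "\<exists>p. (\<forall>x. charlier lam q x = poly p x) \<and> degree p \<le> q \<and> coeff p q = 1"
proof (induction lam q "0::real" rule: charlier.induct)
  case (1 lam)
  then show ?case by (intro exI[of _ 1]) auto
next
  case (2 lam)
  then show ?case by (intro exI[of _ "[:- lam, 1:]"]) auto
next
  case (3 lam r)
  then obtain p p' where p: "\<forall>x. charlier lam (Suc r) x = poly p x" "degree p \<le> Suc r" "coeff p (Suc r) = 1"
    and p': "\<forall>x. charlier lam r x = poly p' x" "degree p' \<le> r" "coeff p' r = 1" by blast
  let ?p = "[:- lam - real (Suc r), 1:] * p - smult (real (Suc r) * lam) p'"
  have "degree ([:- lam - real (Suc r), 1:] * p) \<le> Suc (Suc r)"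
    by (rule order_trans[OF degree_mult_le]) (use p in auto)
  then have "degree ?p \<le> Suc (Suc r)" using p' by (intro degree_diff_le) (auto intro: order_trans[OF degree_smult_le])
  moreover have "coeff ?p (Suc (Suc r)) = 1" using p p' by (simp add: coeff_eq_0)
  moreover have "charlier lam (Suc (Suc r)) x = poly ?p x" for x using p p' by (simp add: algebra_simps)
  ultimately show ?case by blast
qed

text \<open>As the polynomials are monic, subtracting a multiple of the top one removes the leading
  monomial. The top coefficient is kept, which later guarantees that the limiting variance is
  positive.\<close>

lemma charlier_expansion:
  "\<exists>b. (\<forall>x. (\<Sum>j\<le>k. \<beta> j * x ^ j) = (\<Sum>q\<le>k. b q * charlier lam q x)) \<and> b k = \<beta> k"
proof (induction k arbitrary: \<beta>)
  case 0
  show ?case by (intro exI[of _ \<beta>]) simp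
next
  case (Suc k)
  obtain p where p: "\<forall>x. charlier lam (Suc k) x = poly p x" "degree p \<le> Suc k" "coeff p (Suc k) = 1"
    using charlier_poly by blast
  have C: "charlier lam (Suc k) x = (\<Sum>j\<le>k. coeff p j * x ^ j) + x ^ Suc k" for x
  proof -
    have "poly p x = (\<Sum>j\<le>Suc k. coeff p j * x ^ j)"
      using p(2) unfolding poly_altdef by (intro sum.mono_neutral_left) (auto simp: coeff_eq_0)
    then show ?thesis using p by simp
  qed
  obtain b where b: "\<forall>x. (\<Sum>j\<le>k. (\<beta> j - \<beta> (Suc k) * coeff p j) * x ^ j) = (\<Sum>q\<le>k. b q * charlier lam q x)"
    using Suc[of "\<lambda>j. \<beta> j - \<beta> (Suc k) * coeff p j"] by blast
  show ?case
  proof (intro exI[of _ "b(Suc k := \<beta> (Suc k))"] conjI allI)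
    fix x
    have "(\<Sum>q\<le>Suc k. (b(Suc k := \<beta> (Suc k))) q * charlier lam q x)
      = (\<Sum>q\<le>k. b q * charlier lam q x) + \<beta> (Suc k) * charlier lam (Suc k) x" by simp
    also have "\<dots> = (\<Sum>j\<le>Suc k. \<beta> j * x ^ j)"
      unfolding b[rule_format, symmetric] C
      by (simp add: left_diff_distrib sum_subtractf distrib_left sum_distrib_left mult.assoc)
    finally show "(\<Sum>j\<le>Suc k. \<beta> j * x ^ j) = (\<Sum>q\<le>Suc k. (b(Suc k := \<beta> (Suc k))) q * charlier lam q x)" ..
  qed simp
qed

lemma exp_growth_poly: "exp_growth (\<lambda>k. poly p (real k + c))"
  unfolding poly_altdef
  by (intro exp_growth_sum exp_growth_cmult exp_growth_pow exp_growth_add exp_growth_real exp_growth_const)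

lemma exp_growth_charlier: "exp_growth (\<lambda>k. charlier lam q (real k + c))"
  using charlier_poly[of lam q] exp_growth_poly by fastforce

text \<open>Averaging out an independent Poisson summand of mean \<alpha> lowers the parameter by
  \<alpha> and keeps the degree. This is what makes two-point covariances diagonal.\<close>

lemma charlier_appell: assumes "\<alpha> \<ge> 0"
  shows "mean (poi \<alpha>) (\<lambda>k. charlier lam q (real k + b)) = charlier (lam - \<alpha>) q b"
proof (induction q arbitrary: b)
  case 0
  then show ?case by simp
next
  case (Suc q)
  note eg = exp_growth_charlier
  have I: "integrable (measure_pmf (poi \<alpha>)) (\<lambda>k. charlier lam q (real k + c))" for c
    by (intro integrable_poi eg assms)
  have Ik: "integrable (measure_pmf (poi \<alpha>)) (\<lambda>k. real k * charlier lam q (real k + c))" for c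
    by (intro integrable_poi exp_growth_mult exp_growth_real eg assms)
  have "mean (poi \<alpha>) (\<lambda>k. charlier lam (Suc q) (real k + b)) =
    mean (poi \<alpha>) (\<lambda>k. real k * charlier lam q (real k + (b - 1)) + b * charlier lam q (real k + (b - 1)) - lam * charlier lam q (real k + b))"
    unfolding charlier_Suc by (simp add: algebra_simps)
  also have "\<dots> = mean (poi \<alpha>) (\<lambda>k. real k * charlier lam q (real k + (b - 1))) + b * charlier (lam - \<alpha>) q (b - 1) - lam * charlier (lam - \<alpha>) q b"
    using I Ik by (simp add: Suc)
  also have "mean (poi \<alpha>) (\<lambda>k. real k * charlier lam q (real k + (b - 1))) = \<alpha> * charlier (lam - \<alpha>) q b"
    by (subst poi_stein[OF eg assms]) (simp flip: Suc add: algebra_simps)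
  finally show ?case unfolding charlier_Suc by (simp add: algebra_simps)
qed

text \<open>Poisson integration by parts: passing to the next Charlier polynomial is, up to the
  factor \<mu>, adjoint to the forward difference. Applied to a Charlier polynomial it lowers both
  degrees by one, which proves orthogonality.\<close>

lemma charlier_parts: assumes \<mu>: "\<mu> \<ge> 0" and g: "exp_growth g"
  shows "mean (poi \<mu>) (\<lambda>k. charlier \<mu> (Suc q) (real k) * g k) = \<mu> * mean (poi \<mu>) (\<lambda>k. charlier \<mu> q (real k) * (g (Suc k) - g k))"
proof -
  have e: "exp_growth (\<lambda>k. charlier \<mu> q (real k - 1))" "exp_growth (\<lambda>k. charlier \<mu> q (real k))"
    using exp_growth_charlier[of \<mu> q "-1"] exp_growth_charlier[of \<mu> q 0] by simp_all
  have gs: "exp_growth (\<lambda>k. g (Suc k))" using exp_growth_shift[OF g, of 1] by simp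
  have I: "integrable (measure_pmf (poi \<mu>)) (\<lambda>k. real k * (charlier \<mu> q (real k - 1) * g k))"
    "integrable (measure_pmf (poi \<mu>)) (\<lambda>k. charlier \<mu> q (real k) * g k)"
    "integrable (measure_pmf (poi \<mu>)) (\<lambda>k. charlier \<mu> q (real k) * g (Suc k))"
    by (intro integrable_poi exp_growth_mult exp_growth_real e g gs \<mu>)+
  have "mean (poi \<mu>) (\<lambda>k. charlier \<mu> (Suc q) (real k) * g k)
     = mean (poi \<mu>) (\<lambda>k. real k * (charlier \<mu> q (real k - 1) * g k)) - \<mu> * mean (poi \<mu>) (\<lambda>k. charlier \<mu> q (real k) * g k)"
    unfolding charlier_Suc using I by (simp add: left_diff_distrib mult.assoc)
  also have "mean (poi \<mu>) (\<lambda>k. real k * (charlier \<mu> q (real k - 1) * g k)) = \<mu> * mean (poi \<mu>) (\<lambda>k. charlier \<mu> q (real k) * g (Suc k))"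
    by (subst poi_stein[OF exp_growth_mult[OF e(1) g] \<mu>]) simp
  finally show ?thesis using I by (simp add: right_diff_distrib)
qed

lemma charlier_orthogonal: assumes \<mu>: "\<mu> \<ge> 0"
  shows "mean (poi \<mu>) (\<lambda>k. charlier \<mu> q (real k) * charlier \<mu> r (real k)) = (if q = r then fact q * \<mu> ^ q else 0)"
proof (induction q arbitrary: r)
  case 0
  show ?case
  proof (cases r)
    case (Suc r')
    then show ?thesis using charlier_parts[OF \<mu> exp_growth_const[of 1], of r'] by simp
  qed simp
next
  case (Suc q)
  show ?case
  proof (cases r)
    case 0
    then show ?thesis using charlier_parts[OF \<mu> exp_growth_const[of 1], of q] by simp
  next
    case (Suc r')
    have "mean (poi \<mu>) (\<lambda>k. charlier \<mu> (Suc q) (real k) * charlier \<mu> r (real k))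
      = \<mu> * mean (poi \<mu>) (\<lambda>k. charlier \<mu> q (real k) * (charlier \<mu> (Suc r') (real k + 1) - charlier \<mu> (Suc r') (real k)))"
      using charlier_parts[OF \<mu>, of "\<lambda>k. charlier \<mu> r (real k)" q] exp_growth_charlier[of \<mu> r 0] Suc by (simp add: add.commute)
    also have "\<dots> = \<mu> * (real (Suc r') * mean (poi \<mu>) (\<lambda>k. charlier \<mu> q (real k) * charlier \<mu> r' (real k)))"
      unfolding charlier_difference by (simp add: mult.left_commute del: of_nat_Suc)
    finally show ?thesis using Suc.IH[of r'] \<open>r = Suc r'\<close> by auto
  qed
qed

text \<open>The joint law of the occupation numbers at two space-time points with overlap \<open>\<rho>\<close>.\<close>
definition two_point :: "real \<Rightarrow> real \<Rightarrow> (nat \<times> nat) pmf" where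
  "two_point lam \<rho> = map_pmf (\<lambda>z. (fst (snd z) + fst z, fst z + snd (snd z)))
     (pair_pmf (poi (lam * \<rho>)) (pair_pmf (poi (lam * (1 - \<rho>))) (poi (lam * (1 - \<rho>)))))"

lemma integrable_triple:
  assumes "exp_growth f" "exp_growth g" "exp_growth h" "a \<ge> 0" "b \<ge> 0" "c \<ge> 0"
  shows "integrable (measure_pmf (pair_pmf (poi a) (pair_pmf (poi b) (poi c)))) (\<lambda>z. f (fst z) * (g (fst (snd z)) * h (snd (snd z))))"
  using expectation_pair_mult(2)[OF integrable_poi[of f a] expectation_pair_mult(2)[OF integrable_poi[of g b] integrable_poi[of h c]]] assms
  by simp

lemma integrable_two_point:
  assumes fg: "exp_growth f" "exp_growth g" and \<rho>: "0 \<le> \<rho>" "\<rho> \<le> 1" "lam \<ge> 0"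
  shows "integrable (measure_pmf (pair_pmf (poi (lam * \<rho>)) (pair_pmf (poi (lam * (1 - \<rho>))) (poi (lam * (1 - \<rho>))))))
    (\<lambda>z. f (fst (snd z) + fst z) * g (fst z + snd (snd z)))"
proof -
  from fg obtain C R C' R' where *: "0 \<le> C" "1 \<le> R" "\<And>k. \<bar>f k\<bar> \<le> C * R ^ k"
    "0 \<le> C'" "1 \<le> R'" "\<And>k. \<bar>g k\<bar> \<le> C' * R' ^ k" unfolding exp_growth_def by blast
  show ?thesis
  proof (rule Bochner_Integration.integrable_bound)
    show "integrable (measure_pmf (pair_pmf (poi (lam * \<rho>)) (pair_pmf (poi (lam * (1 - \<rho>))) (poi (lam * (1 - \<rho>))))))
      (\<lambda>z. (C * C' * (R * R') ^ fst z) * (R ^ fst (snd z) * R' ^ snd (snd z)))"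
      using \<rho> by (intro integrable_triple exp_growth_cmult exp_growth_power) auto
    have "\<bar>f (a + b) * g (b + c)\<bar> \<le> \<bar>(C * C' * (R * R') ^ b) * (R ^ a * R' ^ c)\<bar>" for a b c
    proof -
      have "\<bar>f (a + b) * g (b + c)\<bar> \<le> (C * R ^ (a + b)) * (C' * R' ^ (b + c))"
        unfolding abs_mult using * by (intro mult_mono) auto
      also have "\<dots> = (C * C' * (R * R') ^ b) * (R ^ a * R' ^ c)" by (simp add: power_add power_mult_distrib mult_ac)
      finally show ?thesis by simp
    qed
    then show "AE z in measure_pmf (pair_pmf (poi (lam * \<rho>)) (pair_pmf (poi (lam * (1 - \<rho>))) (poi (lam * (1 - \<rho>))))).
      norm (f (fst (snd z) + fst z) * g (fst z + snd (snd z))) \<le> norm ((C * C' * (R * R') ^ fst z) * (R ^ fst (snd z) * R' ^ snd (snd z)))"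
      by (intro AE_pmfI) auto
  qed auto
qed

lemma expectation_two_point:
  assumes fg: "exp_growth f" "exp_growth g" and \<rho>: "0 \<le> \<rho>" "\<rho> \<le> 1" "lam \<ge> 0"
  shows "mean (two_point lam \<rho>) (\<lambda>z. f (fst z) * g (snd z)) =
    mean (poi (lam * \<rho>)) (\<lambda>b. mean (poi (lam * (1 - \<rho>))) (\<lambda>a. f (a + b)) * mean (poi (lam * (1 - \<rho>))) (\<lambda>c. g (b + c)))"
    and "integrable (measure_pmf (two_point lam \<rho>)) (\<lambda>z. f (fst z) * g (snd z))"
proof -
  let ?p = "poi (lam * \<rho>)" and ?q = "poi (lam * (1 - \<rho>))"
  note I = integrable_two_point[OF fg \<rho>]
  show "integrable (measure_pmf (two_point lam \<rho>)) (\<lambda>z. f (fst z) * g (snd z))"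
    using I by (simp add: two_point_def)
  have "mean (two_point lam \<rho>) (\<lambda>z. f (fst z) * g (snd z)) = mean (pair_pmf ?p (pair_pmf ?q ?q)) (\<lambda>z. f (fst (snd z) + fst z) * g (fst z + snd (snd z)))"
    by (simp add: two_point_def)
  also have "\<dots> = mean ?p (\<lambda>b. mean (pair_pmf ?q ?q) (\<lambda>z. f (fst z + b) * g (b + snd z)))"
    by (subst expectation_pair_pmf_iterated[OF I]) simp
  also have "\<dots> = mean ?p (\<lambda>b. mean ?q (\<lambda>a. f (a + b)) * mean ?q (\<lambda>c. g (b + c)))"
  proof (intro Bochner_Integration.integral_cong refl)
    fix b
    have i: "integrable (measure_pmf ?q) (\<lambda>a. f (a + b))" "integrable (measure_pmf ?q) (\<lambda>c. g (b + c))"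
      using exp_growth_shift[OF fg(1), of b] exp_growth_shift[OF fg(2), of b] \<rho>
      by (auto intro!: integrable_poi simp: add.commute)
    show "mean (pair_pmf ?q ?q) (\<lambda>z. f (fst z + b) * g (b + snd z)) = mean ?q (\<lambda>a. f (a + b)) * mean ?q (\<lambda>c. g (b + c))"
      using expectation_pair_pmf_iterated[OF expectation_pair_mult(2)[OF i]] by simp
  qed
  finally show "mean (two_point lam \<rho>) (\<lambda>z. f (fst z) * g (snd z)) =
    mean ?p (\<lambda>b. mean ?q (\<lambda>a. f (a + b)) * mean ?q (\<lambda>c. g (b + c)))" .
qed

text \<open>Given the common part, the two private parts are independent. Averaging them out turns
  both factors into Charlier polynomials of rate \<open>lam * \<rho>\<close> in the common part, and
  these are orthogonal for its law.\<close>

lemma two_point_charlier: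
  assumes \<rho>: "0 \<le> \<rho>" "\<rho> \<le> 1" "lam \<ge> 0"
  shows "mean (two_point lam \<rho>) (\<lambda>z. charlier lam q (real (fst z)) * charlier lam r (real (snd z)))
    = (if q = r then fact q * (lam * \<rho>) ^ q else 0)"
proof -
  have e: "exp_growth (\<lambda>k. charlier lam q (real k))" for q using exp_growth_charlier[of lam q 0] by simp
  have s: "lam - lam * (1 - \<rho>) = lam * \<rho>" by (simp add: algebra_simps)
  have a: "mean (poi (lam * (1 - \<rho>))) (\<lambda>a. charlier lam q (real (a + b))) = charlier (lam * \<rho>) q (real b)" for q b
    using charlier_appell[of "lam * (1 - \<rho>)" lam q "real b"] \<rho> by (simp add: s)
  have a': "mean (poi (lam * (1 - \<rho>))) (\<lambda>c. charlier lam q (real (b + c))) = charlier (lam * \<rho>) q (real b)" for q b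
    using a[of q b] by (simp only: add.commute)
  show ?thesis
    using expectation_two_point(1)[OF e e \<rho>, of q r] charlier_orthogonal[of "lam * \<rho>" q r] \<rho>
    unfolding a a' by simp
qed

lemma two_point_pgf:
  assumes \<rho>: "0 \<le> \<rho>" "\<rho> \<le> 1" "lam \<ge> 0"
  shows "mean (two_point lam \<rho>) (\<lambda>z. u ^ fst z * w ^ snd z) = exp (lam * ((u - 1) + (w - 1) + (u - 1) * (w - 1) * \<rho>))"
proof -
  have "mean (two_point lam \<rho>) (\<lambda>z. u ^ fst z * w ^ snd z) =
    mean (poi (lam * \<rho>)) (\<lambda>b. mean (poi (lam * (1 - \<rho>))) (\<lambda>a. u ^ (a + b)) * mean (poi (lam * (1 - \<rho>))) (\<lambda>c. w ^ (b + c)))"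
    by (rule expectation_two_point(1)[OF exp_growth_power exp_growth_power \<rho>])
  also have "\<dots> = mean (poi (lam * \<rho>)) (\<lambda>b. exp (lam * (1 - \<rho>) * (u - 1)) * exp (lam * (1 - \<rho>) * (w - 1)) * (u * w) ^ b)"
    using \<rho> by (simp add: power_add poi_pgf power_mult_distrib mult_ac)
  also have "\<dots> = exp (lam * (1 - \<rho>) * (u - 1)) * exp (lam * (1 - \<rho>) * (w - 1)) * exp (lam * \<rho> * (u * w - 1))"
    using \<rho> by (simp add: poi_pgf)
  also have "\<dots> = exp (lam * ((u - 1) + (w - 1) + (u - 1) * (w - 1) * \<rho>))"
    unfolding mult_exp_exp by (simp add: algebra_simps)
  finally show ?thesis .
qed

subsection \<open>Uniqueness of generating functions\<close>

text \<open>Once the lower coefficients vanish, the series divided by \<open>t ^ n\<close> is zero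
  on (0, 1) and tends to \<open>a n\<close> at 0. The limit is one-sided since the generating
  functions are compared for arguments in [0, 1] only.\<close>

lemma powser_zero_on_unit_interval:
  fixes a :: "nat \<Rightarrow> real"
  assumes bd: "\<And>n. \<bar>a n\<bar> \<le> B" and zero: "\<And>t. 0 < t \<Longrightarrow> t < 1 \<Longrightarrow> (\<Sum>n. a n * t ^ n) = 0"
  shows "a n = 0"
proof (induction n rule: less_induct)
  case (less n)
  have summ: "summable (\<lambda>i. a (i + m) * t ^ i)" if "\<bar>t\<bar> < 1" for t m
  proof (rule summable_comparison_test'[where N=0])
    show "summable (\<lambda>i. B * \<bar>t\<bar> ^ i)" using that by (intro summable_mult summable_geometric) auto
    show "norm (a (i + m) * t ^ i) \<le> B * \<bar>t\<bar> ^ i" for i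
      using bd[of "i + m"] by (simp add: abs_mult power_abs mult_right_mono)
  qed
  define f where "f t = (\<Sum>i. a (i + n) * t ^ i)" for t
  have "(f \<longlongrightarrow> a (0 + n)) (at 0)"
    using summ[of _ n] unfolding f_def by (intro powser_limit_0[of 1] summable_sums) auto
  then have lim: "(f \<longlongrightarrow> a n) (at_right 0)" by (simp add: filterlim_at_split)
  have "f t = 0" if t: "0 < t" "t < 1" for t
  proof -
    have "(\<Sum>i. a i * t ^ i) = (\<Sum>i. a (i + n) * t ^ (i + n)) + (\<Sum>i<n. a i * t ^ i)"
      using summ[of t 0] t by (intro suminf_split_initial_segment) simp
    then have "0 = (\<Sum>i. t ^ n * (a (i + n) * t ^ i))" using zero[OF t] less by (simp add: power_add mult_ac)
    also have "\<dots> = t ^ n * f t" unfolding f_def using summ[of t n] t by (intro suminf_mult) auto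
    finally show ?thesis using t by simp
  qed
  then have "eventually (\<lambda>t. f t = 0) (at_right 0)"
    unfolding eventually_at_right_field by (intro exI[of _ 1]) auto
  then have "(f \<longlongrightarrow> 0) (at_right 0)" by (rule tendsto_eventually)
  from tendsto_unique[OF _ lim this] show "a n = 0" by simp
qed

text \<open>Views a generating function as a power series in one chosen variable; the powers of the
  other variables are hidden in the weight \<open>G\<close>.\<close>

lemma pgf_slice:
  assumes M: "finite_measure M" and Z: "Z \<in> measurable M (count_space UNIV)" and G: "G \<in> borel_measurable M"
    and G01: "\<And>x. 0 \<le> G x" "\<And>x. G x \<le> (1::real)" and t: "0 \<le> t" "t < (1::real)"
  shows "(\<lambda>n. (LINT x|M. G x * of_bool (Z x = (n::nat))) * t ^ n) sums (LINT x|M. G x * t ^ Z x)"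
proof -
  interpret finite_measure M by fact
  have [measurable]: "G \<in> borel_measurable M" "Z \<in> measurable M (count_space UNIV)" by fact+
  let ?f = "\<lambda>n x. G x * of_bool (Z x = n) * t ^ n"
  have I: "integrable M (?f n)" for n
    using G01 t by (intro integrable_const_bound[of _ 1] AE_I2)
       (auto simp: abs_mult power_le_one intro!: mult_le_one)
  have S: "summable (\<lambda>n. norm (?f n x))" for x
    by (rule summable_finite[of "{Z x}"]) auto
  have le: "(LINT x|M. norm (?f n x)) \<le> measure M (space M) * t ^ n" for n
  proof -
    have "(LINT x|M. norm (?f n x)) \<le> (LINT x|M. t ^ n)"
      using G01 t by (intro integral_mono integrable_norm I) (auto simp: abs_mult mult_le_cancel_right1 mult_left_le_one_le)
    then show ?thesis by simp
  qed
  have "summable (\<lambda>n. measure M (space M) * t ^ n)" using t by (intro summable_mult summable_geometric) auto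
  then have S2: "summable (\<lambda>n. LINT x|M. norm (?f n x))"
    by (rule summable_comparison_test'[where N=0]) (use le in \<open>auto simp: integral_nonneg_AE\<close>)
  have "(\<lambda>n. integral\<^sup>L M (?f n)) sums (LINT x|M. (\<Sum>n. ?f n x))"
    using I S S2 by (intro sums_integral) auto
  also have "(\<lambda>x. \<Sum>n. ?f n x) = (\<lambda>x. G x * t ^ Z x)"
    by (rule ext, subst suminf_finite[of "{Z _}"]) auto
  finally show ?thesis by simp
qed

text \<open>Coefficients are extracted one variable at a time. An event already extracted is
  absorbed into the weight, which is why the weights are arbitrary functions into [0, 1]; the event
  that the walker follows a given path enters in the same way.\<close>

lemma pgf_unique:
  fixes Z :: "'i \<Rightarrow> 'a \<Rightarrow> nat" and Z' :: "'i \<Rightarrow> 'b \<Rightarrow> nat"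
  assumes I: "finite I" and M: "finite_measure M" and M': "finite_measure M'"
    and Z: "\<And>i. i \<in> I \<Longrightarrow> Z i \<in> measurable M (count_space UNIV)"
    and Z': "\<And>i. i \<in> I \<Longrightarrow> Z' i \<in> measurable M' (count_space UNIV)"
    and F: "F \<in> borel_measurable M" "\<And>x. 0 \<le> F x" "\<And>x. F x \<le> (1::real)"
    and F': "F' \<in> borel_measurable M'" "\<And>x. 0 \<le> F' x" "\<And>x. F' x \<le> (1::real)"
    and eq: "\<And>u. (\<And>i. 0 \<le> u i \<and> u i \<le> 1) \<Longrightarrow>
      (LINT x|M. F x * (\<Prod>i\<in>I. u i ^ Z i x)) = (LINT x|M'. F' x * (\<Prod>i\<in>I. u i ^ Z' i x))"
  shows "(LINT x|M. F x * (\<Prod>i\<in>I. of_bool (Z i x = k i))) = (LINT x|M'. F' x * (\<Prod>i\<in>I. of_bool (Z' i x = k i)))"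
  using I Z Z' F F' eq
proof (induction I arbitrary: F F' rule: finite_induct)
  case empty
  then show ?case using empty(9)[of "\<lambda>_. 0"] by simp
next
  case (insert i I)
  interpret M: finite_measure M by fact
  interpret M': finite_measure M' by fact
  have [measurable]: "F \<in> borel_measurable M" "F' \<in> borel_measurable M'"
    "Z i \<in> measurable M (count_space UNIV)" "Z' i \<in> measurable M' (count_space UNIV)"
    using insert.prems by auto
  let ?G = "\<lambda>x. F x * of_bool (Z i x = k i)" and ?G' = "\<lambda>x. F' x * of_bool (Z' i x = k i)"
  have "(LINT x|M. ?G x * (\<Prod>j\<in>I. of_bool (Z j x = k j))) = (LINT x|M'. ?G' x * (\<Prod>j\<in>I. of_bool (Z' j x = k j)))"
  proof (rule insert.IH)
    fix u :: "'i \<Rightarrow> real" assume u: "\<And>i. 0 \<le> u i \<and> u i \<le> 1"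
    let ?H = "\<lambda>x. F x * (\<Prod>j\<in>I. u j ^ Z j x)" and ?H' = "\<lambda>x. F' x * (\<Prod>j\<in>I. u j ^ Z' j x)"
    have H: "?H \<in> borel_measurable M" "?H' \<in> borel_measurable M'"
    proof -
      have "(\<lambda>x. u j ^ Z j x) \<in> borel_measurable M" "(\<lambda>x. u j ^ Z' j x) \<in> borel_measurable M'" if "j \<in> I" for j
        using insert.prems(1)[of j] insert.prems(2)[of j] that
        by (auto intro: measurable_compose[where g="\<lambda>n. u j ^ n"])
      then show "?H \<in> borel_measurable M" "?H' \<in> borel_measurable M'"
        by (auto intro!: borel_measurable_times borel_measurable_prod)
    qed
    have pr: "0 \<le> (\<Prod>j\<in>I. u j ^ f j)" "(\<Prod>j\<in>I. u j ^ f j) \<le> 1" for f :: "'i \<Rightarrow> nat"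
      using u by (auto intro!: prod_nonneg prod_le_1 power_le_one)
    have H01: "0 \<le> ?H x" "?H x \<le> 1" "0 \<le> ?H' y" "?H' y \<le> 1" for x y
      using insert.prems(4,5,7,8) pr by (auto intro!: mult_nonneg_nonneg mult_le_one)
    let ?a = "\<lambda>n. LINT x|M. ?H x * of_bool (Z i x = n)" and ?a' = "\<lambda>n. LINT x|M'. ?H' x * of_bool (Z' i x = n)"
    have s: "(\<lambda>n. ?a n * t ^ n) sums (LINT x|M. ?H x * t ^ Z i x)"
      "(\<lambda>n. ?a' n * t ^ n) sums (LINT x|M'. ?H' x * t ^ Z' i x)" if "0 < t" "t < 1" for t
      using that H H01 M M' by (intro pgf_slice; simp)+
    have "?a (k i) - ?a' (k i) = 0"
    proof (rule powser_zero_on_unit_interval[where a="\<lambda>n. ?a n - ?a' n" and B="measure M (space M) + measure M' (space M')"])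
      fix n
      have b: "\<bar>LINT x|N. h x * of_bool (W x = n)\<bar> \<le> measure N (space N)"
        if N: "finite_measure N" and h: "h \<in> borel_measurable N" "\<And>x. 0 \<le> h x" "\<And>x. h x \<le> 1" 
          and W: "W \<in> measurable N (count_space UNIV)"
        for N :: "'c measure" and h :: "'c \<Rightarrow> real" and W :: "'c \<Rightarrow> nat"
      proof -
        interpret N: finite_measure N by fact
        have [measurable]: "h \<in> borel_measurable N" "W \<in> measurable N (count_space UNIV)" by fact+
        have "\<bar>LINT x|N. h x * of_bool (W x = n)\<bar> \<le> (LINT x|N. \<bar>h x * of_bool (W x = n)\<bar>)" by (rule integral_abs_bound)
        also have "\<dots> \<le> (LINT x|N. 1)"
          using h by (intro integral_mono integrable_abs N.integrable_const_bound[of _ 1] AE_I2) (auto simp: abs_mult)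
        finally show ?thesis by simp
      qed
      show "\<bar>?a n - ?a' n\<bar> \<le> measure M (space M) + measure M' (space M')"
        using b[OF M H(1) H01(1,2), of "Z i"] b[OF M' H(2) H01(3,4), of "Z' i"] by auto
    next
      fix t :: real assume t: "0 < t" "t < 1"
      have pu: "(\<Prod>j\<in>insert i I. (u(i := t)) j ^ f j) = t ^ f i * (\<Prod>j\<in>I. u j ^ f j)" for f :: "'i \<Rightarrow> nat"
      proof -
        have "(\<Prod>j\<in>I. (u(i := t)) j ^ f j) = (\<Prod>j\<in>I. u j ^ f j)" using insert.hyps by (intro prod.cong) auto
        then show ?thesis using insert.hyps by simp
      qed
      have "(LINT x|M. ?H x * t ^ Z i x) = (LINT x|M. F x * (\<Prod>j\<in>insert i I. (u(i := t)) j ^ Z j x))"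
        by (simp only: pu mult_ac)
      also have "\<dots> = (LINT x|M'. F' x * (\<Prod>j\<in>insert i I. (u(i := t)) j ^ Z' j x))"
        using u t by (intro insert.prems(9)) auto
      also have "\<dots> = (LINT x|M'. ?H' x * t ^ Z' i x)"
        by (simp only: pu mult_ac)
      finally show "(\<Sum>n. (?a n - ?a' n) * t ^ n) = 0"
        using sums_diff[OF s(1)[OF t] s(2)[OF t]] by (simp add: sums_iff left_diff_distrib)
    qed
    then show "(LINT x|M. ?G x * (\<Prod>j\<in>I. u j ^ Z j x)) = (LINT x|M'. ?G' x * (\<Prod>j\<in>I. u j ^ Z' j x))"
      by (simp add: mult_ac)
  qed (use insert.prems in auto)
  then show ?case using insert.hyps by (simp add: mult.assoc)
qed

subsection \<open>The first-meeting representation\<close>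

definition pos :: "(nat \<Rightarrow> int) \<Rightarrow> nat \<Rightarrow> int" where "pos e n = (\<Sum>l<n. e l)"

definition paths :: "real \<Rightarrow> nat \<Rightarrow> (nat \<Rightarrow> int) pmf" where
  "paths p N = Pi_pmf {..<N} 0 (\<lambda>_. nn_step_pmf p)"

lemma nn_step_bound: "x \<in> set_pmf (nn_step_pmf p) \<Longrightarrow> \<bar>x\<bar> \<le> 1"
  by (auto simp: nn_step_pmf_def split: if_splits)

lemma paths_bound: assumes "e \<in> set_pmf (paths p N)" shows "\<bar>e l\<bar> \<le> 1"
  using assms nn_step_bound[of "e l" p] set_Pi_pmf[of "{..<N}" 0 "\<lambda>_. nn_step_pmf p"]
  by (cases "l < N") (auto simp: paths_def PiE_dflt_def)

lemma pos_bound: assumes "e \<in> set_pmf (paths p N)" shows "\<bar>pos e n\<bar> \<le> int n"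
proof -
  have "\<bar>pos e n\<bar> \<le> (\<Sum>l<n. \<bar>e l\<bar>)" unfolding pos_def by (rule sum_abs)
  also have "\<dots> \<le> (\<Sum>l<n. 1)" by (intro sum_mono paths_bound[OF assms])
  finally show ?thesis by simp
qed

lemma finite_set_paths: "finite (set_pmf (paths p N))"
proof -
  have "finite (set_pmf (nn_step_pmf p))"
    by (rule finite_subset[of _ "{-1, 0, 1}"]) (use nn_step_bound in force, simp)
  then show ?thesis unfolding paths_def by (subst set_Pi_pmf) auto
qed

lemma integrable_paths [simp]: "integrable (measure_pmf (paths p N)) (f :: _ \<Rightarrow> real)"
  by (rule integrable_measure_pmf_finite[OF finite_set_paths])

lemma map_sum_paths:
  assumes "J \<subseteq> {..<N}" shows "map_pmf (\<lambda>e. \<Sum>l\<in>J. e l) (paths p N) = nn_walk_pmf p (card J)"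
proof -
  have fin: "finite J" using assms finite_subset by blast
  have "map_pmf (\<lambda>e. \<Sum>l\<in>J. e l) (Pi_pmf J 0 (\<lambda>_. nn_step_pmf p)) = nn_walk_pmf p (card J)"
    using fin
  proof (induction J rule: finite_induct)
    case (insert x J)
    have "map_pmf (\<lambda>e. \<Sum>l\<in>insert x J. e l) (Pi_pmf (insert x J) 0 (\<lambda>_. nn_step_pmf p))
      = map_pmf (\<lambda>(y, f). (\<Sum>l\<in>insert x J. (f(x := y)) l)) (pair_pmf (nn_step_pmf p) (Pi_pmf J 0 (\<lambda>_. nn_step_pmf p)))"
      using insert by (simp add: Pi_pmf_insert pmf.map_comp o_def case_prod_beta')
    also have "(\<lambda>(y :: int, f). (\<Sum>l\<in>insert x J. (f(x := y)) l)) = (\<lambda>(y, f). y + (\<Sum>l\<in>J. f l))"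
      using insert by (auto simp: fun_eq_iff intro!: sum.cong)
    also have "map_pmf \<dots> (pair_pmf (nn_step_pmf p) (Pi_pmf J 0 (\<lambda>_. nn_step_pmf p)))
      = bind_pmf (map_pmf (\<lambda>f. \<Sum>l\<in>J. f l) (Pi_pmf J 0 (\<lambda>_. nn_step_pmf p))) (\<lambda>z. map_pmf (\<lambda>s. z + s) (nn_step_pmf p))"
      unfolding pair_pmf_def map_pmf_def bind_assoc_pmf bind_return_pmf
      by (subst bind_commute_pmf) (simp add: add.commute)
    finally show ?case using insert by simp
  qed simp
  moreover have "map_pmf (\<lambda>e. \<Sum>l\<in>J. e l) (Pi_pmf J 0 (\<lambda>_. nn_step_pmf p)) = map_pmf (\<lambda>e. \<Sum>l\<in>J. e l) (paths p N)"
    unfolding paths_def using assms by (subst Pi_pmf_subset[of "{..<N}" J]) (auto simp: pmf.map_comp o_def)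
  ultimately show ?thesis by simp
qed

lemma pos_diff: "m \<le> n \<Longrightarrow> pos e n - pos e m = (\<Sum>l\<in>{m..<n}. e l)"
  unfolding pos_def by (simp add: sum_diff_nat_ivl lessThan_atLeast0)

lemma map_pos_diff_paths: assumes "m \<le> n" "n \<le> N"
  shows "map_pmf (\<lambda>e. pos e n - pos e m) (paths p N) = nn_walk_pmf p (n - m)"
  using map_sum_paths[of "{m..<n}" N p] assms by (simp add: pos_diff subset_iff)

text \<open>The starting site that a particle with steps \<open>e\<close> must have in order to be
  with the walker at index \<open>n\<close>. Equal offsets at two indices therefore mean that one
  and the same particle can meet the walker at both.\<close>

definition off :: "(nat \<Rightarrow> int) \<Rightarrow> (nat \<Rightarrow> int) \<Rightarrow> nat \<Rightarrow> int" where
  "off s e n = pos s (Suc n) - pos e (Suc n)"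

definition fresh :: "(nat \<Rightarrow> int) \<Rightarrow> (nat \<Rightarrow> int) \<Rightarrow> nat \<Rightarrow> bool" where
  "fresh s e m \<longleftrightarrow> (\<forall>i<m. off s e i \<noteq> off s e m)"

text \<open>
  Times are shifted by one: index \<open>n\<close> stands for the time \<open>n + 1\<close>. The list \<open>L m\<close> holds the steps of
  all particles that are with the walker at index \<open>m\<close>, so a particle is at the walker's position
  at \<open>n\<close> exactly if its offset at \<open>n\<close> is the one at \<open>m\<close>. To count every particle once, it is kept in
  \<open>L m\<close> only if \<open>m\<close> is its first meeting with the walker.
\<close>
definition occ :: "(nat \<Rightarrow> int) \<Rightarrow> (nat \<Rightarrow> (nat \<Rightarrow> int) list) \<Rightarrow> nat \<Rightarrow> nat" where
  "occ s L n = (\<Sum>m\<le>n. length (filter (\<lambda>e. fresh s e m \<and> off s e n = off s e m) (L m)))"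

definition cloud :: "real \<Rightarrow> 'e pmf \<Rightarrow> 'e list pmf" where
  "cloud lam p = bind_pmf (poi lam) (\<lambda>k. replicate_pmf k p)"

lemma nn_integral_replicate_prod:
  assumes h: "\<And>x. 0 \<le> h x" and I: "integrable (measure_pmf p) h"
  shows "(\<integral>\<^sup>+L. ennreal (prod_list (map h L)) \<partial>replicate_pmf k p) = ennreal (mean p h ^ k)"
proof (induction k)
  case (Suc k)
  have e0: "mean p h \<ge> 0" using h by simp
  have pl: "prod_list (map h L) \<ge> 0" for L using h by (induction L) auto
  have "(\<integral>\<^sup>+L. ennreal (prod_list (map h L)) \<partial>replicate_pmf (Suc k) p)
     = (\<integral>\<^sup>+x. \<integral>\<^sup>+L. ennreal (h x) * ennreal (prod_list (map h L)) \<partial>replicate_pmf k p \<partial>p)"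
    using h pl by (simp add: ennreal_mult)
  also have "\<dots> = (\<integral>\<^sup>+x. ennreal (h x) \<partial>p) * ennreal (mean p h ^ k)"
    using Suc by (simp add: nn_integral_cmult nn_integral_multc)
  also have "(\<integral>\<^sup>+x. ennreal (h x) \<partial>p) = ennreal (mean p h)"
    using h I by (intro nn_integral_eq_integral) auto
  finally show ?case using e0 by (simp add: ennreal_mult)
qed simp

text \<open>The generating functional of a Poisson process with intensity \<open>lam\<close> times
  \<open>p\<close>.\<close>

lemma nn_integral_cloud_prod:
  assumes h: "\<And>x. 0 \<le> h x" and I: "integrable (measure_pmf p) h" and lam: "lam \<ge> 0"
  shows "(\<integral>\<^sup>+L. ennreal (prod_list (map h L)) \<partial>cloud lam p) = ennreal (exp (lam * (mean p h - 1)))"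
proof -
  have e0: "mean p h \<ge> 0" using h by simp
  have "(\<integral>\<^sup>+L. ennreal (prod_list (map h L)) \<partial>cloud lam p) = (\<integral>\<^sup>+k. ennreal (mean p h ^ k) \<partial>poi lam)"
    by (simp add: cloud_def nn_integral_replicate_prod[OF h I])
  also have "\<dots> = ennreal (mean (poi lam) (\<lambda>k. mean p h ^ k))"
    using e0 by (intro nn_integral_eq_integral integrable_poi exp_growth_power lam) auto
  finally show ?thesis by (simp add: poi_pgf lam)
qed

text \<open>Each value of \<open>d\<close> is counted at its first occurrence. This identity is what
  exchanges first meetings for starting sites.\<close>

lemma sum_first_visits:
  "(\<Sum>m<(N::nat). if \<forall>i<m. d i \<noteq> d m then G (d m) else 0) = (\<Sum>y\<in>d ` {..<N}. G y :: real)"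
proof (induction N)
  case (Suc N)
  show ?case
  proof (cases "\<forall>i<N. d i \<noteq> d N")
    case True
    then have "d N \<notin> d ` {..<N}" by force
    then show ?thesis using Suc True by (simp add: lessThan_Suc)
  next
    case False
    then obtain i where "i < N" "d i = d N" by blast
    then have "d N \<in> d ` {..<N}" by (metis image_eqI lessThan_iff)
    then have im: "d ` {..<Suc N} = d ` {..<N}" by (auto simp: lessThan_Suc)
    have z: "(if \<forall>i<N. d i \<noteq> d N then G (d N) else 0) = 0" using False by auto
    show ?thesis unfolding sum.lessThan_Suc Suc im z by simp
  qed
qed simp

text \<open>Steps are numbered by absolute time and cover the past too. A member of the list at
  \<open>m\<close> is placed in space by being with the walker at index \<open>m\<close>, so the law
  of the lists does not depend on the walker.\<close>

definition clouds :: "real \<Rightarrow> nat \<Rightarrow> (nat \<Rightarrow> (nat \<Rightarrow> int) list) pmf" where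
  "clouds lam N = Pi_pmf {..<N} [] (\<lambda>_. cloud lam (paths (1/2) N))"

text \<open>The factor that a particle with steps \<open>e\<close> started at \<open>y\<close>
  contributes to the generating function of the field along \<open>s\<close>.\<close>

definition hits :: "nat \<Rightarrow> (nat \<Rightarrow> real) \<Rightarrow> (nat \<Rightarrow> int) \<Rightarrow> int \<Rightarrow> (nat \<Rightarrow> int) \<Rightarrow> real" where
  "hits N u s y e = (\<Prod>n<N. u n ^ of_bool (y + pos e (Suc n) = pos s (Suc n)))"

lemma power_length_filter: "u ^ length (filter P L) = prod_list (map (\<lambda>e. u ^ of_bool (P e)) L)"
  by (induction L) auto

lemma prod_prod_list: "(\<Prod>n\<in>A. prod_list (map (g n) L)) = prod_list (map (\<lambda>e. \<Prod>n\<in>A. g n e :: real) L)"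
  by (induction L) (auto simp: prod.distrib)

text \<open>
  The right-hand side is the generating function of the field along the path \<open>s\<close>: summing over first
  meetings is the same as summing over the starting points \<open>y\<close>.
\<close>
lemma occ_pgf:
  assumes lam: "lam \<ge> 0" and u: "\<And>n. 0 \<le> u n \<and> u n \<le> 1" and s: "\<And>n. \<bar>pos s n\<bar> \<le> int n"
  shows "mean (clouds lam N) (\<lambda>L. \<Prod>n<N. u n ^ occ s L n)
    = exp (lam * (\<Sum>y\<in>{-(2 * int N)..2 * int N}. mean (paths (1/2) N) (hits N u s y) - 1))"
proof -
  let ?P = "paths (1/2) N" and ?Y = "{-(2 * int N)..2 * int N}"
  let ?c = "\<lambda>m n e. fresh s e m \<and> off s e n = off s e m"
  \<comment> \<open>The weight collected by one member of the list at \<open>m\<close>; it is 1 if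
    the meeting at \<open>m\<close> is not its first.\<close>
  let ?h = "\<lambda>m e. \<Prod>n\<in>{m..<N}. u n ^ of_bool (?c m n e)"
  have h0: "0 \<le> ?h m e" for m e using u by (intro prod_nonneg) auto
  have split: "(\<Prod>n<N. u n ^ occ s L n) = (\<Prod>m<N. prod_list (map (?h m) (L m)))" for L
  proof -
    have "(\<Prod>n<N. u n ^ occ s L n) = (\<Prod>n<N. \<Prod>m\<in>{m. m < N \<and> m \<le> n}. u n ^ length (filter (?c m n) (L m)))"
      unfolding occ_def power_sum by (intro prod.cong refl) auto
    also have "\<dots> = (\<Prod>m<N. \<Prod>n\<in>{n. n < N \<and> m \<le> n}. u n ^ length (filter (?c m n) (L m)))"
      using prod.swap_restrict[of "{..<N}" "{..<N}" "\<lambda>n m. u n ^ length (filter (?c m n) (L m))" "\<lambda>n m. m \<le> n"]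
      by simp
    also have "\<dots> = (\<Prod>m<N. prod_list (map (?h m) (L m)))"
      unfolding power_length_filter prod_prod_list
      by (intro prod.cong refl arg_cong[where f=prod_list] map_cong) auto
    finally show ?thesis .
  qed
  \<comment> \<open>Path by path, a site that leads to a meeting is the offset at exactly one fresh
    index, and all other sites contribute 0. The window is wide enough because positions of walker
    and particle are at most \<open>N\<close> each.\<close>
  have key: "(\<Sum>m<N. ?h m e - 1) = (\<Sum>y\<in>?Y. hits N u s y e - 1)" if e: "e \<in> set_pmf ?P" for e
  proof -
    let ?d = "off s e" and ?G = "\<lambda>y. hits N u s y e - 1"
    have hit: "(y + pos e (Suc n) = pos s (Suc n)) = (?d n = y)" for y n by (auto simp: off_def)
    have "?h m e - 1 = (if \<forall>i<m. ?d i \<noteq> ?d m then ?G (?d m) else 0)" if "m < N" for m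
    proof (cases "\<forall>i<m. ?d i \<noteq> ?d m")
      case True
      then have "?h m e = (\<Prod>n\<in>{m..<N}. u n ^ of_bool (?d n = ?d m))" by (simp add: fresh_def)
      \<comment> \<open>By freshness no earlier index has this offset, so the factors added are
        1.\<close>
      also have "\<dots> = (\<Prod>n<N. u n ^ of_bool (?d n = ?d m))"
        using True by (intro prod.mono_neutral_left) (auto simp: not_le)
      finally show ?thesis using True by (simp add: hits_def hit)
    next
      case False
      then have "\<not> fresh s e m" by (simp add: fresh_def)
      then show ?thesis using False by auto
    qed
    then have "(\<Sum>m<N. ?h m e - 1) = (\<Sum>m<N. if \<forall>i<m. ?d i \<noteq> ?d m then ?G (?d m) else 0)"
      by (intro sum.cong) auto
    also have "\<dots> = (\<Sum>y\<in>?d ` {..<N}. ?G y)" by (rule sum_first_visits)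
    also have "\<dots> = (\<Sum>y\<in>?Y. ?G y)"
    proof (intro sum.mono_neutral_left)
      show "?d ` {..<N} \<subseteq> ?Y"
      proof safe
        fix n assume "n < N"
        then show "?d n \<in> ?Y" using s[of "Suc n"] pos_bound[OF e, of "Suc n"] by (auto simp: off_def)
      qed
      show "\<forall>y\<in>?Y - ?d ` {..<N}. ?G y = 0" by (auto simp: hits_def hit intro!: prod.neutral)
    qed simp
    finally show ?thesis .
  qed
  have "(\<integral>\<^sup>+L. ennreal (\<Prod>n<N. u n ^ occ s L n) \<partial>clouds lam N)
    = (\<integral>\<^sup>+L. (\<Prod>m<N. ennreal (prod_list (map (?h m) (L m)))) \<partial>clouds lam N)"
    unfolding split using h0 by (subst prod_ennreal) (auto intro!: prod_list_nonneg)
  also have "\<dots> = (\<Prod>m<N. ennreal (exp (lam * (mean ?P (?h m) - 1))))"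
    unfolding clouds_def by (subst nn_integral_prod_Pi_pmf) (auto intro!: prod.cong nn_integral_cloud_prod lam h0)
  also have "\<dots> = ennreal (exp (lam * (\<Sum>m<N. mean ?P (?h m) - 1)))"
    by (subst prod_ennreal) (auto simp: exp_sum sum_distrib_left)
  also have "(\<Sum>m<N. mean ?P (?h m) - 1) = mean ?P (\<lambda>e. \<Sum>m<N. ?h m e - 1)"
    by simp
  also have "\<dots> = mean ?P (\<lambda>e. \<Sum>y\<in>?Y. hits N u s y e - 1)"
    using key by (intro integral_cong_AE AE_pmfI) auto
  also have "\<dots> = (\<Sum>y\<in>?Y. mean ?P (hits N u s y) - 1)"
    by (simp add: sum_subtractf)
  finally have "(\<integral>\<^sup>+L. ennreal (\<Prod>n<N. u n ^ occ s L n) \<partial>clouds lam N)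
    = ennreal (exp (lam * (\<Sum>y\<in>?Y. mean ?P (hits N u s y) - 1)))" .
  then show ?thesis using u by (subst integral_eq_nn_integral) (auto intro!: prod_nonneg)
qed

subsection \<open>Two-point laws and overlaps\<close>

lemma pmf_map_mean: "pmf (map_pmf f p) x = mean p (\<lambda>y. of_bool (f y = x))"
proof -
  have "(\<lambda>y. of_bool (f y = x) :: real) = indicator (f -` {x})" by (auto simp: indicator_def)
  then show ?thesis by (simp add: pmf_map)
qed

lemma mean_pos_increment:
  assumes "m \<le> n" "n \<le> N"
  shows "mean (paths p N) (\<lambda>e. g (pos e n - pos e m)) = mean (nn_walk_pmf p (n - m)) g"
  unfolding map_pos_diff_paths[OF assms, of p, symmetric] by simp

lemma mean_indicator_pmf: "mean p (\<lambda>y. of_bool (y = x)) = pmf p x"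
  using pmf_map_mean[of "\<lambda>y. y" p x] by simp

text \<open>Each path hits at index \<open>m\<close> from exactly one site, and likewise at
  \<open>n\<close>. The mixed term survives only if these sites agree, that is, if particle and
  walker have the same increment; its probability is the transition probability.\<close>

lemma sum_hits_two:
  assumes mn: "m < n" "n < N" and s: "\<And>n. \<bar>pos s n\<bar> \<le> int n"
    and u: "u = (\<lambda>l. if l = m then a else if l = n then b else 1)"
  shows "(\<Sum>y\<in>{-(2 * int N)..2 * int N}. mean (paths (1/2) N) (hits N u s y) - 1)
    = (a - 1) + (b - 1) + (a - 1) * (b - 1) * srw_trans (n - m) (pos s (Suc n) - pos s (Suc m))"
proof -
  let ?P = "paths (1/2) N" and ?Y = "{-(2 * int N)..2 * int N}"
  have h: "hits N u s y e = a ^ of_bool (off s e m = y) * b ^ of_bool (off s e n = y)" for y e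
  proof -
    have "hits N u s y e = (\<Prod>l\<in>{m, n}. u l ^ of_bool (y + pos e (Suc l) = pos s (Suc l)))"
      unfolding hits_def using mn by (intro prod.mono_neutral_right) (auto simp: u)
    then show ?thesis using mn by (simp add: u off_def algebra_simps eq_commute)
  qed
  have pt: "(\<Sum>y\<in>?Y. hits N u s y e - 1) = (a - 1) + (b - 1) + (a - 1) * (b - 1) * of_bool (off s e n = off s e m)"
    if e: "e \<in> set_pmf ?P" for e
  proof -
    have Y: "off s e l \<in> ?Y" if "l < N" for l
      using s[of "Suc l"] pos_bound[OF e, of "Suc l"] that by (auto simp: off_def)
    have "(\<Sum>y\<in>?Y. hits N u s y e - 1) = (\<Sum>y\<in>?Y. (a - 1) * of_bool (y = off s e m) + (b - 1) * of_bool (y = off s e n)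
        + (a - 1) * (b - 1) * of_bool (off s e n = off s e m) * of_bool (y = off s e m))"
      unfolding h by (intro sum.cong) (auto simp: algebra_simps)
    also have "\<dots> = (a - 1) * (\<Sum>y\<in>?Y. of_bool (y = off s e m)) + (b - 1) * (\<Sum>y\<in>?Y. of_bool (y = off s e n))
        + (a - 1) * (b - 1) * of_bool (off s e n = off s e m) * (\<Sum>y\<in>?Y. of_bool (y = off s e m))"
      by (simp only: sum.distrib sum_distrib_left)
    also have "(\<Sum>y\<in>?Y. of_bool (y = off s e m)) = (1::real)" using Y[of m] mn by simp
    also have "(\<Sum>y\<in>?Y. of_bool (y = off s e n)) = (1::real)" using Y[of n] mn by simp
    finally show ?thesis by simp
  qed
  have "(\<Sum>y\<in>?Y. mean ?P (hits N u s y) - 1) = mean ?P (\<lambda>e. \<Sum>y\<in>?Y. hits N u s y e - 1)"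
    by (simp add: sum_subtractf)
  also have "\<dots> = mean ?P (\<lambda>e. (a - 1) + (b - 1) + (a - 1) * (b - 1) * of_bool (off s e n = off s e m))"
    using pt by (intro integral_cong_AE AE_pmfI) auto
  also have "\<dots> = (a - 1) + (b - 1) + (a - 1) * (b - 1) * mean ?P (\<lambda>e. of_bool (off s e n = off s e m))"
    by simp
  also have "mean ?P (\<lambda>e. of_bool (off s e n = off s e m))
      = mean ?P (\<lambda>e. of_bool (pos e (Suc n) - pos e (Suc m) = pos s (Suc n) - pos s (Suc m)))"
    by (intro Bochner_Integration.integral_cong) (auto simp: off_def)
  also have "\<dots> = srw_trans (n - m) (pos s (Suc n) - pos s (Suc m))"
    using mean_pos_increment[of "Suc m" "Suc n" N "1/2" "\<lambda>x. of_bool (x = pos s (Suc n) - pos s (Suc m))"] mn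
    by (simp add: mean_indicator_pmf srw_trans_def)
  finally show ?thesis .
qed

lemma srw_trans_bounds: "0 \<le> srw_trans t x" "srw_trans t x \<le> 1"
  by (auto simp: srw_trans_def pmf_le_1)

text \<open>Setting all but two variables to 1 in \<open>occ_pgf\<close> leaves the generating
  function of two Poisson variables sharing a part of rate \<open>lam * \<rho>\<close>.\<close>

lemma occ_two_point:
  assumes lam: "lam \<ge> 0" and mn: "m < n" "n < N" and s: "\<And>n. \<bar>pos s n\<bar> \<le> int n"
  shows "map_pmf (\<lambda>L. (occ s L m, occ s L n)) (clouds lam N)
    = two_point lam (srw_trans (n - m) (pos s (Suc n) - pos s (Suc m)))"
proof (rule pmf_eqI)
  fix z :: "nat \<times> nat"
  let ?\<rho> = "srw_trans (n - m) (pos s (Suc n) - pos s (Suc m))"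
  let ?Z' = "\<lambda>l z. if l = m then fst z else snd (z :: nat \<times> nat)"
  let ?k = "\<lambda>l. if l = m then fst z else snd z"
  have "(LINT L|measure_pmf (clouds lam N). 1 * (\<Prod>l\<in>{m, n}. of_bool (occ s L l = ?k l)))
     = (LINT w|measure_pmf (two_point lam ?\<rho>). 1 * (\<Prod>l\<in>{m, n}. of_bool (?Z' l w = ?k l)) :: real)"
  proof (rule pgf_unique)
    fix u :: "nat \<Rightarrow> real" assume u: "\<And>i. 0 \<le> u i \<and> u i \<le> 1"
    let ?u = "\<lambda>l. if l = m then u m else if l = n then u n else 1"
    have "(\<Prod>l\<in>{m, n}. u l ^ occ s L l) = (\<Prod>l<N. ?u l ^ occ s L l)" for L
    proof -
      have "(\<Prod>l<N. ?u l ^ occ s L l) = (\<Prod>l\<in>{m, n}. ?u l ^ occ s L l)"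
        using mn by (intro prod.mono_neutral_right) auto
      then show ?thesis using mn by simp
    qed
    then have "mean (clouds lam N) (\<lambda>L. 1 * (\<Prod>l\<in>{m, n}. u l ^ occ s L l))
      = mean (clouds lam N) (\<lambda>L. \<Prod>l<N. ?u l ^ occ s L l)" by simp
    also have "\<dots> = exp (lam * (\<Sum>y\<in>{-(2 * int N)..2 * int N}. mean (paths (1/2) N) (hits N ?u s y) - 1))"
      by (intro occ_pgf lam s) (use u in auto)
    also have "\<dots> = exp (lam * ((u m - 1) + (u n - 1) + (u m - 1) * (u n - 1) * ?\<rho>))"
      by (subst sum_hits_two[OF mn s refl]) simp
    also have "\<dots> = mean (two_point lam ?\<rho>) (\<lambda>z. u m ^ fst z * u n ^ snd z)"
      by (subst two_point_pgf) (auto simp: srw_trans_bounds lam)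
    finally show "mean (clouds lam N) (\<lambda>L. 1 * (\<Prod>l\<in>{m, n}. u l ^ occ s L l))
      = mean (two_point lam ?\<rho>) (\<lambda>w. 1 * (\<Prod>l\<in>{m, n}. u l ^ ?Z' l w))" using mn by simp
  qed (auto intro: measure_pmf.finite_measure_axioms)
  then show "pmf (map_pmf (\<lambda>L. (occ s L m, occ s L n)) (clouds lam N)) z = pmf (two_point lam ?\<rho>) z"
    using mn pmf_map_mean[of "\<lambda>z. z" "two_point lam ?\<rho>" z]
    by (simp add: pmf_map_mean prod_eq_iff of_bool_conj)
qed

lemma occ_marginal:
  assumes lam: "lam \<ge> 0" and n: "n < N" and s: "\<And>n. \<bar>pos s n\<bar> \<le> int n"
  shows "map_pmf (\<lambda>L. occ s L n) (clouds lam N) = poi lam"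
proof (rule pmf_eqI)
  fix k
  let ?P = "paths (1/2) N" and ?Y = "{-(2 * int N)..2 * int N}"
  have "(LINT L|measure_pmf (clouds lam N). 1 * (\<Prod>l\<in>{n}. of_bool (occ s L l = k)))
     = (LINT w|measure_pmf (poi lam). 1 * (\<Prod>l\<in>{n}. of_bool (w = k)) :: real)"
  proof (rule pgf_unique[where k="\<lambda>_. k" and Z'="\<lambda>_ x. x"])
    fix u :: "nat \<Rightarrow> real" assume u: "\<And>i. 0 \<le> u i \<and> u i \<le> 1"
    let ?u = "\<lambda>l. if l = n then u n else 1"
    have h: "hits N ?u s y e - 1 = (u n - 1) * of_bool (y = off s e n)" for y e
    proof -
      have "hits N ?u s y e = (\<Prod>l\<in>{n}. ?u l ^ of_bool (y + pos e (Suc l) = pos s (Suc l)))"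
        unfolding hits_def using n by (intro prod.mono_neutral_right) auto
      then show ?thesis by (auto simp add: off_def algebra_simps)
    qed
    have pt: "(\<Sum>y\<in>?Y. hits N ?u s y e - 1) = u n - 1" if e: "e \<in> set_pmf ?P" for e
    proof -
      have "off s e n \<in> ?Y" using s[of "Suc n"] pos_bound[OF e, of "Suc n"] n by (auto simp: off_def)
      then show ?thesis unfolding h sum_distrib_left[symmetric] by simp
    qed
    have "(\<Sum>y\<in>?Y. mean ?P (hits N ?u s y) - 1) = mean ?P (\<lambda>e. \<Sum>y\<in>?Y. hits N ?u s y e - 1)"
      by (simp add: sum_subtractf)
    also have "\<dots> = mean ?P (\<lambda>e. u n - 1)" using pt by (intro integral_cong_AE AE_pmfI) auto
    finally have *: "(\<Sum>y\<in>?Y. mean ?P (hits N ?u s y) - 1) = u n - 1" by simp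
    have "(\<Prod>l\<in>{n}. u l ^ occ s L l) = (\<Prod>l<N. ?u l ^ occ s L l)" for L
    proof -
      have "(\<Prod>l<N. ?u l ^ occ s L l) = (\<Prod>l\<in>{n}. ?u l ^ occ s L l)"
        using n by (intro prod.mono_neutral_right) auto
      then show ?thesis by simp
    qed
    then have "mean (clouds lam N) (\<lambda>L. 1 * (\<Prod>l\<in>{n}. u l ^ occ s L l))
      = mean (clouds lam N) (\<lambda>L. \<Prod>l<N. ?u l ^ occ s L l)" by simp
    also have "\<dots> = exp (lam * (\<Sum>y\<in>?Y. mean ?P (hits N ?u s y) - 1))"
      by (intro occ_pgf lam s) (use u in auto)
    finally show "mean (clouds lam N) (\<lambda>L. 1 * (\<Prod>l\<in>{n}. u l ^ occ s L l)) = mean (poi lam) (\<lambda>w. 1 * (\<Prod>l\<in>{n}. u l ^ w))"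
      unfolding * by (simp add: poi_pgf lam)
  qed (auto intro: measure_pmf.finite_measure_axioms)
  then show "pmf (map_pmf (\<lambda>L. occ s L n) (clouds lam N)) k = pmf (poi lam) k"
    using pmf_map_mean[of "\<lambda>z. z" "poi lam" k] by (simp add: pmf_map_mean)
qed

text \<open>The overlap moment computed from the law of the walk alone; thus constants built from it
  can be fixed before any model is given.\<close>

definition overlap_mean :: "real \<Rightarrow> nat \<Rightarrow> nat \<Rightarrow> real" where
  "overlap_mean p q t = mean (nn_walk_pmf p t) (\<lambda>x. srw_trans t x ^ q)"

lemma mean_exp_walk:
  assumes "0 \<le> p" "p \<le> 1"
  shows "mean (nn_walk_pmf p t) (\<lambda>x. exp (c * real_of_int x)) = (p * exp c + (1 - p) * exp (- c)) ^ t"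
proof -
  have fin: "finite (set_pmf (nn_step_pmf p))"
    by (rule finite_subset[of _ "{-1, 0, 1}"]) (use nn_step_bound in force, simp)
  have "mean (nn_walk_pmf p t) (\<lambda>x. exp (c * real_of_int x)) = mean (paths p t) (\<lambda>e. exp (c * real_of_int (\<Sum>l<t. e l)))"
  proof -
    have w: "nn_walk_pmf p t = map_pmf (\<lambda>e. \<Sum>l<t. e l) (paths p t)"
      using map_sum_paths[of "{..<t}" t p] by simp
    show ?thesis unfolding w by simp
  qed
  also have "\<dots> = mean (paths p t) (\<lambda>e. \<Prod>l<t. exp (c * real_of_int (e l)))"
    by (simp add: exp_sum sum_distrib_left)
  also have "\<dots> = (\<Prod>l<t. mean (nn_step_pmf p) (\<lambda>x. exp (c * real_of_int x)))"
    unfolding paths_def by (intro expectation_prod_Pi_pmf) (auto intro: integrable_measure_pmf_finite fin)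
  also have "mean (nn_step_pmf p) (\<lambda>x. exp (c * real_of_int x)) = p * exp c + (1 - p) * exp (- c)"
    using assms unfolding nn_step_pmf_def integral_map_pmf by (simp add: integral_bernoulli_pmf)
  finally show ?thesis by simp
qed

lemma finite_set_nn_walk: "finite (set_pmf (nn_walk_pmf p t))"
proof -
  have "nn_walk_pmf p t = map_pmf (\<lambda>e. \<Sum>l<t. e l) (paths p t)"
    using map_sum_paths[of "{..<t}" t p] by simp
  then show ?thesis using finite_set_paths by simp
qed

lemma integrable_nn_walk [simp]: "integrable (measure_pmf (nn_walk_pmf p t)) (f :: _ \<Rightarrow> real)"
  by (rule integrable_measure_pmf_finite[OF finite_set_nn_walk])

lemma overlap_mean_1_le:
  assumes p: "0 < p" "p < 1"
  shows "overlap_mean p 1 t \<le> ((1 + 2 * sqrt (p * (1 - p))) / 2) ^ t"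
proof -
  \<comment> \<open>Exponential Markov inequality for the difference of the two walks, at the minimizing \<open>w = exp (2 * c)\<close>.\<close>
  define w where "w = sqrt ((1 - p) / p)"
  have w0: "w > 0" using p by (simp add: w_def)
  define c where "c = ln w / 2"
  have e2: "exp c * exp c = w" using w0 by (simp add: c_def flip: exp_add)
  let ?m = "(1/2) * exp (- c) + (1 - 1/2) * exp (- (- c))" and ?m' = "p * exp c + (1 - p) * exp (- c)"
  have pt: "srw_trans t x \<le> exp (c * real_of_int x) * ?m ^ t" for x
  proof -
    have "pmf (nn_walk_pmf (1/2) t) x * exp (- c * real_of_int x)
       = mean (nn_walk_pmf (1/2) t) (\<lambda>y. of_bool (y = x) * exp (- c * real_of_int y))"
    proof -
      have "mean (nn_walk_pmf (1/2) t) (\<lambda>y. of_bool (y = x) * exp (- c * real_of_int y))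
        = mean (nn_walk_pmf (1/2) t) (\<lambda>y. of_bool (y = x) * exp (- c * real_of_int x))"
        by (intro Bochner_Integration.integral_cong) auto
      then show ?thesis by (simp add: mean_indicator_pmf)
    qed
    also have "\<dots> \<le> mean (nn_walk_pmf (1/2) t) (\<lambda>y. exp (- c * real_of_int y))"
      by (intro integral_mono) auto
    also have "\<dots> = ?m ^ t" by (subst mean_exp_walk) auto
    finally have le: "pmf (nn_walk_pmf (1/2) t) x * exp (- c * real_of_int x) \<le> ?m ^ t" .
    have one: "exp (- c * real_of_int x) * exp (c * real_of_int x) = 1" by (simp flip: exp_add)
    have "srw_trans t x = (pmf (nn_walk_pmf (1/2) t) x * exp (- c * real_of_int x)) * exp (c * real_of_int x)"
      by (simp only: mult.assoc one mult_1_right srw_trans_def)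
    also have "\<dots> \<le> ?m ^ t * exp (c * real_of_int x)" by (intro mult_right_mono le) auto
    finally show ?thesis by (simp only: mult.commute)
  qed
  have "overlap_mean p 1 t \<le> mean (nn_walk_pmf p t) (\<lambda>x. exp (c * real_of_int x) * ?m ^ t)"
    unfolding overlap_mean_def power_one_right by (intro integral_mono pt) auto
  also have "\<dots> = ?m' ^ t * ?m ^ t" using p by (simp add: mean_exp_walk)
  also have "\<dots> = (?m' * ?m) ^ t" by (simp only: power_mult_distrib)
  also have "?m' * ?m = (1 + 2 * sqrt (p * (1 - p))) / 2"
  proof -
    have i: "exp (- c) = inverse (exp c)" by (simp add: exp_minus)
    have "?m' * ?m = (1 + (p * w + (1 - p) / w)) / 2"
      unfolding i e2[symmetric] by (simp add: field_simps)
    also have "p * w = sqrt (p * (1 - p))"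
    proof -
      have "p * w = sqrt (p * p) * w" using p by simp
      also have "\<dots> = sqrt (p * p * ((1 - p) / p))" by (simp only: w_def real_sqrt_mult)
      finally show ?thesis using p by simp
    qed
    also have "(1 - p) / w = sqrt (p * (1 - p))"
    proof -
      have "(1 - p) / w = sqrt ((1 - p) * (1 - p)) / w" using p by simp
      also have "\<dots> = sqrt ((1 - p) * (1 - p) / ((1 - p) / p))" by (simp only: w_def real_sqrt_divide[symmetric])
      finally show ?thesis using p by (simp add: mult.commute)
    qed
    finally show ?thesis by simp
  qed
  finally show ?thesis .
qed

text \<open>The base of the bound for \<open>q = 1\<close> is 1/2 + sqrt (p (1 - p)), which by the
  arithmetic-geometric mean inequality is below 1 unless p = 1/2. Larger \<open>q\<close> only
  decrease the overlap, because transition probabilities are at most 1.\<close>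

lemma overlap_mean_decay:
  assumes p: "0 < p" "p < 1" "p \<noteq> 1/2"
  obtains \<rho> where "0 < \<rho>" "\<rho> < 1" "\<And>q t. q \<ge> 1 \<Longrightarrow> overlap_mean p q t \<le> \<rho> ^ t"
proof -
  let ?\<rho> = "(1 + 2 * sqrt (p * (1 - p))) / 2"
  have "0 < (p - 1/2)\<^sup>2" using p by simp
  then have "p * (1 - p) < (1/2)\<^sup>2" by (simp add: power2_eq_square algebra_simps)
  then have "sqrt (p * (1 - p)) < 1/2" using p by (intro real_less_lsqrt) auto
  then have 1: "?\<rho> < 1" by simp
  have 0: "?\<rho> > 0" using p by (intro divide_pos_pos add_pos_nonneg) auto
  have "overlap_mean p q t \<le> ?\<rho> ^ t" if "q \<ge> 1" for q t
  proof -
    have "overlap_mean p q t \<le> overlap_mean p 1 t"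
      unfolding overlap_mean_def using srw_trans_bounds that
      by (intro integral_mono power_decreasing) auto
    then show ?thesis using overlap_mean_1_le[OF p(1,2), of t] by simp
  qed
  then show ?thesis using that 0 1 by blast
qed

lemma overlap_mean_nonneg: "overlap_mean p q t \<ge> 0"
  unfolding overlap_mean_def using srw_trans_bounds by (intro integral_nonneg_AE) auto

subsection \<open>Influence of one block\<close>

lemma mean_cloud_prod:
  assumes h: "\<And>x. 0 \<le> h x" and I: "integrable (measure_pmf p) h" and lam: "lam \<ge> 0"
  shows "mean (cloud lam p) (\<lambda>L. prod_list (map h L)) = exp (lam * (mean p h - 1))"
proof -
  have pl: "prod_list (map h L) \<ge> 0" for L using h by (induction L) auto
  show ?thesis
    using pl nn_integral_cloud_prod[OF h I lam] by (subst integral_eq_nn_integral) auto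
qed

lemma integrable_of_bool: "integrable (measure_pmf p) (\<lambda>x. of_bool (P x) :: real)"
  by (rule measure_pmf.integrable_const_bound[where B=1]) auto

text \<open>The void probability of the Poisson process is the exponential of minus the expected
  count, and 1 - exp (- x) \<le> x.\<close>

lemma cloud_hit:
  assumes lam: "lam \<ge> 0"
  shows "mean (cloud lam p) (\<lambda>L. of_bool (\<exists>e\<in>set L. A e)) \<le> lam * mean p (\<lambda>e. of_bool (A e))"
proof -
  let ?a = "mean p (\<lambda>e. of_bool (A e))"
  have pl: "prod_list (map (\<lambda>e. of_bool (\<not> A e)) L) = (of_bool (\<forall>e\<in>set L. \<not> A e) :: real)" for L
    by (induction L) auto
  have I: "integrable (measure_pmf (cloud lam p)) (\<lambda>L. prod_list (map (\<lambda>e. of_bool (\<not> A e)) L) :: real)"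
    unfolding pl by (rule integrable_of_bool)
  have na: "mean p (\<lambda>e. of_bool (\<not> A e)) = 1 - ?a"
    using integrable_of_bool[of p A] by (simp add: of_bool_not_iff)
  have "mean (cloud lam p) (\<lambda>L. of_bool (\<exists>e\<in>set L. A e))
     = mean (cloud lam p) (\<lambda>L. 1 - prod_list (map (\<lambda>e. of_bool (\<not> A e)) L))"
    unfolding pl by (intro Bochner_Integration.integral_cong) auto
  also have "\<dots> = 1 - mean (cloud lam p) (\<lambda>L. prod_list (map (\<lambda>e. of_bool (\<not> A e)) L))"
    using I by simp
  also have "mean (cloud lam p) (\<lambda>L. prod_list (map (\<lambda>e. of_bool (\<not> A e)) L)) = exp (lam * (mean p (\<lambda>e. of_bool (\<not> A e)) - 1))"
    by (rule mean_cloud_prod[OF _ integrable_of_bool lam]) auto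
  also have "1 - exp (lam * (mean p (\<lambda>e. of_bool (\<not> A e)) - 1)) \<le> lam * ?a"
    using exp_ge_add_one_self[of "- (lam * ?a)"] unfolding na by simp
  finally show ?thesis .
qed

lemma clouds_component: "m < N \<Longrightarrow> map_pmf (\<lambda>L. L m) (clouds lam N) = cloud lam (paths (1/2) N)"
  unfolding clouds_def by (subst Pi_pmf_component) auto

lemma mean_off_coincide:
  assumes "i \<le> n" "n < N"
  shows "mean (paths (1/2) N) (\<lambda>e. of_bool (off s e n = off s e i)) = srw_trans (n - i) (pos s (Suc n) - pos s (Suc i))"
proof -
  have "mean (paths (1/2) N) (\<lambda>e. of_bool (off s e n = off s e i))
      = mean (paths (1/2) N) (\<lambda>e. of_bool (pos e (Suc n) - pos e (Suc i) = pos s (Suc n) - pos s (Suc i)))"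
    by (intro Bochner_Integration.integral_cong) (auto simp: off_def)
  also have "\<dots> = srw_trans (n - i) (pos s (Suc n) - pos s (Suc i))"
    using mean_pos_increment[of "Suc i" "Suc n" N "1/2" "\<lambda>x. of_bool (x = pos s (Suc n) - pos s (Suc i))"] assms
    by (simp add: mean_indicator_pmf srw_trans_def)
  finally show ?thesis .
qed

text \<open>Given the walker, the event for one particle fixes its increment between the two
  indices. Averaging the transition probability at the walker's own increment produces the first
  overlap moment.\<close>

lemma hit_prob:
  assumes lam: "lam \<ge> 0" and m: "m < N" and i: "i \<le> n" "n < N"
  shows "mean (pair_pmf (paths p N) (clouds lam N)) (\<lambda>z. of_bool (\<exists>e\<in>set (snd z m). off (fst z) e n = off (fst z) e i))
    \<le> lam * overlap_mean p 1 (n - i)"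
proof -
  have "mean (pair_pmf (paths p N) (clouds lam N)) (\<lambda>z. of_bool (\<exists>e\<in>set (snd z m). off (fst z) e n = off (fst z) e i))
    = mean (paths p N) (\<lambda>s. mean (clouds lam N) (\<lambda>L. of_bool (\<exists>e\<in>set (L m). off s e n = off s e i)))"
    by (subst expectation_pair_pmf_iterated[OF integrable_of_bool]) simp
  also have "\<dots> \<le> mean (paths p N) (\<lambda>s. lam * srw_trans (n - i) (pos s (Suc n) - pos s (Suc i)))"
  proof (intro integral_mono)
    fix s
    have "mean (clouds lam N) (\<lambda>L. of_bool (\<exists>e\<in>set (L m). off s e n = off s e i))
      = mean (cloud lam (paths (1/2) N)) (\<lambda>l. of_bool (\<exists>e\<in>set l. off s e n = off s e i))"
      unfolding clouds_component[OF m, of lam, symmetric] by simp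
    also have "\<dots> \<le> lam * mean (paths (1/2) N) (\<lambda>e. of_bool (off s e n = off s e i))"
      by (rule cloud_hit[OF lam])
    finally show "mean (clouds lam N) (\<lambda>L. of_bool (\<exists>e\<in>set (L m). off s e n = off s e i))
      \<le> lam * srw_trans (n - i) (pos s (Suc n) - pos s (Suc i))" unfolding mean_off_coincide[OF i] .
  qed auto
  also have "\<dots> = lam * mean (paths p N) (\<lambda>s. srw_trans (n - i) (pos s (Suc n) - pos s (Suc i)))" by simp
  also have "mean (paths p N) (\<lambda>s. srw_trans (n - i) (pos s (Suc n) - pos s (Suc i))) = overlap_mean p 1 (n - i)"
    using mean_pos_increment[of "Suc i" "Suc n" N p "srw_trans (n - i)"] i by (simp add: overlap_mean_def)
  finally show ?thesis .
qed

text \<open>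
  Resampling block \<open>j\<close> can change the occupation at \<open>n\<close> only through a particle that meets the walker
  both at \<open>n\<close> and at some time up to \<open>j\<close>.
\<close>
definition affected_by :: "nat \<Rightarrow> nat \<Rightarrow> (nat \<Rightarrow> int) \<Rightarrow> (nat \<Rightarrow> (nat \<Rightarrow> int) list) \<Rightarrow> bool" where
  "affected_by j n s L \<longleftrightarrow> (\<exists>m\<le>j. \<exists>e\<in>set (L m). off s e n = off s e m)
     \<or> (\<exists>m\<in>{j<..n}. \<exists>i<j. \<exists>e\<in>set (L m). off s e n = off s e i)"

lemma off_eq_iff: assumes "i \<le> m" shows "off s e m = off s e i \<longleftrightarrow> (\<Sum>l\<in>{Suc i..<Suc m}. s l) = (\<Sum>l\<in>{Suc i..<Suc m}. e l)"
  using pos_diff[of "Suc i" "Suc m" s] pos_diff[of "Suc i" "Suc m" e] assms by (auto simp: off_def)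

text \<open>The step \<open>j\<close> enters the position at every index from \<open>j\<close> on.
  Changing it shifts all these offsets equally and leaves coincidences among them untouched.\<close>

lemma off_eq_cong:
  assumes "j \<le> i" "i \<le> m" "\<And>l. l \<noteq> j \<Longrightarrow> s l = s' l"
  shows "off s e m = off s e i \<longleftrightarrow> off s' e m = off s' e i"
proof -
  have "(\<Sum>l\<in>{Suc i..<Suc m}. s l) = (\<Sum>l\<in>{Suc i..<Suc m}. s' l)"
    using assms by (intro sum.cong) auto
  then show ?thesis using assms by (simp add: off_eq_iff)
qed

text \<open>If neither configuration is affected, the lists up to \<open>j\<close> contribute
  nothing at \<open>n\<close>. A particle from a later list that is present at \<open>n\<close> has
  no coincidence before \<open>j\<close> in either configuration, and those from \<open>j\<close> on
  are unchanged; so its freshness is the same in both.\<close>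

lemma occ_resample:
  assumes j: "j \<le> n" and s: "\<And>l. l \<noteq> j \<Longrightarrow> s l = s' l" and L: "\<And>l. l \<noteq> j \<Longrightarrow> L l = L' l"
    and b: "\<not> affected_by j n s L" "\<not> affected_by j n s' L'"
  shows "occ s L n = occ s' L' n"
  unfolding occ_def
proof (rule sum.cong)
  fix m assume "m \<in> {..n}"
  then have m: "m \<le> n" by simp
  show "length (filter (\<lambda>e. fresh s e m \<and> off s e n = off s e m) (L m))
    = length (filter (\<lambda>e. fresh s' e m \<and> off s' e n = off s' e m) (L' m))"
  proof (cases "m \<le> j")
    case True
    then have "filter (\<lambda>e. fresh s e m \<and> off s e n = off s e m) (L m) = []"
      "filter (\<lambda>e. fresh s' e m \<and> off s' e n = off s' e m) (L' m) = []"
      using b by (auto simp: affected_by_def filter_empty_conv)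
    then show ?thesis by simp
  next
    case False
    then have Lm: "L m = L' m" using L[of m] by simp
    have "filter (\<lambda>e. fresh s e m \<and> off s e n = off s e m) (L m) = filter (\<lambda>e. fresh s' e m \<and> off s' e n = off s' e m) (L m)"
    proof (rule filter_cong[OF refl])
      fix e assume e: "e \<in> set (L m)"
      have hit: "off s e n = off s e m \<longleftrightarrow> off s' e n = off s' e m"
        using False m by (intro off_eq_cong[of j] s) auto
      have "fresh s e m \<longleftrightarrow> fresh s' e m" if h: "off s e n = off s e m"
      proof -
        have lt: "off s e i \<noteq> off s e m \<and> off s' e i \<noteq> off s' e m" if "i < j" for i
          using b e Lm h hit that False m unfolding affected_by_def by (metis greaterThanAtMost_iff not_le)
        have ge: "off s e m = off s e i \<longleftrightarrow> off s' e m = off s' e i" if "j \<le> i" "i < m" for i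
          using that by (intro off_eq_cong[of j] s) auto
        show ?thesis unfolding fresh_def using lt ge by (metis not_le)
      qed
      then show "(fresh s e m \<and> off s e n = off s e m) = (fresh s' e m \<and> off s' e n = off s' e m)"
        using hit by auto
    qed
    then show ?thesis using Lm by simp
  qed
qed simp

text \<open>A union bound over lists and indices. The second family repeats the same geometric sum
  for each list between \<open>j\<close> and \<open>n\<close>, which accounts for the linear
  factor.\<close>

lemma affected_by_prob:
  assumes lam: "lam \<ge> 0" and jn: "j \<le> n" "n < N" and r: "0 < \<rho>" "\<rho> < 1" "\<And>t. overlap_mean p 1 t \<le> \<rho> ^ t"
  shows "mean (pair_pmf (paths p N) (clouds lam N)) (\<lambda>z. of_bool (affected_by j n (fst z) (snd z)))
    \<le> lam / (1 - \<rho>) * (1 + real (n - j)) * \<rho> ^ (n - j)"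
proof -
  let ?P = "pair_pmf (paths p N) (clouds lam N)"
  let ?h = "\<lambda>m i z. of_bool (\<exists>e\<in>set (snd z m). off (fst z) e n = off (fst z) e i) :: real"
  have hp: "mean ?P (?h m i) \<le> lam * \<rho> ^ (n - i)" if "m < N" "i \<le> n" for m i
    using hit_prob[OF lam that jn(2), of p] mult_left_mono[OF r(3)[of "n - i"] lam] by linarith
  have geo: "(\<Sum>i\<le>j. \<rho> ^ (n - i)) \<le> \<rho> ^ (n - j) / (1 - \<rho>)"
  proof -
    have "(\<Sum>i\<le>j. \<rho> ^ (n - i)) = (\<Sum>k\<in>{n - j..<Suc n}. \<rho> ^ (k - 0))"
      by (intro sum.reindex_bij_witness[of _ "\<lambda>k. n - k" "\<lambda>k. n - k"]) (use jn in auto)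
    also have "\<dots> \<le> \<rho> ^ (n - j - 0) / (1 - \<rho>)" using r by (intro geometric_tail_le) auto
    finally show ?thesis by simp
  qed
  have geo': "(\<Sum>i<j. \<rho> ^ (n - i)) \<le> \<rho> ^ (n - j) / (1 - \<rho>)"
    using r by (intro order_trans[OF sum_mono2 geo]) auto
  have I: "integrable (measure_pmf ?P) (?h m i)" for m i by (rule integrable_of_bool)
  have "mean ?P (\<lambda>z. of_bool (affected_by j n (fst z) (snd z)))
     \<le> mean ?P (\<lambda>z. (\<Sum>m\<le>j. ?h m m z) + (\<Sum>m\<in>{j<..n}. \<Sum>i<j. ?h m i z))"
  proof (intro integral_mono integrable_of_bool Bochner_Integration.integrable_add Bochner_Integration.integrable_sum I)
    fix z
    have nn: "0 \<le> (\<Sum>m\<le>j. ?h m m z)" "0 \<le> (\<Sum>m\<in>{j<..n}. \<Sum>i<j. ?h m i z)" by (auto intro!: sum_nonneg)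
    show "of_bool (affected_by j n (fst z) (snd z)) \<le> (\<Sum>m\<le>j. ?h m m z) + (\<Sum>m\<in>{j<..n}. \<Sum>i<j. ?h m i z)"
    proof (cases "affected_by j n (fst z) (snd z)")
      case True
      then consider m where "m \<le> j" "\<exists>e\<in>set (snd z m). off (fst z) e n = off (fst z) e m"
        | m i where "m \<in> {j<..n}" "i < j" "\<exists>e\<in>set (snd z m). off (fst z) e n = off (fst z) e i"
        unfolding affected_by_def by blast
      then show ?thesis
      proof cases
        case 1
        then have "1 \<le> ?h m m z" by simp
        also have "\<dots> \<le> (\<Sum>m\<le>j. ?h m m z)" using 1 by (intro member_le_sum) auto
        finally show ?thesis using nn True by simp
      next
        case 2
        then have "1 \<le> ?h m i z" by simp
        also have "\<dots> \<le> (\<Sum>i<j. ?h m i z)" using 2 by (intro member_le_sum) auto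
        also have "\<dots> \<le> (\<Sum>m\<in>{j<..n}. \<Sum>i<j. ?h m i z)" 
          using 2 by (intro member_le_sum[where f="\<lambda>m. \<Sum>i<j. ?h m i z"]) (auto intro!: sum_nonneg)
        finally show ?thesis using nn True by simp
      qed
    qed (use nn in simp)
  qed
  also have "\<dots> = (\<Sum>m\<le>j. mean ?P (?h m m)) + (\<Sum>m\<in>{j<..n}. \<Sum>i<j. mean ?P (?h m i))"
    using I by (simp del: sum_of_bool_eq)
  also have "\<dots> \<le> (\<Sum>m\<le>j. lam * \<rho> ^ (n - m)) + (\<Sum>m\<in>{j<..n}. \<Sum>i<j. lam * \<rho> ^ (n - i))"
    using jn by (intro add_mono sum_mono hp) auto
  also have "\<dots> = lam * (\<Sum>m\<le>j. \<rho> ^ (n - m)) + real (n - j) * (lam * (\<Sum>i<j. \<rho> ^ (n - i)))"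
    by (simp add: sum_distrib_left)
  also have "\<dots> \<le> lam * (\<rho> ^ (n - j) / (1 - \<rho>)) + real (n - j) * (lam * (\<rho> ^ (n - j) / (1 - \<rho>)))"
    using lam by (intro add_mono mult_left_mono geo geo') auto
  also have "\<dots> = lam / (1 - \<rho>) * (1 + real (n - j)) * \<rho> ^ (n - j)" by (simp add: algebra_simps)
  finally show ?thesis .
qed

section \<open>Walker steps and clouds as one sequence of independent blocks\<close>

definition block :: "real \<Rightarrow> real \<Rightarrow> nat \<Rightarrow> (int \<times> (nat \<Rightarrow> int) list) pmf" where
  "block p lam N = pair_pmf (nn_step_pmf p) (cloud lam (paths (1/2) N))"

definition blocks :: "real \<Rightarrow> real \<Rightarrow> nat \<Rightarrow> (nat \<Rightarrow> int \<times> (nat \<Rightarrow> int) list) pmf" where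
  "blocks p lam N = Pi_pmf {..<N} (0, []) (\<lambda>_. block p lam N)"

definition occ_blocks :: "(nat \<Rightarrow> int \<times> (nat \<Rightarrow> int) list) \<Rightarrow> nat \<Rightarrow> nat" where
  "occ_blocks x n = occ (fst (unzip_fun x)) (snd (unzip_fun x)) n"

lemma map_unzip_blocks: "map_pmf unzip_fun (blocks p lam N) = pair_pmf (paths p N) (clouds lam N)"
  unfolding blocks_def block_def paths_def clouds_def by (rule map_unzip_fun) simp

lemma mean_blocks: "mean (blocks p lam N) (\<lambda>x. F (unzip_fun x)) = mean (pair_pmf (paths p N) (clouds lam N)) F"
  unfolding map_unzip_blocks[symmetric] by simp

lemma occ_blocks_law:
  assumes "lam \<ge> 0" "n < N" shows "map_pmf (\<lambda>x. occ_blocks x n) (blocks p lam N) = poi lam"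
proof -
  have "map_pmf (\<lambda>x. occ_blocks x n) (blocks p lam N) = map_pmf (\<lambda>z. occ (fst z) (snd z) n) (pair_pmf (paths p N) (clouds lam N))"
    unfolding map_unzip_blocks[symmetric] by (simp add: pmf.map_comp o_def occ_blocks_def)
  also have "\<dots> = bind_pmf (paths p N) (\<lambda>s. map_pmf (\<lambda>L. occ s L n) (clouds lam N))"
    by (simp add: pair_pmf_def map_pmf_def bind_assoc_pmf bind_return_pmf)
  also have "\<dots> = bind_pmf (paths p N) (\<lambda>s. poi lam)"
    using assms by (intro bind_pmf_cong refl occ_marginal pos_bound)
  finally show ?thesis by simp
qed

lemma occ_causal:
  assumes "\<And>i. i \<le> n \<Longrightarrow> s i = s' i" "\<And>i. i \<le> n \<Longrightarrow> L i = L' i"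
  shows "occ s L n = occ s' L' n"
proof -
  have o: "off s e i = off s' e i" if "i \<le> n" for e i
    using assms(1) that by (auto simp: off_def pos_def intro!: sum.cong)
  have f: "fresh s e m = fresh s' e m" if "m \<le> n" for e m
    unfolding fresh_def using that o by auto
  show ?thesis unfolding occ_def
    by (intro sum.cong refl arg_cong[where f=length] filter_cong) (use assms(2) o f in auto)
qed

lemma linear_times_geometric: assumes "0 \<le> x" "x < (1::real)" shows "(1 + real t) * x ^ t \<le> 1 / (1 - x)"
proof -
  have "(1 + real t) * x ^ t = (\<Sum>i<Suc t. x ^ t)" by simp
  also have "\<dots> \<le> (\<Sum>i<Suc t. x ^ i)" using assms by (intro sum_mono power_decreasing) auto
  also have "\<dots> \<le> (\<Sum>i. x ^ i)" using assms by (intro sum_le_suminf summable_geometric) auto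
  also have "\<dots> = 1 / (1 - x)" using assms by (intro suminf_geometric) auto
  finally show ?thesis .
qed

lemma L4_occ: assumes "lam \<ge> 0" "n < N" "exp_growth g" shows "L4 (blocks p lam N) (\<lambda>x. g (occ_blocks x n))"
proof -
  have "L4 (map_pmf (\<lambda>x. occ_blocks x n) (blocks p lam N)) g"
    unfolding occ_blocks_law[OF assms(1,2)] L4_def by (intro integrable_poi exp_growth_pow assms)
  then show ?thesis by (simp add: L4_map)
qed

text \<open>The difference vanishes unless one of the two configurations is affected, so Young's
  inequality weighs its eighth power against an indicator. Of the sixteen powers of \<theta> per
  unit of time, eight absorb the linear factor of the union bound, four pay for the division by the
  weight, and four remain.\<close>

lemma occ_influence:
  assumes lam: "lam \<ge> 0" and jn: "j \<le> n" "n < N" and r: "0 < \<theta>" "\<theta> < 1" "\<And>t. overlap_mean p 1 t \<le> (\<theta> ^ 16) ^ t"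
    and g: "exp_growth g"
  shows "mean (pair_pmf (blocks p lam N) (blocks p lam N)) (\<lambda>\<omega>. (g (occ_blocks (fst \<omega>) n) - g (occ_blocks (mix {j} \<omega>) n)) ^ 4)
    \<le> (128 * mean (poi lam) (\<lambda>k. g k ^ 8) + lam / (1 - \<theta> ^ 16) / (1 - \<theta> ^ 8)) * \<theta> ^ (4 * (n - j))"
proof -
  let ?R = "blocks p lam N"
  let ?PP = "pair_pmf ?R ?R"
  let ?t = "n - j"
  let ?w = "\<theta> ^ (4 * ?t)"
  let ?X = "\<lambda>\<omega>. g (occ_blocks (fst \<omega>) n) - g (occ_blocks (mix {j} \<omega>) n)"
  let ?affected_by = "\<lambda>x. affected_by j n (fst (unzip_fun x)) (snd (unzip_fun x))"
  let ?m8 = "mean (poi lam) (\<lambda>k. g k ^ 8)"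
  have w0: "?w > 0" using r by simp
  have mixlaw: "map_pmf (mix A) ?PP = ?R" for A unfolding blocks_def by (rule map_mix) simp
  have fstlaw: "map_pmf fst ?PP = ?R" by (rule map_fst_pair_pmf)
  have mean_mix: "mean ?PP (\<lambda>\<omega>. F (mix A \<omega>)) = mean ?R F" for A F
    using integral_map_pmf[of "mix A" ?PP F] by (simp add: mixlaw)
  have mean_fst: "mean ?PP (\<lambda>\<omega>. F (fst \<omega>)) = mean ?R F" for F
    using integral_map_pmf[of fst ?PP F] by (simp add: fstlaw)
  have I8: "integrable (measure_pmf (poi lam)) (\<lambda>k. g k ^ 8)" by (intro integrable_poi exp_growth_pow g lam)
  have I8R: "integrable (measure_pmf ?R) (\<lambda>x. g (occ_blocks x n) ^ 8)"
    using I8 by (simp flip: occ_blocks_law[OF lam jn(2), of p])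
  have E8R: "mean ?R (\<lambda>x. g (occ_blocks x n) ^ 8) = ?m8"
    by (simp flip: occ_blocks_law[OF lam jn(2), of p])
  have I8': "integrable (measure_pmf ?PP) (\<lambda>\<omega>. g (occ_blocks (mix {j} \<omega>) n) ^ 8)"
    "integrable (measure_pmf ?PP) (\<lambda>\<omega>. g (occ_blocks (fst \<omega>) n) ^ 8)"
    using I8R integrable_map_pmf_eq[of "mix {j}" ?PP "\<lambda>x. g (occ_blocks x n) ^ 8"]
      integrable_map_pmf_eq[of fst ?PP "\<lambda>x. g (occ_blocks x n) ^ 8"]
    by (simp_all add: mixlaw fstlaw)
  have agree: "occ_blocks (fst \<omega>) n = occ_blocks (mix {j} \<omega>) n" if "\<not> ?affected_by (fst \<omega>)" "\<not> ?affected_by (mix {j} \<omega>)" for \<omega>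
    unfolding occ_blocks_def using that by (intro occ_resample[OF jn(1)]) (auto simp: unzip_fun_def mix_def)
  have pt: "?X \<omega> ^ 4 \<le> 1/2 * (?w * (128 * (g (occ_blocks (fst \<omega>) n) ^ 8 + g (occ_blocks (mix {j} \<omega>) n) ^ 8)))
      + 1/2 * ((of_bool (?affected_by (fst \<omega>)) + of_bool (?affected_by (mix {j} \<omega>))) / ?w)" for \<omega>
  proof (cases "?X \<omega> = 0")
    case True
    then show ?thesis using w0 by simp
  next
    case False
    let ?a = "g (occ_blocks (fst \<omega>) n)" and ?b = "g (occ_blocks (mix {j} \<omega>) n)"
    have "y \<le> 1/2 * (w * y\<^sup>2) + 1/2 * (1 / w)" if "w > 0" for w y :: real
    proof -
      have "1/2 * (w * y\<^sup>2) + 1/2 * (1 / w) - y = (w * y - 1)\<^sup>2 / (2 * w)"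
        using that by (simp add: field_simps power2_eq_square)
      also have "\<dots> \<ge> 0" using that by simp
      finally show ?thesis by simp
    qed
    from this[OF w0, of "?X \<omega> ^ 4"] have "?X \<omega> ^ 4 \<le> 1/2 * (?w * ?X \<omega> ^ 8) + 1/2 * (1 / ?w)"
      by (simp flip: power_mult)
    also have "\<dots> \<le> 1/2 * (?w * (128 * (?a ^ 8 + ?b ^ 8))) + 1/2 * ((of_bool (?affected_by (fst \<omega>)) + of_bool (?affected_by (mix {j} \<omega>))) / ?w)"
    proof (intro add_mono mult_left_mono divide_right_mono)
      have "(?a - ?b) ^ 8 = ((?a + - ?b) ^ 4)\<^sup>2" by (simp flip: power_mult)
      also have "\<dots> \<le> (8 * (?a ^ 4 + (- ?b) ^ 4))\<^sup>2" by (intro power_mono pow4_add_le) auto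
      also have "\<dots> = 64 * (?a ^ 4 + ?b ^ 4)\<^sup>2" by (simp only: power_mult_distrib) simp
      also have "\<dots> \<le> 64 * (2 * ((?a ^ 4)\<^sup>2 + (?b ^ 4)\<^sup>2))"
        using sum_squares_bound[of "?a ^ 4" "?b ^ 4"] by (simp add: power2_sum)
      finally show "?X \<omega> ^ 8 \<le> 128 * (?a ^ 8 + ?b ^ 8)" by (simp flip: power_mult)
      have "?affected_by (fst \<omega>) \<or> ?affected_by (mix {j} \<omega>)" using agree[of \<omega>] False by (metis diff_self)
      then show "1 \<le> (of_bool (?affected_by (fst \<omega>)) + of_bool (?affected_by (mix {j} \<omega>)) :: real)" by auto
    qed (use w0 in auto)
    finally show ?thesis .
  qed
  have badp: "mean ?R (\<lambda>x. of_bool (?affected_by x)) \<le> lam / (1 - \<theta> ^ 16) * (1 + real ?t) * (\<theta> ^ 16) ^ ?t"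
    using affected_by_prob[OF lam jn, of "\<theta> ^ 16" p] r mean_blocks[of p lam N "\<lambda>z. of_bool (affected_by j n (fst z) (snd z))"]
    by (simp add: power_less_one_iff)
  have "(1 + real ?t) * (\<theta> ^ 16) ^ ?t \<le> ?w * ?w / (1 - \<theta> ^ 8)"
  proof -
    have "(1 + real ?t) * (\<theta> ^ 16) ^ ?t = ((1 + real ?t) * (\<theta> ^ 8) ^ ?t) * (?w * ?w)"
    proof -
      have "(\<theta> ^ 16) ^ t = (\<theta> ^ 8) ^ t * (\<theta> ^ (4 * t) * \<theta> ^ (4 * t))" for t
        by (simp flip: power_mult power_add)
      then show ?thesis by (simp only: mult.assoc)
    qed
    also have "\<dots> \<le> 1 / (1 - \<theta> ^ 8) * (?w * ?w)"
      using r by (intro mult_right_mono linear_times_geometric) (auto simp: power_less_one_iff)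
    finally show ?thesis by simp
  qed
  then have "lam / (1 - \<theta> ^ 16) * ((1 + real ?t) * (\<theta> ^ 16) ^ ?t) \<le> lam / (1 - \<theta> ^ 16) * (?w * ?w / (1 - \<theta> ^ 8))"
    using r lam by (intro mult_left_mono) (auto simp: power_le_one)
  with badp have badw: "mean ?R (\<lambda>x. of_bool (?affected_by x)) \<le> lam / (1 - \<theta> ^ 16) * (?w * ?w / (1 - \<theta> ^ 8))"
    by (simp only: mult.assoc order_trans)
  have IX: "integrable (measure_pmf ?PP) (\<lambda>\<omega>. ?X \<omega> ^ 4)"
  proof -
    have "L4 (map_pmf fst ?PP) (\<lambda>x. g (occ_blocks x n))" "L4 (map_pmf (mix {j}) ?PP) (\<lambda>x. g (occ_blocks x n))"
      unfolding mixlaw fstlaw by (intro L4_occ lam jn g)+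
    then have "L4 ?PP ?X" by (intro L4_diff) (simp_all add: L4_map)
    then show ?thesis by (simp add: L4_def)
  qed
  have "mean ?PP (\<lambda>\<omega>. ?X \<omega> ^ 4) \<le> mean ?PP (\<lambda>\<omega>. 1/2 * (?w * (128 * (g (occ_blocks (fst \<omega>) n) ^ 8 + g (occ_blocks (mix {j} \<omega>) n) ^ 8)))
      + 1/2 * ((of_bool (?affected_by (fst \<omega>)) + of_bool (?affected_by (mix {j} \<omega>))) / ?w))"
    by (intro integral_mono IX pt Bochner_Integration.integrable_add integrable_mult_right
        integrable_divide integrable_of_bool I8')
  also have "\<dots> = 1/2 * (?w * (128 * (?m8 + ?m8))) + 1/2 * ((mean ?R (\<lambda>x. of_bool (?affected_by x)) + mean ?R (\<lambda>x. of_bool (?affected_by x))) / ?w)"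
    using I8' mean_mix[of "\<lambda>x. of_bool (?affected_by x)" "{j}"] mean_fst[of "\<lambda>x. of_bool (?affected_by x)"]
      mean_mix[of "\<lambda>x. g (occ_blocks x n) ^ 8" "{j}"] mean_fst[of "\<lambda>x. g (occ_blocks x n) ^ 8"]
    by (simp add: integrable_of_bool E8R)
  also have "\<dots> = ?w * (128 * ?m8) + mean ?R (\<lambda>x. of_bool (?affected_by x)) / ?w" by (simp add: field_simps)
  also have "\<dots> \<le> ?w * (128 * ?m8) + lam / (1 - \<theta> ^ 16) * (?w * ?w / (1 - \<theta> ^ 8)) / ?w"
    using w0 by (intro add_left_mono divide_right_mono badw) auto
  also have "\<dots> = (128 * ?m8 + lam / (1 - \<theta> ^ 16) / (1 - \<theta> ^ 8)) * ?w"
  proof -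
    have "w * (128 * m) + c * (w * w / d) / w = (128 * m + c / d) * w" if "w > 0" for w m c d :: real
    proof -
      have "c * (w * w / d) / w = c / d * w" using that by simp
      then show ?thesis unfolding distrib_right by (simp only: mult.commute)
    qed
    then show ?thesis using w0 .
  qed
  finally show ?thesis .
qed

lemma occ_causal_functional:
  assumes lam: "lam \<ge> 0" and r: "0 < \<theta>" "\<theta> < 1" "\<And>t. overlap_mean p 1 t \<le> (\<theta> ^ 16) ^ t" and g: "exp_growth g"
  shows "causal_functional N (0, []) (block p lam N) (\<lambda>n x. g (occ_blocks x n))
    (128 * mean (poi lam) (\<lambda>k. g k ^ 8) + lam / (1 - \<theta> ^ 16) / (1 - \<theta> ^ 8)) \<theta>"
proof
  show "g (occ_blocks x n) = g (occ_blocks y n)" if "\<And>i. i \<le> n \<Longrightarrow> x i = y i" for n x y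
    unfolding occ_blocks_def using that by (intro arg_cong[where f=g] occ_causal) (auto simp: unzip_fun_def)
qed (use r L4_occ[OF lam _ g, of _ N p] occ_influence[OF lam _ _ r g, of _ _ N] in \<open>auto simp: blocks_def\<close>)

subsection \<open>Measurability and independence in the model\<close>

lemma measurable_count_space_compose2:
  fixes f :: "'a \<Rightarrow> 'b::countable" and g :: "'a \<Rightarrow> 'c::countable"
  assumes "f \<in> measurable M (count_space UNIV)" "g \<in> measurable M (count_space UNIV)"
  shows "(\<lambda>x. h (f x) (g x)) \<in> measurable M (count_space UNIV)"
proof (rule measurable_compose_countable[OF _ assms(1)])
  show "(\<lambda>x. h i (g x)) \<in> measurable M (count_space UNIV)" for i
    using measurable_compose[OF assms(2), of "h i" "count_space UNIV"] by simp
qed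

lemma measurable_count_space_sum:
  fixes f :: "'i \<Rightarrow> 'a \<Rightarrow> 'b::{countable, comm_monoid_add}"
  assumes "\<And>i. i \<in> I \<Longrightarrow> f i \<in> measurable M (count_space UNIV)"
  shows "(\<lambda>x. \<Sum>i\<in>I. f i x) \<in> measurable M (count_space UNIV)"
  using assms
proof (induction I rule: infinite_finite_induct)
  case (insert i I)
  then show ?case using measurable_count_space_compose2[of "f i" M "\<lambda>x. \<Sum>i\<in>I. f i x" "(+)"] by simp
qed auto

text \<open>In a discrete space the net of finite sums is eventually constant, and any further
  nonzero term would change it.\<close>

lemma summable_on_nat_finite_support:
  fixes g :: "'i \<Rightarrow> nat"
  assumes "g summable_on UNIV" shows "finite {y. g y \<noteq> 0}"
proof -
  from assms obtain l where "(g has_sum l) UNIV" unfolding summable_on_def by blast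
  then have "(sum g \<longlongrightarrow> l) (finite_subsets_at_top UNIV)" unfolding has_sum_def .
  then have "eventually (\<lambda>A. sum g A = l) (finite_subsets_at_top UNIV)"
    by (simp add: tendsto_discrete)
  then obtain A where A: "finite A" "\<And>B. finite B \<Longrightarrow> A \<subseteq> B \<Longrightarrow> sum g B = l"
    unfolding eventually_finite_subsets_at_top by auto
  have "{y. g y \<noteq> 0} \<subseteq> A"
  proof
    fix y assume y: "y \<in> {y. g y \<noteq> 0}"
    show "y \<in> A"
    proof (rule ccontr)
      assume "y \<notin> A"
      then have "sum g (insert y A) = g y + sum g A" using A by simp
      then show False using A(2)[of "insert y A"] A(2)[of A] A(1) y by auto
    qed
  qed
  then show ?thesis using A(1) finite_subset by blast
qed

lemma infsum_nat_finite_support: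
  fixes g :: "'i \<Rightarrow> nat"
  assumes "finite A" "\<And>y. y \<notin> A \<Longrightarrow> g y = 0" shows "infsum g UNIV = sum g A"
proof -
  have "infsum g UNIV = infsum g A" using assms by (intro infsum_cong_neutral) auto
  then show ?thesis using assms by simp
qed

text \<open>With bounded support the sum is finite over the smallest window containing the support,
  a measurable choice among countably many.\<close>

lemma measurable_infsum_nat:
  fixes g :: "int \<Rightarrow> 'a \<Rightarrow> nat"
  assumes g [measurable]: "\<And>y. g y \<in> measurable M (count_space UNIV)"
  shows "(\<lambda>\<omega>. infsum (\<lambda>y. g y \<omega>) UNIV) \<in> measurable M (count_space UNIV)"
proof -
  define P where "P R \<omega> \<longleftrightarrow> (\<forall>y::int. int R < \<bar>y\<bar> \<longrightarrow> g y \<omega> = 0)" for R \<omega>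
  have P [measurable]: "Measurable.pred M (P R)" for R unfolding P_def by measurable
  define h where "h R \<omega> = (\<Sum>y\<in>{- int R..int R}. g y \<omega>)" for R \<omega>
  have h: "h R \<in> measurable M (count_space UNIV)" for R
    unfolding h_def by (intro measurable_count_space_sum g)
  have eq: "infsum (\<lambda>y. g y \<omega>) UNIV = (if \<exists>R. P R \<omega> then h (LEAST R. P R \<omega>) \<omega> else 0)" for \<omega>
  proof (cases "\<exists>R. P R \<omega>")
    case True
    define R0 where "R0 = (LEAST R. P R \<omega>)"
    have "P R0 \<omega>" unfolding R0_def using True by (rule LeastI_ex)
    then have "infsum (\<lambda>y. g y \<omega>) UNIV = h R0 \<omega>"
      unfolding h_def by (intro infsum_nat_finite_support) (auto simp: P_def)
    then show ?thesis using True by (simp add: R0_def)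
  next
    case False
    \<comment> \<open>Unbounded support means divergence, where \<open>infsum\<close> takes the
      value 0; the measurable formula must reproduce this default.\<close>
    have "\<not> (\<lambda>y. g y \<omega>) summable_on UNIV"
    proof
      assume "(\<lambda>y. g y \<omega>) summable_on UNIV"
      then have fin: "finite {y. g y \<omega> \<noteq> 0}" by (rule summable_on_nat_finite_support)
      have "P (nat (\<Sum>y\<in>{y. g y \<omega> \<noteq> 0}. \<bar>y\<bar>)) \<omega>"
        unfolding P_def
      proof (intro allI impI, rule ccontr)
        fix y assume y: "int (nat (\<Sum>y\<in>{y. g y \<omega> \<noteq> 0}. \<bar>y\<bar>)) < \<bar>y\<bar>" "g y \<omega> \<noteq> 0"
        have "\<bar>y\<bar> \<le> (\<Sum>y\<in>{y. g y \<omega> \<noteq> 0}. \<bar>y\<bar>)" using y fin by (intro member_le_sum) auto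
        then show False using y by simp
      qed
      then show False using False by blast
    qed
    then have "infsum (\<lambda>y. g y \<omega>) UNIV = 0" by (rule infsum_not_exists)
    then show ?thesis using False by simp
  qed
  have "(\<lambda>\<omega>. h (LEAST R. P R \<omega>) \<omega>) \<in> measurable M (count_space UNIV)"
    by (rule measurable_compose_countable[OF h]) measurable
  then show ?thesis unfolding eq by measurable
qed

lemma countable_PiE_dflt: "finite I \<Longrightarrow> countable (PiE_dflt I d (\<lambda>_. UNIV :: 'b::countable set))"
  by (subst dflt_image_PiE[symmetric]) (intro countable_image countable_PiE; simp)

text \<open>The fixed default off \<open>I\<close> confines the vector to a countable set of
  functions, so measurability for the full power set reduces to single points.\<close>

lemma measurable_finite_vector:
  fixes Z :: "'i \<Rightarrow> 'a \<Rightarrow> 'b::countable"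
  assumes fin: "finite I" and Z: "\<And>i. i \<in> I \<Longrightarrow> Z i \<in> measurable M (count_space UNIV)"
  shows "{\<omega>\<in>space M. \<forall>i\<in>I. Z i \<omega> = f i} \<in> sets M"
    and "(\<lambda>\<omega> i. if i \<in> I then Z i \<omega> else d) \<in> measurable M (count_space UNIV)"
proof -
  let ?V = "\<lambda>\<omega> i. if i \<in> I then Z i \<omega> else d"
  let ?C = "PiE_dflt I d (\<lambda>_. UNIV :: 'b set)"
  have V: "?V \<omega> \<in> ?C" for \<omega> by (auto simp: PiE_dflt_def)
  have pt: "{\<omega>\<in>space M. ?V \<omega> = f} = (if f \<in> ?C then {\<omega>\<in>space M. \<forall>i\<in>I. Z i \<omega> = f i} else {})" for f
    using V by (auto simp: PiE_dflt_def fun_eq_iff)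
  show ptm: "{\<omega>\<in>space M. \<forall>i\<in>I. Z i \<omega> = f i} \<in> sets M" for f
  proof -
    have "{\<omega>\<in>space M. Z i \<omega> = f i} \<in> sets M" if "i \<in> I" for i
      using measurable_sets[OF Z[OF that], of "{f i}"] by (auto simp: vimage_def Int_def conj_commute)
    then show ?thesis using fin by (intro sets.sets_Collect_finite_All) auto
  qed
  show meas: "?V \<in> measurable M (count_space UNIV)"
  proof (rule measurableI)
    fix A :: "('i \<Rightarrow> 'b) set"
    have "?V -` A \<inter> space M = (\<Union>f\<in>A \<inter> ?C. {\<omega>\<in>space M. ?V \<omega> = f})" using V by auto
    also have "\<dots> \<in> sets M" unfolding pt using countable_PiE_dflt[OF fin] ptm by (intro sets.countable_UN') auto
    finally show "?V -` A \<inter> space M \<in> sets M" .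
  qed simp
qed

text \<open>The passage from independence on an abstract space to a discrete product law: both laws
  sit on the same countable set and agree on points.\<close>

lemma (in prob_space) joint_law_Pi_pmf:
  fixes Z :: "'i \<Rightarrow> 'a \<Rightarrow> 'b::countable"
  assumes fin: "finite I" and ind: "indep_vars (\<lambda>_. count_space UNIV) Z I"
    and law: "\<And>i. i \<in> I \<Longrightarrow> distr M (count_space UNIV) (Z i) = measure_pmf (q i)"
  shows "distr M (count_space UNIV) (\<lambda>\<omega> i. if i \<in> I then Z i \<omega> else d) = measure_pmf (Pi_pmf I d q)"
proof -
  let ?V = "\<lambda>\<omega> i. if i \<in> I then Z i \<omega> else d"
  let ?C = "PiE_dflt I d (\<lambda>_. UNIV :: 'b set)"
  note C = countable_PiE_dflt[OF fin, of d]
  have Z: "Z i \<in> measurable M (count_space UNIV)" if "i \<in> I" for i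
    using ind that by (auto simp: indep_vars_def2)
  have V: "?V \<omega> \<in> ?C" for \<omega> by (auto simp: PiE_dflt_def)
  have pt: "{\<omega>\<in>space M. ?V \<omega> = f} = (if f \<in> ?C then {\<omega>\<in>space M. \<forall>i\<in>I. Z i \<omega> = f i} else {})" for f
    using V by (auto simp: PiE_dflt_def fun_eq_iff)
  note meas = measurable_finite_vector(2)[where d=d, OF fin Z]
  show "distr M (count_space UNIV) ?V = measure_pmf (Pi_pmf I d q)"
  proof (rule measure_eqI_countable_AE[of _ _ ?C])
    show "AE x in distr M (count_space UNIV) ?V. x \<in> ?C"
      using meas V by (subst AE_distr_iff) auto
    show "AE x in measure_pmf (Pi_pmf I d q). x \<in> ?C"
      using set_Pi_pmf_subset'[OF fin, of d q] by (auto simp: AE_measure_pmf_iff PiE_dflt_def)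
    fix f assume f: "f \<in> ?C"
    have "emeasure (distr M (count_space UNIV) ?V) {f} = emeasure M {\<omega>\<in>space M. \<forall>i\<in>I. Z i \<omega> = f i}"
      using meas f pt[of f] by (subst emeasure_distr) (auto simp: vimage_def Int_def conj_commute)
    also have "\<dots> = ennreal (prob {\<omega>\<in>space M. \<forall>i\<in>I. Z i \<omega> = f i})" by (simp add: emeasure_eq_measure)
    also have "prob {\<omega>\<in>space M. \<forall>i\<in>I. Z i \<omega> = f i} = (\<Prod>i\<in>I. pmf (q i) (f i))"
    proof (cases "I = {}")
      case True then show ?thesis by (simp add: prob_space)
    next
      case False
      have "prob (\<Inter>i\<in>I. Z i -` {f i} \<inter> space M) = (\<Prod>i\<in>I. prob (Z i -` {f i} \<inter> space M))"
        using False fin by (intro indep_varsD_finite[OF ind]) auto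
      also have "(\<Inter>i\<in>I. Z i -` {f i} \<inter> space M) = {\<omega>\<in>space M. \<forall>i\<in>I. Z i \<omega> = f i}"
        using False by auto
      also have "(\<Prod>i\<in>I. prob (Z i -` {f i} \<inter> space M)) = (\<Prod>i\<in>I. pmf (q i) (f i))"
      proof (rule prod.cong[OF refl])
        fix i assume i: "i \<in> I"
        have "prob (Z i -` {f i} \<inter> space M) = measure (distr M (count_space UNIV) (Z i)) {f i}"
          by (subst measure_distr[OF Z[OF i]]) auto
        then show "prob (Z i -` {f i} \<inter> space M) = pmf (q i) (f i)" unfolding law[OF i] by (simp add: measure_pmf_single)
      qed
      finally show ?thesis .
    qed
    also have "\<dots> = pmf (Pi_pmf I d q) f" using f by (auto simp: pmf_Pi[OF fin] PiE_dflt_def)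
    finally show "emeasure (distr M (count_space UNIV) ?V) {f} = emeasure (measure_pmf (Pi_pmf I d q)) {f}"
      by (simp add: emeasure_pmf_single)
  qed (use C in auto)
qed

context walk_in_poisson_field
begin

lemma driver_measurable: "driver \<eta> X S i \<in> measurable M (count_space UNIV)"
  using independent by (auto simp: indep_vars_def2)

lemma particle_driver_law: "distr M (count_space UNIV) (driver \<eta> X S (Particle y i l)) = measure_pmf (nn_step_pmf (1/2))"
proof -
  have "driver \<eta> X S (Particle y i l) = (\<lambda>\<omega>. X y i (Suc l) \<omega> - X y i l \<omega>)" by (simp add: fun_eq_iff)
  then show ?thesis using particle_law[of y i l] by simp
qed

lemma walker_driver_law: "distr M (count_space UNIV) (driver \<eta> X S (Walker l)) = measure_pmf (nn_step_pmf \<pp>)"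
proof -
  have "driver \<eta> X S (Walker l) = (\<lambda>\<omega>. S (Suc l) \<omega> - S l \<omega>)" by (simp add: fun_eq_iff)
  then show ?thesis using walker_law[of l] by simp
qed

lemma \<eta>_measurable: "\<eta> y \<in> measurable M (count_space UNIV)"
proof -
  have "(\<lambda>\<omega>. nat (driver \<eta> X S (Initial y) \<omega>)) \<in> measurable M (count_space UNIV)"
    by (rule measurable_compose[OF driver_measurable]) simp
  then show ?thesis by simp
qed

lemma particle_pos: "\<omega> \<in> space M \<Longrightarrow> X y i n \<omega> = y + pos (\<lambda>l. driver \<eta> X S (Particle y i l) \<omega>) n"
  using particle_start[of \<omega> y i] by (induction n) (auto simp: pos_def)

lemma walker_pos: "\<omega> \<in> space M \<Longrightarrow> S n \<omega> = pos (\<lambda>l. driver \<eta> X S (Walker l) \<omega>) n"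
  using walker_start[of \<omega>] by (induction n) (auto simp: pos_def)

lemma pos_measurable:
  assumes "\<And>l. f l \<in> measurable N (count_space UNIV)"
  shows "(\<lambda>\<omega>. pos (\<lambda>l. f l \<omega>) n) \<in> measurable N (count_space UNIV)"
  unfolding pos_def by (intro measurable_count_space_sum assms)

lemma X_measurable: "X y i n \<in> measurable M (count_space UNIV)"
proof -
  have "(\<lambda>\<omega>. y + pos (\<lambda>l. driver \<eta> X S (Particle y i l) \<omega>) n) \<in> measurable M (count_space UNIV)"
    by (rule measurable_compose[OF pos_measurable[OF driver_measurable]]) simp
  then show ?thesis by (subst measurable_cong[OF particle_pos])
qed

lemma S_measurable: "S n \<in> measurable M (count_space UNIV)"
  using pos_measurable[OF driver_measurable, of Walker] by (subst measurable_cong[OF walker_pos])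

lemma site_count_measurable: "(\<lambda>\<omega>. \<Sum>i<\<eta> y \<omega>. of_bool (X y i n \<omega> = x) :: nat) \<in> measurable M (count_space UNIV)"
proof (rule measurable_compose_countable[OF _ \<eta>_measurable])
  fix k
  show "(\<lambda>\<omega>. \<Sum>i<k. of_bool (X y i n \<omega> = x) :: nat) \<in> measurable M (count_space UNIV)"
    by (intro measurable_count_space_sum measurable_compose[OF X_measurable]) simp
qed

lemma field_measurable: "field \<eta> X n x \<in> measurable M (count_space UNIV)"
  unfolding field_def[abs_def] by (intro measurable_infsum_nat site_count_measurable)

lemma field_at_walker_measurable: "(\<lambda>\<omega>. field \<eta> X n (S m \<omega>) \<omega>) \<in> measurable M (count_space UNIV)"
  by (rule measurable_compose_countable[OF field_measurable S_measurable])

lemma additive_functional_measurable: "additive_functional \<phi> \<eta> X S N \<in> borel_measurable M"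
proof -
  have "(\<lambda>\<omega>. \<phi> (real (field \<eta> X n (S n \<omega>) \<omega>))) \<in> borel_measurable M" for n
    by (rule measurable_compose[OF field_at_walker_measurable]) simp
  then show ?thesis unfolding additive_functional_def[abs_def] by (intro borel_measurable_sum)
qed

lemma AE_driver_bound: "AE \<omega> in M. \<forall>y i l. \<bar>driver \<eta> X S (Particle y i l) \<omega>\<bar> \<le> 1"
proof -
  have "AE \<omega> in M. \<bar>driver \<eta> X S (Particle y i l) \<omega>\<bar> \<le> 1" for y i l
  proof -
    have "AE z in distr M (count_space UNIV) (driver \<eta> X S (Particle y i l)). \<bar>z\<bar> \<le> 1"
      unfolding particle_driver_law using nn_step_bound by (auto simp: AE_measure_pmf_iff)
    then show ?thesis using driver_measurable[of "Particle y i l"] by (subst (asm) AE_distr_iff) auto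
  qed
  then show ?thesis by (simp add: AE_all_countable)
qed

lemma pos_le: assumes "\<And>l. \<bar>e l\<bar> \<le> 1" shows "\<bar>pos e n\<bar> \<le> int n"
proof -
  have "\<bar>pos e n\<bar> \<le> (\<Sum>l<n. \<bar>e l\<bar>)" unfolding pos_def by (rule sum_abs)
  also have "\<dots> \<le> (\<Sum>l<n. 1)" by (intro sum_mono assms)
  finally show ?thesis by simp
qed

text \<open>A nearest-neighbour particle within distance \<open>N\<close> of the origin at a time up
  to \<open>N\<close> started within \<open>2 * N\<close>. The step bound comes from the law of the
  steps and so holds only almost surely.\<close>

lemma AE_field_eq:
  "AE \<omega> in M. \<forall>n x. n \<le> N \<longrightarrow> \<bar>x\<bar> \<le> int N \<longrightarrow> field \<eta> X n x \<omega> = (\<Sum>y\<in>{-(2 * int N)..2 * int N}. \<Sum>i<\<eta> y \<omega>. of_bool (X y i n \<omega> = x))"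
  using AE_driver_bound AE_space
proof eventually_elim
  case (elim \<omega>)
  show ?case
  proof (intro allI impI)
    fix n x assume n: "n \<le> N" and x: "\<bar>x\<bar> \<le> int N"
    show "field \<eta> X n x \<omega> = (\<Sum>y\<in>{-(2 * int N)..2 * int N}. \<Sum>i<\<eta> y \<omega>. of_bool (X y i n \<omega> = x))"
      unfolding field_def
    proof (rule infsum_nat_finite_support)
      fix y assume y: "y \<notin> {-(2 * int N)..2 * int N}"
      have "X y i n \<omega> \<noteq> x" for i
        using particle_pos[OF elim(2), of y i n] pos_le[of "\<lambda>l. driver \<eta> X S (Particle y i l) \<omega>" n] elim(1) y n x by auto
      then show "(\<Sum>i<\<eta> y \<omega>. of_bool (X y i n \<omega> = x)) = (0::nat)" by simp
    qed simp
  qed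
qed

lemma independent_groups:
  assumes K: "disjoint_family_on K L"
    and \<Psi>: "\<And>j. j \<in> L \<Longrightarrow> \<Psi> j \<in> borel_measurable (PiM (K j) (\<lambda>_. count_space UNIV))"
  shows "indep_vars (\<lambda>_. borel) (\<lambda>j \<omega>. \<Psi> j (restrict (\<lambda>i. driver \<eta> X S i \<omega>) (K j)) :: real) L"
  using indep_vars_compose2[OF indep_vars_restrict[OF independent _ K] \<Psi>] by simp

lemma steps_law:
  assumes "inj c" and "\<And>l. distr M (count_space UNIV) (driver \<eta> X S (c l)) = measure_pmf (nn_step_pmf p)"
  shows "distr M (count_space UNIV) (\<lambda>\<omega> l. if l \<in> {..<N} then driver \<eta> X S (c l) \<omega> else 0) = measure_pmf (paths p N)"
proof -
  have "indep_vars (\<lambda>_. count_space UNIV) (\<lambda>l. driver \<eta> X S (c l)) {..<N}"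
    using indep_vars_compose2[OF indep_vars_restrict[OF independent, of "{..<N}" "\<lambda>l. {c l}"],
        of "\<lambda>l a. a (c l)" "\<lambda>_. count_space UNIV"] assms(1)
    by (simp add: disjoint_family_on_def inj_eq del: driver.simps)
  from joint_law_Pi_pmf[OF _ this, of "\<lambda>_. nn_step_pmf p" 0] show ?thesis
    using assms(2) unfolding paths_def by auto
qed

lemma particle_steps_law:
  "distr M (count_space UNIV) (\<lambda>\<omega> l. if l \<in> {..<N} then driver \<eta> X S (Particle y i l) \<omega> else 0) = measure_pmf (paths (1/2) N)"
  by (rule steps_law) (auto simp: inj_def particle_driver_law simp del: driver.simps)

lemma walker_steps_law:
  "distr M (count_space UNIV) (\<lambda>\<omega> l. if l \<in> {..<N} then driver \<eta> X S (Walker l) \<omega> else 0) = measure_pmf (paths \<pp> N)"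
  by (rule steps_law) (auto simp: inj_def walker_driver_law simp del: driver.simps)

end

subsection \<open>The joint law of the field along the walker\<close>

lemma prod_of_bool_lessThan: "(\<Prod>n<(N::nat). of_bool (P n) :: real) = of_bool (\<forall>n<N. P n)"
  by (induction N) (auto simp: less_Suc_eq)

lemma hits_bounds: assumes "\<And>n. 0 \<le> u n \<and> u n \<le> 1" shows "0 \<le> hits N u s y e" "hits N u s y e \<le> 1"
  unfolding hits_def using assms by (auto intro!: prod_nonneg prod_le_1 power_le_one)

lemma hits_cong: assumes "\<And>l. l < N \<Longrightarrow> e l = e' l" shows "hits N u s y e = hits N u s y e'"
proof -
  have "pos e (Suc n) = pos e' (Suc n)" if "n < N" for n
    unfolding pos_def using assms that by (intro sum.cong) auto
  then show ?thesis unfolding hits_def by (intro prod.cong) auto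
qed

lemma hits_measurable:
  assumes "\<And>l. f l \<in> measurable M (count_space UNIV)"
  shows "(\<lambda>\<omega>. hits N u s y (\<lambda>l. f l \<omega>)) \<in> borel_measurable M"
proof -
  have "(\<lambda>\<omega>. u n ^ of_bool (y + pos (\<lambda>l. f l \<omega>) (Suc n) = pos s (Suc n))) \<in> borel_measurable M" for n
  proof -
    have "(\<lambda>\<omega>. pos (\<lambda>l. f l \<omega>) (Suc n)) \<in> measurable M (count_space UNIV)"
      unfolding pos_def by (rule measurable_count_space_sum[OF assms])
    from measurable_compose[OF this, of "\<lambda>x. u n ^ of_bool (y + x = pos s (Suc n))" borel] show ?thesis by simp
  qed
  then show ?thesis unfolding hits_def by (intro borel_measurable_prod)
qed

lemma measurable_PiM_coordinate: "i \<in> I \<Longrightarrow> (\<lambda>a. a i) \<in> measurable (PiM I (\<lambda>_. count_space UNIV)) (count_space UNIV)"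
  by (rule measurable_component_singleton)

context walk_in_poisson_field
begin

text \<open>What the site \<open>y\<close> contributes to the generating function along
  \<open>s\<close>. It involves only the drivers belonging to \<open>y\<close>, so different sites
  give independent factors.\<close>

definition site_block :: "nat \<Rightarrow> (nat \<Rightarrow> real) \<Rightarrow> (nat \<Rightarrow> int) \<Rightarrow> int \<Rightarrow> 'a \<Rightarrow> real" where
  "site_block N u s y \<omega> = (\<Prod>i<\<eta> y \<omega>. hits N u s y (\<lambda>l. driver \<eta> X S (Particle y i l) \<omega>))"

lemma particle_hits_measurable: "(\<lambda>\<omega>. hits N u s y (\<lambda>l. driver \<eta> X S (Particle y i l) \<omega>)) \<in> borel_measurable M"
  by (intro hits_measurable driver_measurable)

lemma mean_particle_hits:
  "(LINT \<omega>|M. hits N u s y (\<lambda>l. driver \<eta> X S (Particle y i l) \<omega>)) = mean (paths (1/2) N) (hits N u s y)"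
proof -
  let ?V = "\<lambda>\<omega> l. if l \<in> {..<N} then driver \<eta> X S (Particle y i l) \<omega> else 0"
  have "(LINT \<omega>|M. hits N u s y (\<lambda>l. driver \<eta> X S (Particle y i l) \<omega>)) = (LINT \<omega>|M. hits N u s y (?V \<omega>))"
    by (intro Bochner_Integration.integral_cong refl hits_cong) auto
  also have "\<dots> = (LINT e|distr M (count_space UNIV) ?V. hits N u s y e)"
    by (rule integral_distr[symmetric, OF measurable_finite_vector(2)]) (auto intro: driver_measurable simp del: driver.simps)
  finally show ?thesis unfolding particle_steps_law .
qed

lemma prob_initial: assumes "lam > 0" shows "(LINT \<omega>|M. of_bool (\<eta> y \<omega> = k)) = pmf (poi lam) k"
proof -
  have "(LINT \<omega>|M. of_bool (\<eta> y \<omega> = k) :: real) = (LINT x|distr M (count_space UNIV) (\<eta> y). of_bool (x = k))"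
    by (rule integral_distr[symmetric, OF \<eta>_measurable]) simp
  also have "distr M (count_space UNIV) (\<eta> y) = measure_pmf (poi lam)"
    using initial_law[of y] assms by (simp add: poi_def)
  finally show ?thesis by (simp add: mean_indicator_pmf)
qed

text \<open>The number of factors in a site block is random, so independence is used on each event
  where it equals a fixed \<open>k\<close>. Here \<open>None\<close> indexes the initial number and
  \<open>Some i\<close> the steps of particle \<open>i\<close>.\<close>

lemma site_block_slice:
  assumes lam: "lam > 0" and u: "\<And>n. 0 \<le> u n \<and> u n \<le> 1"
  shows "(LINT \<omega>|M. of_bool (\<eta> y \<omega> = k) * (\<Prod>i<k. hits N u s y (\<lambda>l. driver \<eta> X S (Particle y i l) \<omega>)))
    = pmf (poi lam) k * mean (paths (1/2) N) (hits N u s y) ^ k"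
proof -
  let ?L = "insert None (Some ` {..<k})"
  let ?K = "\<lambda>j. case j of None \<Rightarrow> {Initial y} | Some i \<Rightarrow> range (Particle y i)"
  let ?\<Psi> = "\<lambda>j a. case j of None \<Rightarrow> of_bool (nat (a (Initial y)) = k) | Some i \<Rightarrow> hits N u s y (\<lambda>l. a (Particle y i l))"
  let ?F = "\<lambda>j \<omega>. ?\<Psi> j (restrict (\<lambda>i. driver \<eta> X S i \<omega>) (?K j))"
  have ind: "indep_vars (\<lambda>_. borel) ?F ?L"
  proof (rule independent_groups)
    show "disjoint_family_on ?K ?L" by (auto simp: disjoint_family_on_def split: option.splits)
    show "?\<Psi> j \<in> borel_measurable (PiM (?K j) (\<lambda>_. count_space UNIV))" for j
    proof (cases j)
      case None
      have "(\<lambda>a. of_bool (nat (a (Initial y)) = k) :: real) \<in> borel_measurable (PiM {Initial y} (\<lambda>_. count_space UNIV))"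
        by (rule measurable_compose[OF measurable_PiM_coordinate]) auto
      then show ?thesis using None by simp
    next
      case (Some i)
      then show ?thesis by (auto intro!: hits_measurable measurable_PiM_coordinate)
    qed
  qed
  have F: "?F None \<omega> = of_bool (\<eta> y \<omega> = k)" "?F (Some i) \<omega> = hits N u s y (\<lambda>l. driver \<eta> X S (Particle y i l) \<omega>)" for i \<omega>
    by (simp_all del: driver.simps(2))
  have int: "integrable M (?F j)" for j
  proof (rule integrable_const_bound[of _ 1])
    show "?F j \<in> borel_measurable M"
    proof (cases j)
      case None
      have "(\<lambda>\<omega>. of_bool (\<eta> y \<omega> = k) :: real) \<in> borel_measurable M"
        by (rule measurable_compose[OF \<eta>_measurable]) simp
      then show ?thesis unfolding None F .
    next
      case (Some i)
      show ?thesis unfolding Some F by (rule particle_hits_measurable)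
    qed
    show "AE \<omega> in M. norm (?F j \<omega>) \<le> 1" using hits_bounds[OF u] by (cases j) (auto simp del: driver.simps(2))
  qed
  have P: "(\<Prod>j\<in>?L. G j) = G None * (\<Prod>i<k. G (Some i))" for G :: "nat option \<Rightarrow> real"
    by (subst prod.insert) (auto simp: prod.reindex)
  have "(LINT \<omega>|M. (\<Prod>j\<in>?L. ?F j \<omega>)) = (\<Prod>j\<in>?L. LINT \<omega>|M. ?F j \<omega>)"
    by (rule indep_vars_lebesgue_integral[OF _ ind int]) simp
  then show ?thesis unfolding P F mean_particle_hits prob_initial[OF lam] by simp
qed

lemma site_block_bounds: assumes u: "\<And>n. 0 \<le> u n \<and> u n \<le> 1"
  shows "0 \<le> site_block N u s y \<omega>" "site_block N u s y \<omega> \<le> 1"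
  unfolding site_block_def using hits_bounds[OF u] by (auto intro!: prod_nonneg prod_le_1)

text \<open>Summing the slices gives the Poisson generating function evaluated at the mean factor of
  one particle.\<close>

lemma mean_site_block:
  assumes lam: "lam > 0" and u: "\<And>n. 0 \<le> u n \<and> u n \<le> 1"
  shows "(LINT \<omega>|M. site_block N u s y \<omega>) = exp (lam * (mean (paths (1/2) N) (hits N u s y) - 1))"
proof -
  let ?c = "mean (paths (1/2) N) (hits N u s y)"
  let ?G = "\<lambda>k \<omega>. of_bool (\<eta> y \<omega> = k) * (\<Prod>i<k. hits N u s y (\<lambda>l. driver \<eta> X S (Particle y i l) \<omega>))"
  have G01: "0 \<le> ?G k \<omega>" "?G k \<omega> \<le> 1" for k \<omega>
    using hits_bounds[OF u] by (auto intro!: prod_nonneg prod_le_1)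
  have Gm: "?G k \<in> borel_measurable M" for k
    by (intro borel_measurable_times borel_measurable_prod particle_hits_measurable measurable_compose[OF \<eta>_measurable]) simp
  have int: "integrable M (?G k)" for k
    using G01 by (intro integrable_const_bound[of _ 1] Gm) auto
  have summ: "summable (\<lambda>k. pmf (poi lam) k * ?c ^ k)"
    using summable_norm_cancel[OF summable_poi[OF exp_growth_power, of lam ?c]] lam by simp
  have "(\<lambda>k. LINT \<omega>|M. ?G k \<omega>) sums (LINT \<omega>|M. (\<Sum>k. ?G k \<omega>))"
  proof (rule sums_integral[OF int])
    show "AE \<omega> in M. summable (\<lambda>k. norm (?G k \<omega>))"
      by (intro AE_I2 summable_finite[of "{\<eta> y _}"]) auto
    have "(LINT \<omega>|M. norm (?G k \<omega>)) = pmf (poi lam) k * ?c ^ k" for k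
      using site_block_slice[OF lam u, where y=y and k=k and N=N and s=s] G01(1) by simp
    then show "summable (\<lambda>k. LINT \<omega>|M. norm (?G k \<omega>))" using summ by simp
  qed
  moreover have "(\<Sum>k. ?G k \<omega>) = site_block N u s y \<omega>" for \<omega>
    by (subst suminf_finite[of "{\<eta> y \<omega>}"]) (auto simp: site_block_def)
  ultimately have "(LINT \<omega>|M. site_block N u s y \<omega>) = (\<Sum>k. pmf (poi lam) k * ?c ^ k)"
    by (simp add: sums_iff site_block_slice[OF lam u] del: driver.simps)
  also have "\<dots> = mean (poi lam) (\<lambda>k. ?c ^ k)"
    using lam by (subst expectation_poi[OF exp_growth_power]) auto
  finally show ?thesis using lam by (simp add: poi_pgf)
qed

text \<open>Conditioning on the walker is done by multiplying with this indicator, since only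
  finitely many paths have positive probability.\<close>

definition walker_follows :: "nat \<Rightarrow> (nat \<Rightarrow> int) \<Rightarrow> 'a \<Rightarrow> bool" where
  "walker_follows N s \<omega> \<longleftrightarrow> (\<forall>l<N. driver \<eta> X S (Walker l) \<omega> = s l)"

lemma walker_follows_measurable: "(\<lambda>\<omega>. of_bool (walker_follows N s \<omega>) :: real) \<in> borel_measurable M"
proof -
  have "(\<lambda>\<omega>. of_bool (walker_follows N s \<omega>) :: real) = (\<lambda>\<omega>. \<Prod>l<N. of_bool (driver \<eta> X S (Walker l) \<omega> = s l))"
    unfolding walker_follows_def by (auto simp: fun_eq_iff of_bool_def)
  moreover have "(\<lambda>\<omega>. \<Prod>l<N. of_bool (driver \<eta> X S (Walker l) \<omega> = s l) :: real) \<in> borel_measurable M"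
    by (intro borel_measurable_prod measurable_compose[OF driver_measurable]) simp
  ultimately show ?thesis by simp
qed

lemma prob_walker_follows:
  assumes "s \<in> set_pmf (paths \<pp> N)"
  shows "(LINT \<omega>|M. of_bool (walker_follows N s \<omega>)) = pmf (paths \<pp> N) s"
proof -
  let ?V = "\<lambda>\<omega> l. if l \<in> {..<N} then driver \<eta> X S (Walker l) \<omega> else 0"
  have s0: "s l = 0" if "\<not> l < N" for l
    using assms set_Pi_pmf_subset[of "{..<N}" 0 "\<lambda>_. nn_step_pmf \<pp>"] that by (auto simp: paths_def)
  have "walker_follows N s \<omega> \<longleftrightarrow> ?V \<omega> = s" for \<omega>
    unfolding walker_follows_def fun_eq_iff using s0 by (auto simp del: driver.simps)
  then have "(LINT \<omega>|M. of_bool (walker_follows N s \<omega>) :: real) = (LINT \<omega>|M. of_bool (?V \<omega> = s))" by simp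
  also have "\<dots> = (LINT e|distr M (count_space UNIV) ?V. of_bool (e = s))"
    by (rule integral_distr[symmetric, OF measurable_finite_vector(2)]) (auto intro: driver_measurable simp del: driver.simps)
  finally show ?thesis unfolding walker_steps_law by (simp add: mean_indicator_pmf)
qed

lemma mean_walker_site_blocks:
  assumes lam: "lam > 0" and u: "\<And>n. 0 \<le> u n \<and> u n \<le> 1" and s: "s \<in> set_pmf (paths \<pp> N)" and Y: "finite Y"
  shows "(LINT \<omega>|M. of_bool (walker_follows N s \<omega>) * (\<Prod>y\<in>Y. site_block N u s y \<omega>))
    = pmf (paths \<pp> N) s * (\<Prod>y\<in>Y. exp (lam * (mean (paths (1/2) N) (hits N u s y) - 1)))"
proof -
  \<comment> \<open>\<open>None\<close> stands for the walker, \<open>Some y\<close> for the initial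
    number at \<open>y\<close> together with all its particles.\<close>
  let ?L = "insert None (Some ` Y)"
  let ?K = "\<lambda>j. case j of None \<Rightarrow> range Walker | Some y \<Rightarrow> insert (Initial y) {Particle y i l |i l. True}"
  let ?\<Psi> = "\<lambda>j a. case j of None \<Rightarrow> (\<Prod>l<N. of_bool (a (Walker l) = s l))
    | Some y \<Rightarrow> (\<Prod>i<nat (a (Initial y)). hits N u s y (\<lambda>l. a (Particle y i l)))"
  let ?F = "\<lambda>j \<omega>. ?\<Psi> j (restrict (\<lambda>i. driver \<eta> X S i \<omega>) (?K j))"
  have ind: "indep_vars (\<lambda>_. borel) ?F ?L"
  proof (rule independent_groups)
    show "disjoint_family_on ?K ?L" by (auto simp: disjoint_family_on_def split: option.splits)
    show "?\<Psi> j \<in> borel_measurable (PiM (?K j) (\<lambda>_. count_space UNIV))" for j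
    proof (cases j)
      case None
      have "(\<lambda>a. \<Prod>l<N. of_bool (a (Walker l) = s l) :: real) \<in> borel_measurable (PiM (range Walker) (\<lambda>_. count_space UNIV))"
        by (intro borel_measurable_prod measurable_compose[OF measurable_PiM_coordinate]) auto
      then show ?thesis using None by simp
    next
      case (Some y)
      let ?N = "PiM (insert (Initial y) {Particle y i l |i l. True}) (\<lambda>_. count_space UNIV) :: (source \<Rightarrow> int) measure"
      have n: "(\<lambda>a. nat (a (Initial y))) \<in> measurable ?N (count_space UNIV)"
        by (rule measurable_compose[OF measurable_PiM_coordinate]) auto
      have "(\<lambda>a. \<Prod>i<k. hits N u s y (\<lambda>l. a (Particle y i l))) \<in> borel_measurable ?N" for k
        by (intro borel_measurable_prod hits_measurable measurable_PiM_coordinate) auto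
      from measurable_compose_countable[OF this n] show ?thesis using Some by simp
    qed
  qed
  have F1: "?F None \<omega> = of_bool (walker_follows N s \<omega>)" for \<omega>
    unfolding walker_follows_def by (auto simp: of_bool_def simp del: driver.simps)
  have F2: "?F (Some y) \<omega> = site_block N u s y \<omega>" for y \<omega>
  proof -
    have "restrict (\<lambda>i. driver \<eta> X S i \<omega>) (?K (Some y)) (Particle y i l) = driver \<eta> X S (Particle y i l) \<omega>" for i l
      by (auto simp del: driver.simps)
    then show ?thesis by (simp add: site_block_def del: driver.simps(2))
  qed
  have meas: "?F j \<in> borel_measurable M" if "j \<in> ?L" for j
    using ind that by (auto simp: indep_vars_def2)
  have int: "integrable M (?F j)" if "j \<in> ?L" for j
  proof (rule integrable_const_bound[OF _ meas[OF that]])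
    show "AE \<omega> in M. norm (?F j \<omega>) \<le> 1"
    proof (rule AE_I2)
      show "norm (?F j \<omega>) \<le> 1" for \<omega>
      proof (cases j)
        case None
        show ?thesis unfolding None F1 by simp
      next
        case (Some y)
        show ?thesis unfolding Some F2 using site_block_bounds[OF u] by simp
      qed
    qed
  qed
  have P: "(\<Prod>j\<in>?L. G j) = G None * (\<Prod>y\<in>Y. G (Some y))" for G :: "int option \<Rightarrow> real"
    using Y by (subst prod.insert) (auto simp: prod.reindex)
  have "(LINT \<omega>|M. (\<Prod>j\<in>?L. ?F j \<omega>)) = (\<Prod>j\<in>?L. LINT \<omega>|M. ?F j \<omega>)"
    using Y by (intro indep_vars_lebesgue_integral ind int) auto
  then show ?thesis unfolding P F1 F2 mean_site_block[OF lam u] prob_walker_follows[OF s] by simp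
qed

text \<open>Interchanging the products regroups particles by starting site, where they are
  independent; \<open>occ_pgf\<close> has brought the generating function of the first-meeting
  clouds to the same form.\<close>

lemma field_pgf:
  assumes lam: "lam > 0" and u: "\<And>n. 0 \<le> u n \<and> u n \<le> 1" and s: "s \<in> set_pmf (paths \<pp> N)"
  shows "(LINT \<omega>|M. of_bool (walker_follows N s \<omega>) * (\<Prod>n<N. u n ^ field \<eta> X (Suc n) (pos s (Suc n)) \<omega>))
    = pmf (paths \<pp> N) s * mean (clouds lam N) (\<lambda>L. \<Prod>n<N. u n ^ occ s L n)"
proof -
  let ?Y = "{-(2 * int N)..2 * int N}"
  have bd: "\<bar>pos s n\<bar> \<le> int n" for n by (rule pos_bound[OF s])
  have ae: "AE \<omega> in M. (\<Prod>n<N. u n ^ field \<eta> X (Suc n) (pos s (Suc n)) \<omega>) = (\<Prod>y\<in>?Y. site_block N u s y \<omega>)"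
    using AE_field_eq[of N] AE_space
  proof eventually_elim
    case (elim \<omega>)
    have "(\<Prod>n<N. u n ^ field \<eta> X (Suc n) (pos s (Suc n)) \<omega>)
      = (\<Prod>n<N. \<Prod>y\<in>?Y. \<Prod>i<\<eta> y \<omega>. u n ^ of_bool (X y i (Suc n) \<omega> = pos s (Suc n)))"
    proof (intro prod.cong refl)
      fix n assume "n \<in> {..<N}"
      then have "Suc n \<le> N" "\<bar>pos s (Suc n)\<bar> \<le> int N" using bd[of "Suc n"] by auto
      then have "field \<eta> X (Suc n) (pos s (Suc n)) \<omega> = (\<Sum>y\<in>?Y. \<Sum>i<\<eta> y \<omega>. of_bool (X y i (Suc n) \<omega> = pos s (Suc n)))"
        using elim(1) by blast
      then show "u n ^ field \<eta> X (Suc n) (pos s (Suc n)) \<omega> = (\<Prod>y\<in>?Y. \<Prod>i<\<eta> y \<omega>. u n ^ of_bool (X y i (Suc n) \<omega> = pos s (Suc n)))"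
        by (simp only: power_sum)
    qed
    also have "\<dots> = (\<Prod>y\<in>?Y. \<Prod>n<N. \<Prod>i<\<eta> y \<omega>. u n ^ of_bool (X y i (Suc n) \<omega> = pos s (Suc n)))"
      by (rule prod.swap)
    also have "\<dots> = (\<Prod>y\<in>?Y. \<Prod>i<\<eta> y \<omega>. \<Prod>n<N. u n ^ of_bool (X y i (Suc n) \<omega> = pos s (Suc n)))"
      by (intro prod.cong refl prod.swap)
    also have "\<dots> = (\<Prod>y\<in>?Y. site_block N u s y \<omega>)"
      unfolding site_block_def hits_def particle_pos[OF elim(2)] ..
    finally show ?case .
  qed
  have sbm: "(\<lambda>\<omega>. \<Prod>y\<in>?Y. site_block N u s y \<omega>) \<in> borel_measurable M"
  proof (intro borel_measurable_prod)
    fix y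
    have "(\<lambda>\<omega>. \<Prod>i<k. hits N u s y (\<lambda>l. driver \<eta> X S (Particle y i l) \<omega>)) \<in> borel_measurable M" for k
      by (intro borel_measurable_prod particle_hits_measurable)
    from measurable_compose_countable[OF this \<eta>_measurable[of y]] show "site_block N u s y \<in> borel_measurable M"
      by (simp add: site_block_def[abs_def] del: driver.simps)
  qed
  have fm: "(\<lambda>\<omega>. \<Prod>n<N. u n ^ field \<eta> X (Suc n) (pos s (Suc n)) \<omega>) \<in> borel_measurable M"
    by (intro borel_measurable_prod measurable_compose[OF field_measurable]) simp
  have "(LINT \<omega>|M. of_bool (walker_follows N s \<omega>) * (\<Prod>n<N. u n ^ field \<eta> X (Suc n) (pos s (Suc n)) \<omega>))
     = (LINT \<omega>|M. of_bool (walker_follows N s \<omega>) * (\<Prod>y\<in>?Y. site_block N u s y \<omega>))"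
    using ae by (intro integral_cong_AE borel_measurable_times walker_follows_measurable fm sbm) auto
  also have "\<dots> = pmf (paths \<pp> N) s * (\<Prod>y\<in>?Y. exp (lam * (mean (paths (1/2) N) (hits N u s y) - 1)))"
    by (intro mean_walker_site_blocks lam u s) simp
  also have "(\<Prod>y\<in>?Y. exp (lam * (mean (paths (1/2) N) (hits N u s y) - 1))) = mean (clouds lam N) (\<lambda>L. \<Prod>n<N. u n ^ occ s L n)"
    using lam by (subst occ_pgf[OF _ u bd]) (auto simp: exp_sum sum_distrib_left)
  finally show ?thesis .
qed

lemma field_joint_law:
  assumes lam: "lam > 0" and s: "s \<in> set_pmf (paths \<pp> N)"
  shows "(LINT \<omega>|M. of_bool (walker_follows N s \<omega>) * (\<Prod>n<N. of_bool (field \<eta> X (Suc n) (pos s (Suc n)) \<omega> = k n)))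
    = pmf (paths \<pp> N) s * mean (clouds lam N) (\<lambda>L. \<Prod>n<N. of_bool (occ s L n = k n))"
proof -
  have "(LINT \<omega>|M. of_bool (walker_follows N s \<omega>) * (\<Prod>n<N. of_bool (field \<eta> X (Suc n) (pos s (Suc n)) \<omega> = k n)))
    = (LINT L|measure_pmf (clouds lam N). pmf (paths \<pp> N) s * (\<Prod>n<N. of_bool (occ s L n = k n)))"
  proof (rule pgf_unique)
    show "finite_measure M" by (rule finite_measure_axioms)
    show "finite_measure (measure_pmf (clouds lam N))" by (rule measure_pmf.finite_measure_axioms)
    show "(LINT \<omega>|M. of_bool (walker_follows N s \<omega>) * (\<Prod>n<N. u n ^ field \<eta> X (Suc n) (pos s (Suc n)) \<omega>))
      = (LINT L|measure_pmf (clouds lam N). pmf (paths \<pp> N) s * (\<Prod>n<N. u n ^ occ s L n))"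
      if "\<And>i. 0 \<le> u i \<and> u i \<le> 1" for u :: "nat \<Rightarrow> real"
      using field_pgf[OF lam that s] by simp
  qed (auto intro: field_measurable walker_follows_measurable pmf_le_1)
  then show ?thesis by simp
qed

text \<open>The functional starts at time 1, so component \<open>n\<close> belongs to time
  \<open>n + 1\<close>, in accordance with the indexing of blocks. The default 0 keeps the values in
  a countable set.\<close>

definition field_vector :: "nat \<Rightarrow> 'a \<Rightarrow> nat \<Rightarrow> nat" where
  "field_vector N \<omega> = (\<lambda>n. if n \<in> {..<N} then field \<eta> X (Suc n) (S (Suc n) \<omega>) \<omega> else 0)"

lemma field_vector_measurable: "field_vector N \<in> measurable M (count_space UNIV)"
  unfolding field_vector_def[abs_def]
  by (rule measurable_finite_vector(2)) (auto intro: field_at_walker_measurable)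

lemma AE_walker_follows_some: "AE \<omega> in M. (\<Sum>s\<in>set_pmf (paths \<pp> N). of_bool (walker_follows N s \<omega>)) = (1::real)"
proof -
  let ?V = "\<lambda>\<omega> l. if l \<in> {..<N} then driver \<eta> X S (Walker l) \<omega> else 0"
  have m: "?V \<in> measurable M (count_space UNIV)"
    by (rule measurable_finite_vector(2)) (auto intro: driver_measurable simp del: driver.simps)
  have "AE e in distr M (count_space UNIV) ?V. e \<in> set_pmf (paths \<pp> N)"
    unfolding walker_steps_law by (simp add: AE_measure_pmf)
  then have "AE \<omega> in M. ?V \<omega> \<in> set_pmf (paths \<pp> N)"
    using m by (subst (asm) AE_distr_iff) auto
  then show ?thesis
  proof eventually_elim
    case (elim \<omega>)
    have "walker_follows N s \<omega> \<longleftrightarrow> s = ?V \<omega>" if "s \<in> set_pmf (paths \<pp> N)" for s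
    proof -
      have s0: "s l = 0" if "\<not> l < N" for l
        using \<open>s \<in> _\<close> set_Pi_pmf_subset[of "{..<N}" 0 "\<lambda>_. nn_step_pmf \<pp>"] that by (auto simp: paths_def)
      show ?thesis unfolding walker_follows_def fun_eq_iff using s0 by (auto simp del: driver.simps)
    qed
    then have "(\<Sum>s\<in>set_pmf (paths \<pp> N). of_bool (walker_follows N s \<omega>)) = (\<Sum>s\<in>set_pmf (paths \<pp> N). of_bool (s = ?V \<omega>) :: real)"
      by (intro sum.cong) auto
    also have "\<dots> = (\<Sum>s\<in>{?V \<omega>}. 1)"
      using elim finite_set_paths by (intro sum.mono_neutral_cong_right) auto
    finally show ?case by simp
  qed
qed

lemma field_vector_law:
  assumes lam: "lam > 0"
  shows "distr M (count_space UNIV) (field_vector N)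
    = measure_pmf (map_pmf (\<lambda>x n. if n \<in> {..<N} then occ_blocks x n else 0) (blocks \<pp> lam N))"
proof (rule measure_eqI_countable_AE[of _ _ "PiE_dflt {..<N} 0 (\<lambda>_. UNIV)"])
  let ?C = "PiE_dflt {..<N} 0 (\<lambda>_. UNIV) :: (nat \<Rightarrow> nat) set"
  let ?v = "\<lambda>x n. if n \<in> {..<N} then occ_blocks x n else 0"
  let ?A = "set_pmf (paths \<pp> N)"
  show "countable ?C" by (rule countable_PiE_dflt) simp
  show "AE x in distr M (count_space UNIV) (field_vector N). x \<in> ?C"
    using field_vector_measurable by (subst AE_distr_iff) (auto simp: field_vector_def PiE_dflt_def)
  show "AE x in measure_pmf (map_pmf ?v (blocks \<pp> lam N)). x \<in> ?C"
    by (auto simp: AE_measure_pmf_iff PiE_dflt_def)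
  fix k :: "nat \<Rightarrow> nat" assume k: "k \<in> ?C"
  let ?f = "\<lambda>s \<omega>. of_bool (walker_follows N s \<omega>) * (\<Prod>n<N. of_bool (field \<eta> X (Suc n) (pos s (Suc n)) \<omega> = k n)) :: real"
  have fm: "?f s \<in> borel_measurable M" for s
    by (intro borel_measurable_times walker_follows_measurable borel_measurable_prod measurable_compose[OF field_measurable]) simp
  have fi: "integrable M (?f s)" for s
    by (rule integrable_const_bound[of _ 1]) (auto intro: fm simp: abs_mult abs_prod intro!: mult_le_one prod_le_1 prod_nonneg)
  have "measure (distr M (count_space UNIV) (field_vector N)) {k} = (LINT z|distr M (count_space UNIV) (field_vector N). indicator {k} z)"
    by simp
  also have "\<dots> = (LINT \<omega>|M. indicator {k} (field_vector N \<omega>))"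
    by (rule integral_distr[OF field_vector_measurable]) simp
  \<comment> \<open>Almost surely exactly one path is followed, and on that event the random
    positions of the walker may be replaced by those of \<open>s\<close>.\<close>
  also have "\<dots> = (LINT \<omega>|M. (\<Sum>s\<in>?A. ?f s \<omega>))"
  proof (rule integral_cong_AE)
    show "(\<lambda>\<omega>. indicator {k} (field_vector N \<omega>) :: real) \<in> borel_measurable M"
      by (rule measurable_compose[OF field_vector_measurable]) simp
    show "(\<lambda>\<omega>. \<Sum>s\<in>?A. ?f s \<omega>) \<in> borel_measurable M" by (intro borel_measurable_sum fm)
    show "AE \<omega> in M. indicator {k} (field_vector N \<omega>) = (\<Sum>s\<in>?A. ?f s \<omega>)"
      using AE_walker_follows_some[of N] AE_space
    proof eventually_elim
      case (elim \<omega>)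
      have "?f s \<omega> = of_bool (walker_follows N s \<omega>) * indicator {k} (field_vector N \<omega>)" for s
      proof (cases "walker_follows N s \<omega>")
        case True
        have "S (Suc n) \<omega> = pos s (Suc n)" if "n < N" for n
          unfolding walker_pos[OF elim(2)] pos_def using True that
          by (intro sum.cong) (auto simp: walker_follows_def simp del: driver.simps)
        then have "field_vector N \<omega> = k \<longleftrightarrow> (\<forall>n<N. field \<eta> X (Suc n) (pos s (Suc n)) \<omega> = k n)"
          using k by (auto simp: field_vector_def fun_eq_iff PiE_dflt_def)
        then show ?thesis using True by (simp add: prod_of_bool_lessThan indicator_def)
      qed simp
      then have "(\<Sum>s\<in>?A. ?f s \<omega>) = (\<Sum>s\<in>?A. of_bool (walker_follows N s \<omega>)) * indicator {k} (field_vector N \<omega>)"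
        by (simp only: sum_distrib_right)
      then show ?case using elim(1) by simp
    qed
  qed
  also have "\<dots> = (\<Sum>s\<in>?A. LINT \<omega>|M. ?f s \<omega>)" using fi by (rule Bochner_Integration.integral_sum)
  also have "\<dots> = (\<Sum>s\<in>?A. pmf (paths \<pp> N) s * mean (clouds lam N) (\<lambda>L. \<Prod>n<N. of_bool (occ s L n = k n)))"
    by (intro sum.cong refl field_joint_law lam)
  also have "\<dots> = mean (paths \<pp> N) (\<lambda>s. mean (clouds lam N) (\<lambda>L. \<Prod>n<N. of_bool (occ s L n = k n)))"
    by (subst integral_measure_pmf[of ?A]) (auto simp: finite_set_paths)
  also have "\<dots> = mean (pair_pmf (paths \<pp> N) (clouds lam N)) (\<lambda>z. \<Prod>n<N. of_bool (occ (fst z) (snd z) n = k n))"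
    unfolding prod_of_bool_lessThan by (subst expectation_pair_pmf_iterated) (auto intro: integrable_of_bool)
  also have "\<dots> = mean (blocks \<pp> lam N) (\<lambda>x. \<Prod>n<N. of_bool (occ_blocks x n = k n))"
    unfolding occ_blocks_def mean_blocks[symmetric] ..
  also have "\<dots> = mean (blocks \<pp> lam N) (\<lambda>x. of_bool (?v x = k))"
  proof (intro Bochner_Integration.integral_cong refl)
    fix x
    have "?v x = k \<longleftrightarrow> (\<forall>n<N. occ_blocks x n = k n)" using k by (auto simp: fun_eq_iff PiE_dflt_def)
    then show "(\<Prod>n<N. of_bool (occ_blocks x n = k n)) = (of_bool (?v x = k) :: real)" by (auto simp: of_bool_def)
  qed
  also have "\<dots> = pmf (map_pmf ?v (blocks \<pp> lam N)) k" by (simp add: pmf_map_mean)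
  finally show "emeasure (distr M (count_space UNIV) (field_vector N)) {k} = emeasure (measure_pmf (map_pmf ?v (blocks \<pp> lam N))) {k}"
  proof -
    interpret D: prob_space "distr M (count_space UNIV) (field_vector N)"
      by (rule prob_space_distr[OF field_vector_measurable])
    assume "measure (distr M (count_space UNIV) (field_vector N)) {k} = pmf (map_pmf ?v (blocks \<pp> lam N)) k"
    then show ?thesis by (simp add: D.emeasure_eq_measure emeasure_pmf_single)
  qed
qed simp_all

lemma additive_functional_eq:
  "additive_functional \<phi> \<eta> X S N \<omega> = (\<Sum>n<N. \<phi> (real (field_vector N \<omega> n)))"
proof -
  have "additive_functional \<phi> \<eta> X S N \<omega> = (\<Sum>n<N. \<phi> (real (field \<eta> X (Suc n) (S (Suc n) \<omega>) \<omega>)))"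
    unfolding additive_functional_def
    by (intro sum.reindex_bij_witness[of _ Suc "\<lambda>n. n - 1"]) auto
  then show ?thesis by (simp add: field_vector_def)
qed

lemma expectation_additive_functional:
  assumes "lam > 0"
  shows "(LINT \<omega>|M. G (additive_functional \<phi> \<eta> X S N \<omega>)) = mean (blocks \<pp> lam N) (\<lambda>x. G (\<Sum>n<N. \<phi> (real (occ_blocks x n))) :: real)"
proof -
  let ?G = "\<lambda>k. G (\<Sum>n<N. \<phi> (real (k n)))"
  have "(LINT \<omega>|M. G (additive_functional \<phi> \<eta> X S N \<omega>)) = (LINT \<omega>|M. ?G (field_vector N \<omega>))"
    unfolding additive_functional_eq ..
  also have "\<dots> = (LINT k|distr M (count_space UNIV) (field_vector N). ?G k)"
    by (rule integral_distr[symmetric, OF field_vector_measurable]) simp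
  also have "\<dots> = mean (blocks \<pp> lam N) (\<lambda>x. ?G (\<lambda>n. if n \<in> {..<N} then occ_blocks x n else 0))"
    unfolding field_vector_law[OF assms] by simp
  finally show ?thesis by simp
qed

lemma overlap_eq: "overlap M S q t = overlap_mean \<pp> q t"
proof -
  let ?V = "\<lambda>\<omega> l. if l \<in> {..<t} then driver \<eta> X S (Walker l) \<omega> else 0"
  have m: "?V \<in> measurable M (count_space UNIV)"
    by (rule measurable_finite_vector(2)) (auto intro: driver_measurable simp del: driver.simps)
  have "overlap M S q t = (LINT \<omega>|M. srw_trans t (pos (?V \<omega>) t) ^ q)"
    unfolding overlap_def
    by (intro Bochner_Integration.integral_cong refl arg_cong[where f="\<lambda>z. srw_trans t z ^ q"])
       (subst walker_pos, simp, auto simp: pos_def simp del: driver.simps intro!: sum.cong)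
  also have "\<dots> = (LINT e|distr M (count_space UNIV) ?V. srw_trans t (pos e t) ^ q)"
    by (rule integral_distr[symmetric, OF m]) simp
  also have "\<dots> = mean (paths \<pp> t) (\<lambda>e. srw_trans t (pos e t - pos e 0) ^ q)"
    unfolding walker_steps_law by (simp add: pos_def)
  also have "\<dots> = overlap_mean \<pp> q t"
    using mean_pos_increment[of 0 t t \<pp> "\<lambda>x. srw_trans t x ^ q"] by (simp add: overlap_mean_def)
  finally show ?thesis .
qed

end

subsection \<open>Variance and normal approximation\<close>

text \<open>\<open>b\<close> lists the Charlier coefficients of the observable. The sum defining
  \<open>g\<close> starts at 1 because \<open>b 0\<close> is the mean; a nonzero top coefficient
  makes the single-site variance positive.\<close>

locale charlier_functional =
  fixes lam p :: real and k :: nat and b :: "nat \<Rightarrow> real"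
  assumes lam: "lam > 0" and p: "0 < p" "p < 1" "p \<noteq> 1/2" and k: "k \<ge> 1" and bk: "b k \<noteq> 0"
begin

definition g :: "nat \<Rightarrow> real" where "g x = (\<Sum>q=1..k. b q * charlier lam q (real x))"

definition weight :: "nat \<Rightarrow> real" where "weight q = (b q)\<^sup>2 * fact q * lam ^ q"

definition cov :: "nat \<Rightarrow> real" where "cov t = (\<Sum>q=1..k. weight q * overlap_mean p q t)"

definition V0 :: real where "V0 = (\<Sum>q=1..k. weight q)"

definition asym_var :: real where "asym_var = (\<Sum>q=1..k. weight q * (1 + 2 * (\<Sum>t. overlap_mean p q (Suc t))))"

lemma exp_growth_g: "exp_growth g"
  unfolding g_def[abs_def]
  using exp_growth_charlier[of lam _ 0] by (intro exp_growth_sum exp_growth_cmult) simp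

lemma weight_nonneg: "weight q \<ge> 0" using lam by (simp add: weight_def)

lemma V0_pos: "V0 > 0"
proof -
  have "0 < weight k" using lam bk by (simp add: weight_def)
  also have "weight k \<le> V0" unfolding V0_def using k weight_nonneg by (intro member_le_sum) auto
  finally show ?thesis .
qed

lemma mean_g_product_two_point:
  assumes "0 \<le> \<rho>" "\<rho> \<le> 1"
  shows "mean (two_point lam \<rho>) (\<lambda>z. g (fst z) * g (snd z)) = (\<Sum>q=1..k. weight q * \<rho> ^ q)"
proof -
  have e: "exp_growth (\<lambda>k. charlier lam q (real k))" for q using exp_growth_charlier[of lam q 0] by simp
  have I: "integrable (measure_pmf (two_point lam \<rho>)) (\<lambda>z. charlier lam q (real (fst z)) * charlier lam r (real (snd z)))" for q r
    using lam assms by (intro expectation_two_point(2) e) auto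
  have "mean (two_point lam \<rho>) (\<lambda>z. g (fst z) * g (snd z))
    = mean (two_point lam \<rho>) (\<lambda>z. \<Sum>q=1..k. \<Sum>r=1..k. b q * b r * (charlier lam q (real (fst z)) * charlier lam r (real (snd z))))"
    unfolding g_def sum_product by (intro Bochner_Integration.integral_cong refl sum.cong) (simp add: mult_ac)
  also have "\<dots> = (\<Sum>q=1..k. \<Sum>r=1..k. b q * b r * mean (two_point lam \<rho>) (\<lambda>z. charlier lam q (real (fst z)) * charlier lam r (real (snd z))))"
    using I by simp
  also have "\<dots> = (\<Sum>q=1..k. \<Sum>r=1..k. if r = q then b q * b q * (fact q * (lam * \<rho>) ^ q) else 0)"
    using lam assms by (intro sum.cong refl) (simp add: two_point_charlier)
  also have "\<dots> = (\<Sum>q=1..k. b q * b q * (fact q * (lam * \<rho>) ^ q))" by (intro sum.cong refl) simp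
  finally show ?thesis by (simp add: weight_def power2_eq_square power_mult_distrib mult_ac)
qed

lemma mean_g: "mean (poi lam) g = 0"
proof -
  have e: "exp_growth (\<lambda>k. charlier lam q (real k))" for q using exp_growth_charlier[of lam q 0] by simp
  have I: "integrable (measure_pmf (poi lam)) (\<lambda>x. charlier lam q (real x))" for q
    using lam by (intro integrable_poi e) auto
  have z: "mean (poi lam) (\<lambda>x. charlier lam q (real x)) = 0" if "q \<ge> 1" for q
    using charlier_orthogonal[of lam q 0] lam that by simp
  have "mean (poi lam) g = (\<Sum>q=1..k. b q * mean (poi lam) (\<lambda>x. charlier lam q (real x)))"
    unfolding g_def[abs_def] using I by simp
  then show ?thesis using z by simp
qed

definition v :: "nat \<Rightarrow> (nat \<Rightarrow> int \<times> (nat \<Rightarrow> int) list) \<Rightarrow> real" where "v n x = g (occ_blocks x n)"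

lemma L4_v: "n < N \<Longrightarrow> L4 (blocks p lam N) (v n)"
  unfolding v_def[abs_def] using lam by (intro L4_occ exp_growth_g) auto

lemma mean_v: "n < N \<Longrightarrow> mean (blocks p lam N) (v n) = 0"
  using mean_g lam integral_map_pmf[of "\<lambda>x. occ_blocks x n" "blocks p lam N" g]
  by (simp add: occ_blocks_law v_def[abs_def])

lemma mean_v_sq: assumes "n < N" shows "mean (blocks p lam N) (\<lambda>x. v n x * v n x) = V0"
proof -
  have "mean (blocks p lam N) (\<lambda>x. v n x * v n x) = mean (poi lam) (\<lambda>y. g y * g y)"
    using lam assms integral_map_pmf[of "\<lambda>x. occ_blocks x n" "blocks p lam N" "\<lambda>y. g y * g y"]
    by (simp add: occ_blocks_law v_def)
  \<comment> \<open>Overlap 1 leaves private parts of rate 0, so both coordinates coincide and the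
    single-site variance is a case of the two-point formula.\<close>
  also have "\<dots> = mean (two_point lam 1) (\<lambda>z. g (fst z) * g (snd z))"
  proof -
    have "two_point lam 1 = map_pmf (\<lambda>x. (x, x)) (poi lam)"
      by (simp add: two_point_def poi_def[of 0] pair_return_pmf1 pair_return_pmf2 pmf.map_comp o_def)
    then show ?thesis by simp
  qed
  also have "\<dots> = V0" by (simp add: mean_g_product_two_point V0_def)
  finally show ?thesis .
qed

text \<open>Given the walker, the two occupation numbers have the two-point law whose overlap is the
  transition probability at the walker's increment. Averaging over that increment turns powers of
  the overlap into its moments.\<close>

lemma mean_v_product:
  assumes mn: "m < n" "n < N"
  shows "mean (blocks p lam N) (\<lambda>x. v m x * v n x) = cov (n - m)"
proof -
  let ?\<rho> = "\<lambda>s. srw_trans (n - m) (pos s (Suc n) - pos s (Suc m))"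
  have I: "integrable (measure_pmf (pair_pmf (paths p N) (clouds lam N))) (\<lambda>z. g (occ (fst z) (snd z) m) * g (occ (fst z) (snd z) n))"
    using L4_integrable2[OF L4_v[of m N] L4_v[of n N]] mn
    by (simp add: v_def occ_blocks_def flip: map_unzip_blocks)
  have "mean (blocks p lam N) (\<lambda>x. v m x * v n x)
    = mean (pair_pmf (paths p N) (clouds lam N)) (\<lambda>z. g (occ (fst z) (snd z) m) * g (occ (fst z) (snd z) n))"
    unfolding v_def occ_blocks_def mean_blocks[symmetric] ..
  also have "\<dots> = mean (paths p N) (\<lambda>s. mean (clouds lam N) (\<lambda>L. g (occ s L m) * g (occ s L n)))"
    by (subst expectation_pair_pmf_iterated[OF I]) simp
  also have "\<dots> = mean (paths p N) (\<lambda>s. \<Sum>q=1..k. weight q * ?\<rho> s ^ q)"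
  proof (intro integral_cong_AE AE_pmfI)
    fix s assume s: "s \<in> set_pmf (paths p N)"
    have "mean (clouds lam N) (\<lambda>L. g (occ s L m) * g (occ s L n))
      = mean (map_pmf (\<lambda>L. (occ s L m, occ s L n)) (clouds lam N)) (\<lambda>z. g (fst z) * g (snd z))" by simp
    also have "\<dots> = mean (two_point lam (?\<rho> s)) (\<lambda>z. g (fst z) * g (snd z))"
      using lam by (subst occ_two_point[OF _ mn pos_bound[OF s]]) auto
    also have "\<dots> = (\<Sum>q=1..k. weight q * ?\<rho> s ^ q)"
      by (intro mean_g_product_two_point srw_trans_bounds)
    finally show "mean (clouds lam N) (\<lambda>L. g (occ s L m) * g (occ s L n)) = (\<Sum>q=1..k. weight q * ?\<rho> s ^ q)" .
  qed auto
  also have "\<dots> = (\<Sum>q=1..k. weight q * mean (paths p N) (\<lambda>s. ?\<rho> s ^ q))" by simp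
  also have "\<dots> = cov (n - m)"
    unfolding cov_def overlap_mean_def
    using mean_pos_increment[of "Suc m" "Suc n" N p "\<lambda>x. srw_trans (n - m) x ^ _"] mn by simp
  finally show ?thesis .
qed

definition f :: "nat \<Rightarrow> (nat \<Rightarrow> int \<times> (nat \<Rightarrow> int) list) \<Rightarrow> real" where "f N x = (\<Sum>n<N. v n x)"

lemma mean_f: "mean (blocks p lam N) (f N) = 0"
  unfolding f_def[abs_def] using L4_integrable[OF L4_v] mean_v by simp

text \<open>The number of summands and the number of blocks are separate parameters because the
  block space itself changes with \<open>N\<close>; the induction runs over the summands on a fixed
  space.\<close>

lemma second_moment_f: "M \<le> N \<Longrightarrow> mean (blocks p lam N) (\<lambda>x. (f M x)\<^sup>2) = real M * V0 + 2 * (\<Sum>n<M. \<Sum>t<n. cov (Suc t))"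
proof (induction M)
  case (Suc M)
  have L: "L4 (blocks p lam N) (v n)" if "n \<le> M" for n using Suc.prems that by (intro L4_v) auto
  have fL: "L4 (blocks p lam N) (f M)" unfolding f_def[abs_def] by (intro L4_sum L) auto
  have I: "integrable (measure_pmf (blocks p lam N)) (\<lambda>x. v n x * v M x)" if "n < M" for n
    using L4_integrable2[OF L L] that by auto
  have I': "integrable (measure_pmf (blocks p lam N)) (\<lambda>x. (f M x)\<^sup>2)" "integrable (measure_pmf (blocks p lam N)) (\<lambda>x. v M x * v M x)"
    using L4_integrable_sq[OF fL] L4_integrable2[OF L L] by auto
  have "mean (blocks p lam N) (\<lambda>x. (f (Suc M) x)\<^sup>2)
    = mean (blocks p lam N) (\<lambda>x. (f M x)\<^sup>2 + v M x * v M x + 2 * (\<Sum>n<M. v n x * v M x))"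
  proof (intro Bochner_Integration.integral_cong refl)
    fix x
    have "(\<Sum>n<M. v n x * v M x) = f M x * v M x" by (simp add: f_def sum_distrib_right)
    moreover have "f (Suc M) x = f M x + v M x" by (simp add: f_def)
    ultimately show "(f (Suc M) x)\<^sup>2 = (f M x)\<^sup>2 + v M x * v M x + 2 * (\<Sum>n<M. v n x * v M x)"
      by (simp add: power2_eq_square algebra_simps)
  qed
  also have "\<dots> = mean (blocks p lam N) (\<lambda>x. (f M x)\<^sup>2) + mean (blocks p lam N) (\<lambda>x. v M x * v M x)
      + 2 * (\<Sum>n<M. mean (blocks p lam N) (\<lambda>x. v n x * v M x))"
  proof -
    have "integrable (measure_pmf (blocks p lam N)) (\<lambda>x. \<Sum>n<M. v n x * v M x)"
      by (intro Bochner_Integration.integrable_sum I) auto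
    moreover have "mean (blocks p lam N) (\<lambda>x. \<Sum>n<M. v n x * v M x) = (\<Sum>n<M. mean (blocks p lam N) (\<lambda>x. v n x * v M x))"
      by (intro Bochner_Integration.integral_sum I) auto
    ultimately show ?thesis using I' by simp
  qed
  also have "mean (blocks p lam N) (\<lambda>x. v M x * v M x) = V0" using Suc.prems by (intro mean_v_sq) auto
  also have "(\<Sum>n<M. mean (blocks p lam N) (\<lambda>x. v n x * v M x)) = (\<Sum>n<M. cov (M - n))"
    using Suc.prems by (intro sum.cong refl mean_v_product) auto
  also have "\<dots> = (\<Sum>t<M. cov (Suc t))"
    by (intro sum.reindex_bij_witness[of _ "\<lambda>t. M - Suc t" "\<lambda>n. M - Suc n"]) (auto simp: Suc_diff_Suc)
  finally show ?case using Suc by (simp add: algebra_simps)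
qed (simp add: f_def)

definition var_f :: "nat \<Rightarrow> real" where "var_f N = mean (blocks p lam N) (\<lambda>x. (f N x)\<^sup>2)"

lemma cov_nonneg: "cov t \<ge> 0"
  unfolding cov_def using weight_nonneg overlap_mean_nonneg by (intro sum_nonneg mult_nonneg_nonneg)

lemma var_f_ge: "var_f N \<ge> real N * V0"
  unfolding var_f_def by (subst second_moment_f) (auto intro!: sum_nonneg cov_nonneg)

lemma summable_overlap: "q \<ge> 1 \<Longrightarrow> summable (\<lambda>t. overlap_mean p q (Suc t))"
proof -
  assume q: "q \<ge> 1"
  obtain \<rho> where r: "0 < \<rho>" "\<rho> < 1" "\<And>q t. q \<ge> 1 \<Longrightarrow> overlap_mean p q t \<le> \<rho> ^ t"
    using overlap_mean_decay[OF p] by blast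
  show ?thesis
  proof (rule summable_comparison_test'[where N=0])
    show "summable (\<lambda>t. \<rho> ^ Suc t)" using r by (simp add: summable_geometric summable_mult)
    show "norm (overlap_mean p q (Suc t)) \<le> \<rho> ^ Suc t" for t
      using r(3)[OF q, of "Suc t"] overlap_mean_nonneg[of p q "Suc t"] by simp
  qed
qed

lemma summable_cov: "summable (\<lambda>t. cov (Suc t))"
  unfolding cov_def by (intro summable_sum summable_mult summable_overlap) auto

lemma asym_var_eq: "asym_var = V0 + 2 * (\<Sum>t. cov (Suc t))"
proof -
  have "(\<Sum>t. cov (Suc t)) = (\<Sum>q=1..k. \<Sum>t. weight q * overlap_mean p q (Suc t))"
    unfolding cov_def by (intro suminf_sum summable_mult summable_overlap) auto
  also have "\<dots> = (\<Sum>q=1..k. weight q * (\<Sum>t. overlap_mean p q (Suc t)))"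
    by (intro sum.cong refl suminf_mult summable_overlap) auto
  finally show ?thesis
    by (simp add: asym_var_def V0_def distrib_left sum.distrib sum_distrib_left mult_ac)
qed

lemma asym_var_pos: "asym_var > 0"
  unfolding asym_var_eq using V0_pos suminf_nonneg[OF summable_cov cov_nonneg] by linarith

text \<open>The deviation from linear growth is twice a sum of tails of the covariance series. The
  tails decay geometrically, so their sum stays bounded.\<close>

lemma var_f_asymptotic: "\<exists>B. \<forall>N. \<bar>var_f N - asym_var * real N\<bar> \<le> B"
proof -
  obtain \<rho> where r: "0 < \<rho>" "\<rho> < 1" "\<And>q t. q \<ge> 1 \<Longrightarrow> overlap_mean p q t \<le> \<rho> ^ t"
    using overlap_mean_decay[OF p] by blast
  have cov: "cov t \<le> V0 * \<rho> ^ t" for t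
    unfolding cov_def V0_def sum_distrib_right using weight_nonneg r(3) by (intro sum_mono mult_left_mono) auto
  have tail: "(\<Sum>t. cov (Suc t)) - (\<Sum>t<n. cov (Suc t)) \<le> V0 / (1 - \<rho>) * \<rho> ^ n" 
    "(\<Sum>t<n. cov (Suc t)) \<le> (\<Sum>t. cov (Suc t))" for n
  proof -
    have "(\<Sum>t. cov (Suc t)) - (\<Sum>t<n. cov (Suc t)) = (\<Sum>t. cov (Suc (t + n)))"
      using suminf_split_initial_segment[OF summable_cov, of n] by simp
    also have "\<dots> \<le> (\<Sum>t. V0 * \<rho> ^ n * \<rho> ^ t)"
    proof (intro suminf_le)
      show "cov (Suc (t + n)) \<le> V0 * \<rho> ^ n * \<rho> ^ t" for t
      proof -
        have "cov (Suc (t + n)) \<le> V0 * \<rho> ^ Suc (t + n)" by (rule cov)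
        also have "\<dots> \<le> V0 * \<rho> ^ (t + n)" using r V0_pos by (intro mult_left_mono power_decreasing) auto
        finally show ?thesis by (simp add: power_add mult_ac)
      qed
      show "summable (\<lambda>t. cov (Suc (t + n)))" using summable_cov by (subst summable_iff_shift[of "\<lambda>t. cov (Suc t)"])
      show "summable (\<lambda>t. V0 * \<rho> ^ n * \<rho> ^ t)" using r by (intro summable_mult summable_geometric) auto
    qed
    also have "\<dots> = V0 * \<rho> ^ n * (1 / (1 - \<rho>))"
      using r by (subst suminf_mult) (auto simp: suminf_geometric summable_geometric)
    finally show "(\<Sum>t. cov (Suc t)) - (\<Sum>t<n. cov (Suc t)) \<le> V0 / (1 - \<rho>) * \<rho> ^ n" by simp
    show "(\<Sum>t<n. cov (Suc t)) \<le> (\<Sum>t. cov (Suc t))"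
      by (intro sum_le_suminf summable_cov) (auto simp: cov_nonneg)
  qed
  let ?D = "\<lambda>n. (\<Sum>t. cov (Suc t)) - (\<Sum>t<n. cov (Suc t))"
  have "\<bar>var_f N - asym_var * real N\<bar> \<le> 2 * (V0 / (1 - \<rho>) * (1 / (1 - \<rho>)))" for N
  proof -
    have "asym_var * real N - var_f N = 2 * (\<Sum>n<N. ?D n)"
      unfolding var_f_def asym_var_eq by (subst second_moment_f) (auto simp: sum_subtractf algebra_simps)
    moreover have "0 \<le> (\<Sum>n<N. ?D n)" using tail(2) by (intro sum_nonneg) auto
    moreover have "(\<Sum>n<N. ?D n) \<le> V0 / (1 - \<rho>) * (1 / (1 - \<rho>))"
    proof -
      have "(\<Sum>n<N. ?D n) \<le> (\<Sum>n<N. V0 / (1 - \<rho>) * \<rho> ^ n)" by (intro sum_mono tail)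
      also have "\<dots> = V0 / (1 - \<rho>) * (\<Sum>n\<in>{0..<N}. \<rho> ^ (n - 0))" by (simp add: sum_distrib_left lessThan_atLeast0)
      also have "\<dots> \<le> V0 / (1 - \<rho>) * (\<rho> ^ (0 - 0) / (1 - \<rho>))"
        using r V0_pos by (intro mult_left_mono geometric_tail_le) auto
      finally show ?thesis by simp
    qed
    ultimately show ?thesis by linarith
  qed
  then show ?thesis by blast
qed

lemma normal_approximation:
  "\<exists>C>0. \<forall>N\<ge>1. \<forall>h. 1-lipschitz_on UNIV h \<longrightarrow>
    \<bar>mean (blocks p lam N) (\<lambda>x. h (f N x / sqrt (var_f N))) - normal_mean h\<bar> \<le> C * real N powr (- 1/2)"
proof -
  obtain \<rho> where r: "0 < \<rho>" "\<rho> < 1" "\<And>q t. q \<ge> 1 \<Longrightarrow> overlap_mean p q t \<le> \<rho> ^ t"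
    using overlap_mean_decay[OF p] by blast
  \<comment> \<open>The sixteenth root, because \<open>occ_influence\<close> consumes sixteen powers
    of \<theta> per unit of time.\<close>
  define \<theta> where "\<theta> = root 16 \<rho>"
  have th: "0 < \<theta>" "\<theta> < 1" "\<theta> ^ 16 = \<rho>" using r by (auto simp: \<theta>_def real_root_lt_1_iff)
  define K where "K = 128 * mean (poi lam) (\<lambda>k. g k ^ 8) + lam / (1 - \<theta> ^ 16) / (1 - \<theta> ^ 8)"
  define K1 where "K1 = K / (1 - \<theta>) ^ 4"
  have K: "K \<ge> 0" unfolding K_def using th lam by (intro add_nonneg_nonneg mult_nonneg_nonneg divide_nonneg_nonneg) (auto simp: power_le_one)
  have K1: "K1 \<ge> 0" using K by (simp add: K1_def)
  \<comment> \<open>3 and 26 are the bounds on the derivative of the Stein solution and on its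
    Lipschitz constant. \<open>V0\<close> stands for the variance per summand, by
    \<open>var_f_ge\<close>; both error terms are then of order 1 / sqrt N.\<close>
  define C where "C = 3 * sqrt (17 * K1 / (1 - \<theta>)\<^sup>2) / V0 + 26 * (1 + K1) / (2 * sqrt V0 ^ 3)"
  have C: "C > 0" unfolding C_def using K1 V0_pos by (intro add_nonneg_pos divide_nonneg_pos divide_pos_pos) auto
  have "\<bar>mean (blocks p lam N) (\<lambda>x. h (f N x / sqrt (var_f N))) - normal_mean h\<bar> \<le> C * real N powr (- 1/2)"
    if N: "N \<ge> 1" and h: "1-lipschitz_on UNIV h" for N h
  proof -
    interpret cf: causal_functional N "(0, [])" "block p lam N" v K \<theta>
      unfolding v_def[abs_def] K_def using lam th r by (intro occ_causal_functional exp_growth_g) auto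
    have Q: "cf.Q = blocks p lam N" by (simp add: cf.Q_def blocks_def)
    have ff: "cf.f = f N" by (simp add: fun_eq_iff cf.f_def f_def)
    have KK: "cf.K1 = K1" by (simp add: cf.K1_def K1_def)
    let ?s = "sqrt (var_f N)"
    have vpos: "0 < real N * V0" using N V0_pos by simp
    then have vf: "var_f N > 0" using var_f_ge[of N] by linarith
    have s: "?s > 0" using vf by simp
    obtain G G' where G: "\<And>x. (G has_real_derivative G' x) (at x)" "\<And>x. \<bar>G' x\<bar> \<le> 3"
      "\<And>x y. \<bar>G' x - G' y\<bar> \<le> 26 * \<bar>x - y\<bar>" "\<And>x. G' x - x * G x = h x - normal_mean h"
      by (rule stein_equation_solution[OF h], rule that; assumption)
    have fs: "L4 (blocks p lam N) (\<lambda>x. f N x / ?s)" using L4_cmult[OF cf.f_L4, of "1 / ?s"] by (simp add: Q ff)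
    have I1: "integrable (measure_pmf (blocks p lam N)) (\<lambda>x. G' (f N x / ?s))"
      by (rule L4_integrable, rule L4_bounded[of _ 3]) (rule G(2))
    have I2: "integrable (measure_pmf (blocks p lam N)) (\<lambda>x. h (f N x / ?s))"
    proof (rule L4_integrable)
      have "L4 (blocks p lam N) (\<lambda>x. h (f N x / ?s) - h 0)"
      proof (rule L4_mono[OF fs])
        show "\<bar>h (f N x / ?s) - h 0\<bar> \<le> \<bar>f N x / ?s\<bar>" for x
          using lip_abs[OF h, of "f N x / ?s" 0] by simp
      qed
      from L4_add[OF this L4_const[of _ "h 0"]] show "L4 (blocks p lam N) (\<lambda>x. h (f N x / ?s))" by simp
    qed
    have "f N x / ?s * G (f N x / ?s) = G' (f N x / ?s) - (h (f N x / ?s) - normal_mean h)" for x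
      using G(4)[of "f N x / ?s"] by linarith
    then have "mean (blocks p lam N) (\<lambda>x. f N x / ?s * G (f N x / ?s))
      = mean (blocks p lam N) (\<lambda>x. G' (f N x / ?s)) - (mean (blocks p lam N) (\<lambda>x. h (f N x / ?s)) - normal_mean h)"
      using I1 I2 by simp
    then have "\<bar>mean (blocks p lam N) (\<lambda>x. h (f N x / ?s)) - normal_mean h\<bar>
      = \<bar>mean (blocks p lam N) (\<lambda>x. G' (f N x / ?s)) - mean (blocks p lam N) (\<lambda>x. f N x / ?s * G (f N x / ?s))\<bar>"
      by simp
    also have "\<dots> \<le> 3 * sqrt (17 * K1 * N / (1 - \<theta>)\<^sup>2) / ?s\<^sup>2 + 26 * real N * (1 + K1) / (2 * ?s ^ 3)"
    proof -
      have N0: "0 < N" using N by simp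
      have m: "mean cf.Q cf.f = 0" unfolding Q ff by (rule mean_f)
      have "mean cf.Q (\<lambda>x. (cf.f x)\<^sup>2) = var_f N" unfolding Q ff var_f_def ..
      also have "\<dots> = ?s\<^sup>2" using vf by simp
      finally have vv: "mean cf.Q (\<lambda>x. (cf.f x)\<^sup>2) = ?s\<^sup>2" .
      show ?thesis using cf.stein_discrepancy[OF N0 s m vv G(1-3)] unfolding Q ff KK .
    qed
    also have "\<dots> \<le> 3 * sqrt (17 * K1 * N / (1 - \<theta>)\<^sup>2) / (real N * V0) + 26 * real N * (1 + K1) / (2 * sqrt (real N * V0) ^ 3)"
    proof (intro add_mono divide_left_mono)
      show "real N * V0 \<le> ?s\<^sup>2" using var_f_ge[of N] vf by simp
      show "2 * sqrt (real N * V0) ^ 3 \<le> 2 * ?s ^ 3" using var_f_ge[of N] vpos by (intro mult_left_mono power_mono) auto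
    qed (use K1 s vf vpos th in auto)
    also have "\<dots> = C * (1 / sqrt N)"
    proof -
      have n: "real N = sqrt N * sqrt N" by simp
      have n0: "sqrt N > 0" using N by simp
      have a: "3 * sqrt (17 * K1 * N / (1 - \<theta>)\<^sup>2) / (real N * V0) = 3 * sqrt (17 * K1 / (1 - \<theta>)\<^sup>2) / V0 * (1 / sqrt N)"
      proof -
        have "sqrt (17 * K1 * N / (1 - \<theta>)\<^sup>2) = sqrt (17 * K1 / (1 - \<theta>)\<^sup>2) * sqrt N"
          by (simp flip: real_sqrt_mult add: mult_ac)
        then have "3 * sqrt (17 * K1 * N / (1 - \<theta>)\<^sup>2) / (real N * V0)
          = 3 * (sqrt (17 * K1 / (1 - \<theta>)\<^sup>2) * sqrt N) / ((sqrt N * sqrt N) * V0)" using n by simp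
        also have "\<dots> = 3 * sqrt (17 * K1 / (1 - \<theta>)\<^sup>2) / V0 * (1 / sqrt N)" 
        proof -
          have "3 * (x * y) / ((y * y) * z) = 3 * x / z * (1 / y)" if "y > 0" for x y z :: real
            using that by simp
          from this[OF n0] show ?thesis .
        qed
        finally show ?thesis .
      qed
      have b: "26 * real N * (1 + K1) / (2 * sqrt (real N * V0) ^ 3) = 26 * (1 + K1) / (2 * sqrt V0 ^ 3) * (1 / sqrt N)"
      proof -
        have "26 * real N * (1 + K1) / (2 * sqrt (real N * V0) ^ 3)
          = 26 * (sqrt N * sqrt N) * (1 + K1) / (2 * (sqrt N * sqrt V0) ^ 3)" by (simp add: real_sqrt_mult)
        also have "\<dots> = 26 * (1 + K1) / (2 * sqrt V0 ^ 3) * (1 / sqrt N)"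
        proof -
          have "26 * (y * y) * c / (2 * (y * z) ^ 3) = 26 * c / (2 * z ^ 3) * (1 / y)" if "y > 0" for c y z :: real
            using that by (simp add: power3_eq_cube)
          from this[OF n0] show ?thesis .
        qed
        finally show ?thesis .
      qed
      show ?thesis unfolding a b C_def by (simp only: distrib_right)
    qed
    also have "1 / sqrt N = real N powr (- 1/2)"
      using N by (simp add: powr_minus powr_half_sqrt inverse_eq_divide)
    finally show ?thesis .
  qed
  then show ?thesis using C by blast
qed

end

section \<open>Transfer from the blocks to the model\<close>

lemma charlier_coeff_expansion:
  assumes lam: "lam > 0" and b: "\<And>x. \<phi> x = (\<Sum>q\<le>k. b q * charlier lam q x)" and q: "q \<le> k"
  shows "charlier_coeff lam \<phi> q = b q"
proof -
  have e: "exp_growth (\<lambda>k. charlier lam q (real k))" for q using exp_growth_charlier[of lam q 0] by simp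
  have I: "integrable (measure_pmf (poi lam)) (\<lambda>m. charlier lam r (real m) * charlier lam q (real m))" for r
    using lam by (intro integrable_poi exp_growth_mult e) auto
  have P: "poisson_pmf lam = poi lam" using lam by (simp add: poi_def)
  have "mean (poi lam) (\<lambda>m. \<phi> (real m) * charlier lam q (real m))
    = (\<Sum>r\<le>k. b r * mean (poi lam) (\<lambda>m. charlier lam r (real m) * charlier lam q (real m)))"
    using I by (simp add: b sum_distrib_right mult.assoc)
  also have "\<dots> = (\<Sum>r\<le>k. if r = q then b q * (fact q * lam ^ q) else 0)"
    using lam by (intro sum.cong) (auto simp: charlier_orthogonal)
  also have "\<dots> = b q * (fact q * lam ^ q)" using q by simp
  finally show ?thesis using lam by (simp add: charlier_coeff_def P)
qed

theorem theorem1p4: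
  fixes lam \<pp> :: real and k :: nat and \<beta> :: "nat \<Rightarrow> real" and \<phi> :: "real \<Rightarrow> real"
  assumes "lam > 0" and "0 < \<pp>" and "\<pp> < 1" and "\<pp> \<noteq> 1 / 2"
    and "k \<ge> 1" and "\<And>x. \<phi> x = (\<Sum>j\<le>k. \<beta> j * x ^ j)" and "\<beta> k \<noteq> 0"
  shows "(\<exists>C>0. \<forall>(M :: 'a measure) \<eta> X S. walk_in_poisson_field M lam \<pp> \<eta> X S \<longrightarrow>
            (\<forall>N\<ge>1. wasserstein_dist
                     (distr M borel (standardized M (additive_functional \<phi> \<eta> X S N)))
                     std_normal_distribution
                   \<le> ereal (C * real N powr (- 1 / 2))))
       \<and> (\<exists>c>0. \<forall>(M :: 'a measure) \<eta> X S. walk_in_poisson_field M lam \<pp> \<eta> X S \<longrightarrow>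
            (\<lambda>N. prob_space.variance M (additive_functional \<phi> \<eta> X S N) - c * real N) \<in> O(\<lambda>_. 1)
          \<and> (\<forall>q\<in>{1..k}. summable (\<lambda>t. overlap M S q (Suc t)))
          \<and> c = (\<Sum>q=1..k. (charlier_coeff lam \<phi> q)\<^sup>2 * fact q * lam ^ q
                   * (1 + 2 * (\<Sum>t. overlap M S q (Suc t)))))"
proof -
  obtain b where b: "\<And>x. (\<Sum>j\<le>k. \<beta> j * x ^ j) = (\<Sum>q\<le>k. b q * charlier lam q x)" and bk: "b k = \<beta> k"
    using charlier_expansion by metis
  \<comment> \<open>The constants come from this interpretation, which sees only the parameters and
    the coefficients; so they are the same for all realizations of the model.\<close>
  interpret charlier_functional lam \<pp> k b
    using assms bk by unfold_locales auto
  have phi: "\<phi> x = (\<Sum>q\<le>k. b q * charlier lam q x)" for x using assms(6) b by simp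
  have phi_g: "\<phi> (real x) = b 0 + g x" for x
  proof -
    have "{..k} = insert 0 {1..k}" by auto
    then show ?thesis unfolding phi g_def by simp
  qed
  have sum_phi: "(\<Sum>n<N. \<phi> (real (occ_blocks x n))) = real N * b 0 + f N x" for N x
    by (simp add: phi_g f_def v_def sum.distrib)
  have fI: "integrable (measure_pmf (blocks \<pp> lam N)) (f N)" for N
    unfolding f_def[abs_def] using L4_integrable[OF L4_v] by (intro Bochner_Integration.integrable_sum) auto
  have moments: "prob_space.expectation M (additive_functional \<phi> \<eta> X S N) = real N * b 0"
    "prob_space.variance M (additive_functional \<phi> \<eta> X S N) = var_f N"
    if "walk_in_poisson_field M lam \<pp> \<eta> X S" for M :: "'a measure" and \<eta> X S N
  proof -
    interpret W: walk_in_poisson_field M lam \<pp> \<eta> X S by fact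
    show e: "prob_space.expectation M (additive_functional \<phi> \<eta> X S N) = real N * b 0"
      using W.expectation_additive_functional[OF lam, of "\<lambda>y. y" \<phi> N] fI[of N] mean_f[of N] by (simp add: sum_phi)
    show "prob_space.variance M (additive_functional \<phi> \<eta> X S N) = var_f N"
      unfolding e var_f_def
      using W.expectation_additive_functional[OF lam, of "\<lambda>y. (y - real N * b 0)\<^sup>2" \<phi> N] by (simp add: sum_phi)
  qed
  obtain C where C: "C > 0" "\<And>N h. N \<ge> 1 \<Longrightarrow> 1-lipschitz_on UNIV h \<Longrightarrow>
    \<bar>mean (blocks \<pp> lam N) (\<lambda>x. h (f N x / sqrt (var_f N))) - normal_mean h\<bar> \<le> C * real N powr (- 1/2)"
    using normal_approximation by blast
  have "wasserstein_dist (distr M borel (standardized M (additive_functional \<phi> \<eta> X S N))) std_normal_distribution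
      \<le> ereal (C * real N powr (- 1 / 2))"
    if W: "walk_in_poisson_field M lam \<pp> \<eta> X S" and N: "N \<ge> 1" for M :: "'a measure" and \<eta> X S N
    unfolding wasserstein_dist_def
  proof (rule SUP_least)
    interpret W: walk_in_poisson_field M lam \<pp> \<eta> X S by fact
    fix h :: "real \<Rightarrow> real" assume "h \<in> {h. 1-lipschitz_on UNIV h}"
    then have h: "1-lipschitz_on UNIV h" by simp
    have [measurable]: "h \<in> borel_measurable borel" by (rule lip_borel[OF h])
    have [measurable]: "additive_functional \<phi> \<eta> X S N \<in> borel_measurable M" by (rule W.additive_functional_measurable)
    have "(LINT x|distr M borel (standardized M (additive_functional \<phi> \<eta> X S N)). h x)
      = (LINT \<omega>|M. h (standardized M (additive_functional \<phi> \<eta> X S N) \<omega>))"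
      by (rule integral_distr) (auto simp: standardized_def[abs_def])
    \<comment> \<open>The variance is rewritten before the mean, which occurs inside it. Then
      \<open>b 0\<close> cancels and only \<open>f N\<close> is left.\<close>
    also have "\<dots> = mean (blocks \<pp> lam N) (\<lambda>x. h (f N x / sqrt (var_f N)))"
      unfolding standardized_def moments(2)[OF W] unfolding moments(1)[OF W]
      using W.expectation_additive_functional[OF lam, of "\<lambda>y. h ((y - real N * b 0) / sqrt (var_f N))" \<phi> N]
      by (simp add: sum_phi)
    finally have 1: "(LINT x|distr M borel (standardized M (additive_functional \<phi> \<eta> X S N)). h x)
      = mean (blocks \<pp> lam N) (\<lambda>x. h (f N x / sqrt (var_f N)))" .
    have 2: "(LINT x|std_normal_distribution. h x) = normal_mean h"
      unfolding normal_mean_def by (subst integral_density) auto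
    show "ereal \<bar>(LINT x|distr M borel (standardized M (additive_functional \<phi> \<eta> X S N)). h x)
        - (LINT x|std_normal_distribution. h x)\<bar> \<le> ereal (C * real N powr (- 1 / 2))"
      unfolding 1 2 using C(2)[OF N h] by simp
  qed
  moreover have "(\<lambda>N. prob_space.variance M (additive_functional \<phi> \<eta> X S N) - asym_var * real N) \<in> O(\<lambda>_. 1)
          \<and> (\<forall>q\<in>{1..k}. summable (\<lambda>t. overlap M S q (Suc t)))
          \<and> asym_var = (\<Sum>q=1..k. (charlier_coeff lam \<phi> q)\<^sup>2 * fact q * lam ^ q
                   * (1 + 2 * (\<Sum>t. overlap M S q (Suc t))))"
    if W: "walk_in_poisson_field M lam \<pp> \<eta> X S" for M :: "'a measure" and \<eta> X S
  proof (intro conjI ballI)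
    interpret W: walk_in_poisson_field M lam \<pp> \<eta> X S by fact
    obtain B where "\<And>N. \<bar>var_f N - asym_var * real N\<bar> \<le> B" using var_f_asymptotic by blast
    then show "(\<lambda>N. prob_space.variance M (additive_functional \<phi> \<eta> X S N) - asym_var * real N) \<in> O(\<lambda>_. 1)"
      unfolding moments(2)[OF W] by (intro bigoI[of _ B]) simp
    show "summable (\<lambda>t. overlap M S q (Suc t))" if "q \<in> {1..k}" for q
      unfolding W.overlap_eq using that by (intro summable_overlap) auto
    show "asym_var = (\<Sum>q=1..k. (charlier_coeff lam \<phi> q)\<^sup>2 * fact q * lam ^ q * (1 + 2 * (\<Sum>t. overlap M S q (Suc t))))"
      unfolding asym_var_def weight_def W.overlap_eq
      by (intro sum.cong refl) (simp add: charlier_coeff_expansion[where b=b and k=k, OF lam phi])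
  qed
  ultimately show ?thesis using C(1) asym_var_pos by blast
qed

end
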